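(* \begin{enumerate} \item There are infinitely many connected graphs $F$ with $D'(F)\le\frac23\,v(F)+1$. \item For every connected graph $F$, $W'(F)>\frac23\,v(F)-2$. \end{enumerate}
   Context: Graphs are finite and simple; $v(F)$ denotes the number of vertices of $F$. First-order sentences are over the vocabulary $\{\sim,=\}$ (adjacency and equality). A first-order sentence $\Phi$ defines a class of graphs $\mathcal C$ asymptotically over connected graphs if there is an integer $N$ such that for every connected graph $G$ with at least $N$ vertices, $G\models\Phi$ iff $G\in\mathcal C$. For a graph $F$, let $\mathcal C_F$ be the class of graphs containing a (not necessarily induced) subgraph isomorphic to $F$. $D'(F)$ is the minimum quantifier depth of a sentence defining $\mathcal C_F$ asymptotically over connected graphs, and $W'(F)$ is the minimum variable width (number of distinct first-order variables used) of such a sentence. *)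

theory Defs
  imports "Graph_Theory.Graph_Theory"
begin

text \<open>
  A finite simple graph is a \<^const>\<open>pair_graph\<close>: a finite vertex set with a symmetric irreflexive
  set of arcs, the edge between \<open>u\<close> and \<open>v\<close> being the two arcs \<open>(u, v)\<close> and \<open>(v, u)\<close>.
  Vertices are natural numbers, so every finite graph occurs up to isomorphism.
\<close>

type_synonym ngraph = "nat pair_pre_digraph"

abbreviation v_count :: "ngraph \<Rightarrow> nat" where
  "v_count G \<equiv> card (pverts G)"

definition connected_graph :: "ngraph \<Rightarrow> bool" where
  "connected_graph G \<longleftrightarrow> pair_graph G \<and> Digraph_Component.connected (with_proj G)"

definition graph_iso :: "ngraph \<Rightarrow> ngraph \<Rightarrow> bool" where
  "graph_iso F G \<longleftrightarrow> digraph_iso (with_proj F) (with_proj G)"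

definition containing :: "ngraph \<Rightarrow> ngraph set" where
  "containing F =
     {G. pair_graph G \<and>
         (\<exists>H. pair_graph H \<and> subgraph (with_proj H) (with_proj G) \<and> graph_iso F H)}"

text \<open>
  The only atomic formulas are adjacency and equality of variables. There are no propositional
  constants, so every sentence uses at least one variable; otherwise the width of an asymptotically
  trivial class, such as that of the graphs containing the path on three vertices, would be zero.
\<close>

datatype fo =
    Adj nat nat
  | Eq nat nat
  | Neg fo
  | Conj fo fo
  | Disj fo fo
  | Exi nat fo
  | All nat fo

primrec sat :: "ngraph \<Rightarrow> (nat \<Rightarrow> nat) \<Rightarrow> fo \<Rightarrow> bool" where
  "sat G e (Adj x y) \<longleftrightarrow> (e x, e y) \<in> parcs G"
| "sat G e (Eq x y) \<longleftrightarrow> e x = e y"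
| "sat G e (Neg p) \<longleftrightarrow> \<not> sat G e p"
| "sat G e (Conj p q) \<longleftrightarrow> sat G e p \<and> sat G e q"
| "sat G e (Disj p q) \<longleftrightarrow> sat G e p \<or> sat G e q"
| "sat G e (Exi x p) \<longleftrightarrow> (\<exists>a\<in>pverts G. sat G (e(x := a)) p)"
| "sat G e (All x p) \<longleftrightarrow> (\<forall>a\<in>pverts G. sat G (e(x := a)) p)"

primrec free_vars :: "fo \<Rightarrow> nat set" where
  "free_vars (Adj x y) = {x, y}"
| "free_vars (Eq x y) = {x, y}"
| "free_vars (Neg p) = free_vars p"
| "free_vars (Conj p q) = free_vars p \<union> free_vars q"
| "free_vars (Disj p q) = free_vars p \<union> free_vars q"
| "free_vars (Exi x p) = free_vars p - {x}"
| "free_vars (All x p) = free_vars p - {x}"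

primrec all_vars :: "fo \<Rightarrow> nat set" where
  "all_vars (Adj x y) = {x, y}"
| "all_vars (Eq x y) = {x, y}"
| "all_vars (Neg p) = all_vars p"
| "all_vars (Conj p q) = all_vars p \<union> all_vars q"
| "all_vars (Disj p q) = all_vars p \<union> all_vars q"
| "all_vars (Exi x p) = insert x (all_vars p)"
| "all_vars (All x p) = insert x (all_vars p)"

primrec qdepth :: "fo \<Rightarrow> nat" where
  "qdepth (Adj x y) = 0"
| "qdepth (Eq x y) = 0"
| "qdepth (Neg p) = qdepth p"
| "qdepth (Conj p q) = max (qdepth p) (qdepth q)"
| "qdepth (Disj p q) = max (qdepth p) (qdepth q)"
| "qdepth (Exi x p) = Suc (qdepth p)"
| "qdepth (All x p) = Suc (qdepth p)"

definition width :: "fo \<Rightarrow> nat" where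
  "width p = card (all_vars p)"

definition sentence :: "fo \<Rightarrow> bool" where
  "sentence p \<longleftrightarrow> free_vars p = {}"

definition models :: "ngraph \<Rightarrow> fo \<Rightarrow> bool" where
  "models G p \<longleftrightarrow> (\<forall>e. range e \<subseteq> pverts G \<longrightarrow> sat G e p)"

definition defines_asymptotically :: "fo \<Rightarrow> ngraph set \<Rightarrow> bool" where
  "defines_asymptotically p C \<longleftrightarrow>
     sentence p \<and>
     (\<exists>N. \<forall>G. connected_graph G \<and> N \<le> v_count G \<longrightarrow> (models G p \<longleftrightarrow> G \<in> C))"

definition D' :: "ngraph \<Rightarrow> nat" where
  "D' F = (LEAST d. \<exists>p. defines_asymptotically p (containing F) \<and> qdepth p = d)"

definition W' :: "ngraph \<Rightarrow> nat" where
  "W' F = (LEAST w. \<exists>p. defines_asymptotically p (containing F) \<and> width p = w)"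


text \<open>
  Both minima range over nonempty sets: \<open>F\<close>-containment is defined by the existential closure of
  the positive diagram of \<open>F\<close>, with the vertices of \<open>F\<close> as variables.
\<close>

lemma containing_iff:
  assumes F: "pair_graph F" and G: "pair_graph G"
  shows "G \<in> containing F \<longleftrightarrow>
    (\<exists>f. inj_on f (pverts F) \<and> f ` pverts F \<subseteq> pverts G \<and> (\<forall>(u, v)\<in>parcs F. (f u, f v) \<in> parcs G))"
    (is "_ \<longleftrightarrow> (\<exists>f. ?P f)")
proof
  assume "G \<in> containing F"
  then obtain H h where H: "subgraph (with_proj H) (with_proj G)"
    and h: "pre_digraph.digraph_isomorphism (with_proj F) h" "with_proj H = app_iso h (with_proj F)"
    unfolding containing_def graph_iso_def digraph_iso_def by blast
  have eqs: "pverts H = iso_verts h ` pverts F" "parcs H = iso_arcs h ` parcs F"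
    "fst = iso_tail h" "snd = iso_head h"
    using h(2) by (auto simp: with_proj_def app_iso_def)
  have arc: "iso_arcs h a = (iso_verts h (fst a), iso_verts h (snd a))" if "a \<in> parcs F" for a
    using h(1) that unfolding pre_digraph.digraph_isomorphism_def
    by (metis eqs(3,4) prod.collapse with_proj_simps(2,4,5))
  have sub: "pverts H \<subseteq> pverts G" "parcs H \<subseteq> parcs G"
    using H by (auto simp: subgraph_def)
  have "inj_on (iso_verts h) (pverts F)"
    using h(1) unfolding pre_digraph.digraph_isomorphism_def by simp
  moreover have "(iso_verts h u, iso_verts h v) \<in> parcs G" if "(u, v) \<in> parcs F" for u v
    using arc[OF that] sub(2) that unfolding eqs(2) by force
  ultimately have "?P (iso_verts h)" using sub(1) unfolding eqs(1) by blast
  then show "\<exists>f. ?P f" by (intro exI[of _ "iso_verts h"])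
next
  assume "\<exists>f. ?P f"
  then obtain f where f: "?P f" ..
  interpret F: pair_graph F by fact
  interpret G: pair_graph G by fact
  define H where "H = \<lparr>pverts = f ` pverts F, parcs = map_prod f f ` parcs F\<rparr>"
  have H: "pair_graph H"
  proof
    show "symmetric (with_proj H)"
      using F.arcs_symmetric by (auto simp: symmetric_def H_def intro!: symI)
  next
    fix a assume "a \<in> parcs H"
    then obtain x y where xy: "(x, y) \<in> parcs F" and a: "a = (f x, f y)" by (auto simp: H_def)
    have "x \<in> pverts F" "y \<in> pverts F" "x \<noteq> y"
      using F.wellformed'[OF xy] F.no_loops'[OF xy] by auto
    then show "fst a \<noteq> snd a" using f a by (auto dest: inj_onD)
  qed (use F.wellformed' F.pair_finite_verts F.pair_finite_arcs
       in \<open>auto simp: H_def\<close>)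
  interpret H: pair_graph H by (rule H)
  have "subgraph (with_proj H) (with_proj G)"
    using f H.wf_digraph G.wf_digraph by (auto simp: subgraph_def compatible_def H_def)
  moreover have "graph_iso F H"
  proof -
    let ?h = "\<lparr>iso_verts = f, iso_arcs = map_prod f f, iso_head = snd, iso_tail = fst\<rparr>"
    have "inj_on (map_prod f f) (parcs F)"
      using f F.wellformed' by (auto simp: inj_on_def)
    then have "pre_digraph.digraph_isomorphism (with_proj F) ?h"
      using f F.wf_digraph by (auto simp: pre_digraph.digraph_isomorphism_def)
    moreover have "with_proj H = app_iso ?h (with_proj F)"
      by (simp add: with_proj_def app_iso_def H_def)
    ultimately show ?thesis unfolding graph_iso_def digraph_iso_def by blast
  qed
  ultimately show "G \<in> containing F" using G H by (auto simp: containing_def)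
qed

lemma sat_foldr_Conj:
  "sat G e (foldr Conj ps q) \<longleftrightarrow> (\<forall>p\<in>set ps. sat G e p) \<and> sat G e q"
  by (induction ps) auto

lemma sat_foldr_Exi:
  "sat G e (foldr Exi xs p) \<longleftrightarrow>
    (\<exists>e'. e' ` set xs \<subseteq> pverts G \<and> (\<forall>x. x \<notin> set xs \<longrightarrow> e' x = e x) \<and> sat G e' p)"
proof (induction xs arbitrary: e)
  case Nil
  have "e' = e" if "\<forall>x. e' x = e x" for e' using that by auto
  then show ?case by auto
next
  case (Cons x xs)
  show ?case (is "?L \<longleftrightarrow> ?R")
  proof
    assume ?L
    then obtain a e' where a: "a \<in> pverts G" "e' ` set xs \<subseteq> pverts G"
      "\<forall>y. y \<notin> set xs \<longrightarrow> e' y = (e(x := a)) y" "sat G e' p"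
      using Cons.IH by auto
    have "e' x \<in> pverts G" using a by (cases "x \<in> set xs") auto
    with a show ?R by (intro exI[of _ e']) auto
  next
    assume ?R
    then obtain e' where "e' ` set (x # xs) \<subseteq> pverts G"
      "\<forall>y. y \<notin> set (x # xs) \<longrightarrow> e' y = e y" "sat G e' p" by blast
    then have "e' x \<in> pverts G \<and> sat G (e(x := e' x)) (foldr Exi xs p)"
      unfolding Cons.IH by auto
    then show ?L by auto
  qed
qed

lemma free_vars_foldr_Exi: "free_vars (foldr Exi xs p) = free_vars p - set xs"
  by (induction xs) auto

lemma free_vars_foldr_Conj:
  "free_vars (foldr Conj ps q) = (\<Union>p\<in>set ps. free_vars p) \<union> free_vars q"
  by (induction ps) auto

lemma ex_defines_asymptotically:
  assumes "connected_graph F"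
  shows "\<exists>p. defines_asymptotically p (containing F)"
proof -
  have F: "pair_graph F" and ne: "pverts F \<noteq> {}"
    using assms
    by (auto simp: connected_graph_def Digraph_Component.connected_def strongly_connected_def
        mk_symmetric_def)
  interpret F: pair_graph F by fact
  obtain v where v: "v \<in> pverts F" using ne by blast
  obtain vs where vs: "set vs = pverts F" using F.pair_finite_verts finite_list by blast
  obtain as where as: "set as = parcs F" using F.pair_finite_arcs finite_list by blast
  define ps where "ps = map (\<lambda>(x, y). Adj x y) as @
    map (\<lambda>(x, y). Neg (Eq x y)) (filter (\<lambda>(x, y). x \<noteq> y) (List.product vs vs))"
  define p where "p = foldr Exi vs (foldr Conj ps (Eq v v))"
  have "sentence p"
    using F.wellformed' v
    by (auto simp: sentence_def p_def free_vars_foldr_Exi free_vars_foldr_Conj ps_def vs as)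
  moreover have "models G p \<longleftrightarrow> G \<in> containing F" if G: "connected_graph G" for G
  proof -
    have G': "pair_graph G" and "pverts G \<noteq> {}"
      using G
      by (auto simp: connected_graph_def Digraph_Component.connected_def strongly_connected_def
          mk_symmetric_def)
    then obtain b where b: "b \<in> pverts G" by blast
    have body: "sat G f (foldr Conj ps (Eq v v)) \<longleftrightarrow>
        (\<forall>(x, y)\<in>parcs F. (f x, f y) \<in> parcs G) \<and> inj_on f (pverts F)" for f
    proof -
      have "(\<forall>q\<in>set (map (\<lambda>(x, y). Adj x y) as). sat G f q) \<longleftrightarrow>
          (\<forall>(x, y)\<in>parcs F. (f x, f y) \<in> parcs G)"
        by (simp add: as split_beta)
      moreover have "(\<forall>q\<in>set (map (\<lambda>(x, y). Neg (Eq x y))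
          (filter (\<lambda>(x, y). x \<noteq> y) (List.product vs vs))). sat G f q) \<longleftrightarrow> inj_on f (pverts F)"
        by (simp add: vs split_beta inj_on_def) blast
      ultimately show ?thesis
        unfolding sat_foldr_Conj ps_def set_append ball_Un by simp
    qed
    have *: "sat G e p \<longleftrightarrow> (\<exists>f. inj_on f (pverts F) \<and> f ` pverts F \<subseteq> pverts G \<and>
        (\<forall>(u, v)\<in>parcs F. (f u, f v) \<in> parcs G))" (is "_ \<longleftrightarrow> (\<exists>f. ?P f)") for e
    proof
      assume "sat G e p"
      then obtain f where "f ` pverts F \<subseteq> pverts G" "sat G f (foldr Conj ps (Eq v v))"
        unfolding p_def sat_foldr_Exi vs by blast
      then have "?P f" unfolding body by blast
      then show "\<exists>f. ?P f" by (intro exI[of _ f])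
    next
      assume "\<exists>f. ?P f"
      then obtain f where f: "?P f" ..
      define g where "g = (\<lambda>x. if x \<in> pverts F then f x else e x)"
      have "sat G g (foldr Conj ps (Eq v v))"
        unfolding body using f by (auto simp: inj_on_def g_def dest: F.wellformed')
      moreover have "g ` pverts F \<subseteq> pverts G" using f by (auto simp: g_def)
      ultimately show "sat G e p"
        unfolding p_def sat_foldr_Exi vs by (intro exI[of _ g]) (auto simp: g_def)
    qed
    have "range (\<lambda>_ :: nat. b) \<subseteq> pverts G" using b by auto
    moreover have "sat G e p \<longleftrightarrow> G \<in> containing F" for e
      by (rule trans[OF * containing_iff[OF F G', symmetric]])
    ultimately show ?thesis unfolding models_def by meson
  qed
  ultimately show ?thesis unfolding defines_asymptotically_def by blast
qed

end

theory Submission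
  imports Defs
begin

text \<open>
  \<^bold>\<open>Lower bound.\<close> Enlarging a class of twins that already has \<open>k\<close> elements is invisible to \<open>k\<close>
  variables. Hence, if \<open>k\<close> variables define \<open>F\<close>-containment, then \<open>F\<close> embeds into a clique on \<open>k + 1\<close>
  vertices with an arbitrarily long path, an arbitrarily large star, or a path ending in such a star
  attached to it. If \<open>k\<close> is at most \<open>2/3 v(F) - 2\<close>, so that at least \<open>v(F)/3 + 1\<close> vertices lie
  outside the clique, this forces \<open>F\<close> to be a broom: a star with one pendant path. A broom is
  excluded by a complete bipartite graph with a pendant path and a large star attached to a vertex of the smaller side: the path of the
  broom is too long to start there, so the broom has to occupy \<open>2/3 v(F)\<close> twins of the larger side.

  \<^bold>\<open>Upper bound.\<close> The broom with \<open>a - 1\<close> leaves and a path with \<open>2a\<close> edges has \<open>3a\<close> vertices. In a large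
  connected graph it is present if every vertex starts a path with \<open>2a\<close> edges and some vertex has \<open>a\<close>
  neighbours: look at a vertex of huge degree or, if there is none, at a vertex of degree at least
  \<open>a\<close> and one far from it. If \<open>v\<close> starts no such path, consider a copy with centre \<open>x\<close>. We find
  vertices \<open>W\<close> on its path such that the adjacency to \<open>W\<close> splits the remaining neighbours of \<open>x\<close>
  in the copy into classes of at most \<open>2a - |W|\<close> elements. After \<open>x\<close> and \<open>W\<close> have been pebbled, the rest of the
  path and each single class can be pebbled separately within \<open>2a + 1\<close> moves, and counting the classes
  recovers the leaves. If there were no such \<open>W\<close>, then leaves could be
  inserted between consecutive neighbours of \<open>x\<close> on the path often enough to give a
  path with \<open>2a\<close> edges that starts at \<open>v\<close>.
\<close>

section \<open>Graphs, sentences and twins\<close>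

lemma pair_graph_adj_verts:
  assumes "pair_graph G" "(u, v) \<in> parcs G"
  shows "u \<in> pverts G" "v \<in> pverts G"
proof -
  interpret pair_graph G by fact
  show "u \<in> pverts G" "v \<in> pverts G" using wellformed' assms(2) by auto
qed

lemma pair_graph_sym: "pair_graph G \<Longrightarrow> (u, v) \<in> parcs G \<Longrightarrow> (v, u) \<in> parcs G"
proof -
  assume "pair_graph G" and a: "(u, v) \<in> parcs G"
  interpret pair_graph G by fact
  show ?thesis using a arcs_symmetric by simp
qed

lemma pair_graph_irrefl: "pair_graph G \<Longrightarrow> (u, u) \<notin> parcs G"
proof -
  assume "pair_graph G"
  interpret pair_graph G by fact
  show ?thesis using no_loops' by blast
qed

lemma pair_graph_finite: "pair_graph G \<Longrightarrow> finite (pverts G)"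
proof -
  assume "pair_graph G"
  interpret pair_graph G by fact
  show ?thesis by (rule pair_finite_verts)
qed

lemma connected_graph_iff:
  "connected_graph G \<longleftrightarrow> pair_graph G \<and> pverts G \<noteq> {} \<and>
     (\<forall>u\<in>pverts G. \<forall>v\<in>pverts G. (u, v) \<in> (parcs G)\<^sup>*)"
proof (cases "pair_graph G")
  case True
  then interpret pair_graph G .
  have s: "(parcs G)\<^sup>s = parcs G"
    using pair_graph_sym[OF True] by (auto simp: symcl_def)
  have "(u, v) \<in> rtrancl_on (pverts G) (parcs G) \<longleftrightarrow> (u, v) \<in> (parcs G)\<^sup>*"
    if "u \<in> pverts G" for u v
  proof
    assume "(u, v) \<in> (parcs G)\<^sup>*"
    then show "(u, v) \<in> rtrancl_on (pverts G) (parcs G)"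
      by induction
        (use that in \<open>auto intro: rtrancl_on_into_rtrancl_on dest: wellformed'\<close>)
  qed (rule rtrancl_on_rtranclI)
  then show ?thesis
    using True by (simp add: connected_graph_def connected_conv s cong: ball_cong)
qed (simp add: connected_graph_def)

lemma connected_graph_closed:
  assumes "connected_graph G" "S \<inter> pverts G \<noteq> {}"
    and closed: "\<And>u v. u \<in> S \<Longrightarrow> (u, v) \<in> parcs G \<Longrightarrow> v \<in> S"
  shows "pverts G \<subseteq> S"
proof
  fix v assume v: "v \<in> pverts G"
  obtain u where u: "u \<in> S" "u \<in> pverts G" using assms(2) by blast
  have "(u, v) \<in> (parcs G)\<^sup>*" using assms(1) u v by (simp add: connected_graph_iff)
  then show "v \<in> S" by induction (use u closed in auto)
qed

definition mk_graph :: "nat \<Rightarrow> (nat \<Rightarrow> nat \<Rightarrow> bool) \<Rightarrow> ngraph" where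
  "mk_graph n A = \<lparr>pverts = {..<n}, parcs = {(i, j). i < n \<and> j < n \<and> i \<noteq> j \<and> (A i j \<or> A j i)}\<rparr>"

lemma mk_graph_simps [simp]:
  "pverts (mk_graph n A) = {..<n}"
  "(i, j) \<in> parcs (mk_graph n A) \<longleftrightarrow> i < n \<and> j < n \<and> i \<noteq> j \<and> (A i j \<or> A j i)"
  by (auto simp: mk_graph_def)

lemma pair_graph_mk_graph [simp]: "pair_graph (mk_graph n A)"
proof
  show "finite (parcs (mk_graph n A))"
    by (rule finite_subset[of _ "{..<n} \<times> {..<n}"]) (auto simp: mk_graph_def)
  show "symmetric (with_proj (mk_graph n A))"
    by (auto simp: symmetric_def intro!: symI)
qed (auto simp: mk_graph_def)

text \<open>Following neighbours of smaller \<open>\<mu>\<close> leads from every vertex to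
  \<open>r\<close>. The hosts below use for \<open>\<mu>\<close> the distance to
  \<open>r\<close>.\<close>

lemma connected_mk_graph:
  fixes \<mu> :: "nat \<Rightarrow> nat"
  assumes "0 < n"
    and desc: "\<And>i. i < n \<Longrightarrow> i \<noteq> r \<Longrightarrow> \<exists>j<n. \<mu> j < \<mu> i \<and> (A i j \<or> A j i)"
  shows "connected_graph (mk_graph n A)"
proof -
  let ?G = "mk_graph n A"
  have to_r: "(i, r) \<in> (parcs ?G)\<^sup>*" if "i < n" for i
    using that
  proof (induction "\<mu> i" arbitrary: i rule: less_induct)
    case less
    show ?case
    proof (cases "i = r")
      case False
      then obtain j where j: "j < n" "\<mu> j < \<mu> i" "A i j \<or> A j i" using desc less.prems by blast
      have "i \<noteq> j" using j(2) by auto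
      then have "(i, j) \<in> parcs ?G" using j less.prems by auto
      then show ?thesis using less.hyps[OF j(2,1)] by (meson converse_rtrancl_into_rtrancl)
    qed simp
  qed
  have "sym ((parcs ?G)\<^sup>*)" by (intro sym_rtrancl symI) auto
  then have "(i, j) \<in> (parcs ?G)\<^sup>*" if "i < n" "j < n" for i j
    using to_r[OF that(1)] to_r[OF that(2)] by (meson rtrancl_trans symD)
  then show ?thesis using assms(1) by (auto simp: connected_graph_iff)
qed

lemma sat_cong:
  "(\<And>x. x \<in> free_vars p \<Longrightarrow> e x = e' x) \<Longrightarrow> sat G e p \<longleftrightarrow> sat G e' p"
proof (induction p arbitrary: e e')
  case (Exi x p)
  have "sat G (e(x := a)) p \<longleftrightarrow> sat G (e'(x := a)) p" for a
    by (rule Exi.IH) (use Exi.prems in auto)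
  then show ?case by simp
next
  case (All x p)
  have "sat G (e(x := a)) p \<longleftrightarrow> sat G (e'(x := a)) p" for a
    by (rule All.IH) (use All.prems in auto)
  then show ?case by simp
next
  case (Conj p q)
  have "sat G e p \<longleftrightarrow> sat G e' p" "sat G e q \<longleftrightarrow> sat G e' q"
    using Conj.prems by (auto intro!: Conj.IH)
  then show ?case by simp
next
  case (Disj p q)
  have "sat G e p \<longleftrightarrow> sat G e' p" "sat G e q \<longleftrightarrow> sat G e' q"
    using Disj.prems by (auto intro!: Disj.IH)
  then show ?case by simp
next
  case (Neg p)
  have "sat G e p \<longleftrightarrow> sat G e' p" by (rule Neg.IH) (use Neg.prems in simp)
  then show ?case by simp
qed auto

lemma models_sentence:
  assumes "sentence p" "c \<in> pverts G"
  shows "models G p \<longleftrightarrow> sat G (\<lambda>_. c) p"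
proof -
  have "sat G e p \<longleftrightarrow> sat G (\<lambda>_. c) p" for e
    by (rule sat_cong) (use assms in \<open>simp add: sentence_def\<close>)
  moreover have "range (\<lambda>_ :: nat. c) \<subseteq> pverts G" using assms(2) by auto
  ultimately show ?thesis unfolding models_def by meson
qed

lemma finite_all_vars: "finite (all_vars p)"
  by (induction p) auto

lemma width_pos: "0 < width p"
proof -
  have "all_vars p \<noteq> {}" by (induction p) auto
  then show ?thesis using finite_all_vars by (simp add: width_def card_gt_0_iff)
qed

section \<open>Pebble games on graphs that differ in the size of a twin class\<close>

locale twin_exchange =
  fixes G H :: ngraph and C B B' :: "nat set" and k :: nat
  assumes vG: "pverts G = C \<union> B" and vH: "pverts H = C \<union> B'"
    and disj: "C \<inter> B = {}" "C \<inter> B' = {}"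
    and fin: "finite B" "finite B'"
    and big: "k \<le> card B" "k \<le> card B'"
    and CC: "\<And>x y. x \<in> C \<Longrightarrow> y \<in> C \<Longrightarrow> (x, y) \<in> parcs G \<longleftrightarrow> (x, y) \<in> parcs H"
    and CB: "\<And>x b b'. x \<in> C \<Longrightarrow> b \<in> B \<Longrightarrow> b' \<in> B' \<Longrightarrow>
      (x, b) \<in> parcs G \<longleftrightarrow> (x, b') \<in> parcs H"
    and BC: "\<And>x b b'. x \<in> C \<Longrightarrow> b \<in> B \<Longrightarrow> b' \<in> B' \<Longrightarrow>
      (b, x) \<in> parcs G \<longleftrightarrow> (b', x) \<in> parcs H"
    and BB: "\<And>b1 b2 b1' b2'. b1 \<in> B \<Longrightarrow> b2 \<in> B \<Longrightarrow> b1' \<in> B' \<Longrightarrow> b2' \<in> B' \<Longrightarrow>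
      b1 \<noteq> b2 \<Longrightarrow> b1' \<noteq> b2' \<Longrightarrow> (b1, b2) \<in> parcs G \<longleftrightarrow> (b1', b2') \<in> parcs H"
    and noloop: "\<And>b. (b, b) \<notin> parcs G" "\<And>b. (b, b) \<notin> parcs H"
begin

text \<open>The position invariant of the game with \<open>k\<close> pebbles. Twins are
  indistinguishable, so beyond the pattern of equalities nothing is recorded about the pebbled
  elements of \<open>B\<close> and \<open>B'\<close>.\<close>

definition matched :: "nat set \<Rightarrow> (nat \<Rightarrow> nat) \<Rightarrow> (nat \<Rightarrow> nat) \<Rightarrow> bool" where
  "matched X e e' \<longleftrightarrow>
     (\<forall>x\<in>X. e x \<in> C \<and> e' x = e x \<or> e x \<in> B \<and> e' x \<in> B') \<and>
     (\<forall>x\<in>X. \<forall>y\<in>X. e x = e y \<longleftrightarrow> e' x = e' y)"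

text \<open>Once the pebble \<open>x\<close> is lifted, at most \<open>k - 1\<close> pebbles remain,
  so a twin class with \<open>k\<close> elements has an unpebbled element that answers a fresh
  twin.\<close>

lemma matched_extend:
  assumes m: "matched X e e'" and X: "finite X" "card X \<le> k" "x \<in> X" and a: "a \<in> pverts G"
  shows "\<exists>a'\<in>pverts H. matched X (e(x := a)) (e'(x := a'))"
proof -
  consider "a \<in> C" | y where "y \<in> X - {x}" "a = e y" "a \<in> B" | "a \<in> B" "a \<notin> e ` (X - {x})"
    using a vG by auto
  then show ?thesis
  proof cases
    case 1
    then have "matched X (e(x := a)) (e'(x := a))"
      using m disj unfolding matched_def by (auto; metis disjoint_iff)
    then show ?thesis using 1 vH by blast
  next
    case 2
    then have "matched X (e(x := a)) (e'(x := e' y))" "e' y \<in> pverts H"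
      using m vH unfolding matched_def by (auto simp: vH)
    then show ?thesis by blast
  next
    case 3
    have "card (e' ` (X - {x})) < card B'"
    proof -
      have "card (e' ` (X - {x})) \<le> card (X - {x})" by (rule card_image_le) (use X in simp)
      also have "\<dots> < card X" using X by (intro psubset_card_mono) auto
      finally show ?thesis using X big by simp
    qed
    then have "\<not> B' \<subseteq> e' ` (X - {x})" using X card_mono[of "e' ` (X - {x})" B'] by auto
    then obtain a' where a': "a' \<in> B'" "a' \<notin> e' ` (X - {x})" by blast
    have "matched X (e(x := a)) (e'(x := a'))"
      using m 3 a' disj unfolding matched_def by (auto; fastforce)
    then show ?thesis using a' vH by blast
  qed
qed

lemma matched_adj:
  assumes "matched X e e'" "x \<in> X" "y \<in> X"
  shows "(e x, e y) \<in> parcs G \<longleftrightarrow> (e' x, e' y) \<in> parcs H"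
proof (cases "e x = e y")
  case True
  then show ?thesis using assms noloop unfolding matched_def by metis
next
  case False
  then have "e' x \<noteq> e' y" using assms unfolding matched_def by blast
  moreover have "e x \<in> C \<and> e' x = e x \<or> e x \<in> B \<and> e' x \<in> B'"
    "e y \<in> C \<and> e' y = e y \<or> e y \<in> B \<and> e' y \<in> B'"
    using assms unfolding matched_def by blast+
  ultimately show ?thesis
    using False by (elim disjE conjE) (simp_all add: CC CB BC BB)
qed

end

lemma twin_exchange_sym: "twin_exchange G H C B B' k \<Longrightarrow> twin_exchange H G C B' B k"
  unfolding twin_exchange_def by (elim conjE, intro conjI allI impI) simp_all

context twin_exchange
begin

interpretation S: twin_exchange H G C B' B k
  by (rule twin_exchange_sym) (rule twin_exchange_axioms)

lemma matched_sym: "matched X e e' \<longleftrightarrow> S.matched X e' e"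
proof -
  have "(e x \<in> C \<and> e' x = e x \<or> e x \<in> B \<and> e' x \<in> B') \<longleftrightarrow>
      (e' x \<in> C \<and> e x = e' x \<or> e' x \<in> B' \<and> e x \<in> B)" for x by auto
  moreover have "(e x = e y \<longleftrightarrow> e' x = e' y) \<longleftrightarrow> (e' x = e' y \<longleftrightarrow> e x = e y)" for x y
    by auto
  ultimately show ?thesis unfolding matched_def S.matched_def by simp
qed

text \<open>Only quantifiers need work: one direction is \<open>matched_extend\<close>, the other is
  the same lemma with the two graphs exchanged.\<close>

lemma sat_matched:
  assumes "matched X e e'" "finite X" "card X \<le> k" "all_vars p \<subseteq> X"
  shows "sat G e p \<longleftrightarrow> sat H e' p"
  using assms
proof (induction p arbitrary: e e')
  case (Adj x y)
  then show ?case using matched_adj by simp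
next
  case (Eq x y)
  then show ?case unfolding matched_def by simp
next
  case (Exi x p)
  have x: "x \<in> X" and p: "all_vars p \<subseteq> X" using Exi.prems by auto
  note IH = Exi.IH[OF _ Exi.prems(2,3) p]
  show ?case
  proof
    assume "sat G e (Exi x p)"
    then obtain a where a: "a \<in> pverts G" "sat G (e(x := a)) p" by auto
    then show "sat H e' (Exi x p)"
      using matched_extend[OF Exi.prems(1-3) x a(1)] IH by auto
  next
    assume "sat H e' (Exi x p)"
    then obtain a where a: "a \<in> pverts H" "sat H (e'(x := a)) p" by auto
    obtain b where "b \<in> pverts G" "S.matched X (e'(x := a)) (e(x := b))"
      using S.matched_extend[OF Exi.prems(1)[unfolded matched_sym] Exi.prems(2,3) x a(1)] by blast
    then show "sat G e (Exi x p)" using IH[unfolded matched_sym] a(2) by auto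
  qed
next
  case (All x p)
  have x: "x \<in> X" and p: "all_vars p \<subseteq> X" using All.prems by auto
  note IH = All.IH[OF _ All.prems(2,3) p]
  show ?case
  proof
    assume L: "sat G e (All x p)"
    have "sat H (e'(x := a)) p" if a: "a \<in> pverts H" for a
    proof -
      obtain b where "b \<in> pverts G" "S.matched X (e'(x := a)) (e(x := b))"
        using S.matched_extend[OF All.prems(1)[unfolded matched_sym] All.prems(2,3) x a] by blast
      then show ?thesis using IH[unfolded matched_sym] L by auto
    qed
    then show "sat H e' (All x p)" by simp
  next
    assume L: "sat H e' (All x p)"
    have "sat G (e(x := a)) p" if a: "a \<in> pverts G" for a
      using matched_extend[OF All.prems(1-3) x a] IH L by auto
    then show "sat G e (All x p)" by simp
  qed
qed auto

lemma models_eq: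
  assumes "sentence p" "width p \<le> k" "C \<noteq> {}"
  shows "models G p \<longleftrightarrow> models H p"
proof -
  obtain c where c: "c \<in> C" using assms(3) by blast
  have "sat G (\<lambda>_. c) p \<longleftrightarrow> sat H (\<lambda>_. c) p"
    by (rule sat_matched[OF _ finite_all_vars]) (use assms c in \<open>auto simp: matched_def width_def\<close>)
  moreover have "c \<in> pverts G" "c \<in> pverts H" using c vG vH by auto
  ultimately show ?thesis using models_sentence[OF assms(1)] by blast
qed

end

lemma twin_exchange_contains:
  assumes p: "defines_asymptotically p (containing F)" and tw: "twin_exchange G H C B B' (width p)"
    and "C \<noteq> {}" and N: "\<And>G. connected_graph G \<Longrightarrow> N \<le> v_count G \<Longrightarrow> models G p \<longleftrightarrow> G \<in> containing F"
    and "connected_graph G" "connected_graph H" "N \<le> v_count G" "N \<le> v_count H"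
    and "G \<in> containing F"
  shows "H \<in> containing F"
proof -
  have "models G p \<longleftrightarrow> models H p"
    by (rule twin_exchange.models_eq[OF tw])
      (use p assms(3) in \<open>auto simp: defines_asymptotically_def\<close>)
  then show ?thesis using N[OF assms(5,7)] N[OF assms(6,8)] assms(9) by blast
qed

section \<open>Lower bound on the width\<close>

text \<open>
  \<open>N\<close> leaves at the vertex \<open>N\<close>, a path from \<open>N\<close> to \<open>N + t\<close>, and a clique on the \<open>q\<close> vertices
  from \<open>N + t\<close> on.
\<close>

definition host :: "nat \<Rightarrow> nat \<Rightarrow> nat \<Rightarrow> ngraph" where
  "host N t q = mk_graph (N + t + q) (\<lambda>i j.
     i < N \<and> j = N \<or> N \<le> i \<and> i < N + t \<and> j = Suc i \<or> N + t \<le> i \<and> N + t \<le> j)"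

text \<open>
  \<open>N\<close> leaves at the vertex \<open>N + c\<close>, a pendant path with the \<open>c\<close> vertices \<open>N, \<dots>, N + c - 1\<close> at the same
  vertex, and a complete bipartite graph whose sides are the next \<open>a\<close> vertices, starting with
  \<open>N + c\<close>, and the last \<open>b\<close> vertices.
\<close>

definition bip_host :: "nat \<Rightarrow> nat \<Rightarrow> nat \<Rightarrow> nat \<Rightarrow> ngraph" where
  "bip_host N c a b = mk_graph (N + c + a + b) (\<lambda>i j.
     i < N \<and> j = N + c \<or> N \<le> i \<and> i < N + c \<and> j = Suc i \<or>
     N + c \<le> i \<and> i < N + c + a \<and> N + c + a \<le> j)"

lemma connected_host: "0 < q \<Longrightarrow> connected_graph (host N t q)"
  unfolding host_def
\<comment> \<open>The distance to \<open>N + t\<close>, the clique vertex at which the path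
  ends.\<close>
proof (rule connected_mk_graph[where r = "N + t" and
      \<mu> = "\<lambda>i. if i < N then t + 1 else if i \<le> N + t then N + t - i else 1"])
  fix i assume "0 < q" "i < N + t + q" "i \<noteq> N + t"
  then consider "i < N" | "N \<le> i" "i < N + t" | "N + t < i" by linarith
  then show "\<exists>j<N + t + q. (if j < N then t + 1 else if j \<le> N + t then N + t - j else 1)
      < (if i < N then t + 1 else if i \<le> N + t then N + t - i else 1) \<and>
      ((i < N \<and> j = N \<or> N \<le> i \<and> i < N + t \<and> j = Suc i \<or> N + t \<le> i \<and> N + t \<le> j) \<or>
       (j < N \<and> i = N \<or> N \<le> j \<and> j < N + t \<and> i = Suc j \<or> N + t \<le> j \<and> N + t \<le> i))"
  proof cases
    case 1 then show ?thesis using \<open>0 < q\<close> by (intro exI[of _ N]) auto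
  next
    case 2 then show ?thesis using \<open>0 < q\<close> by (intro exI[of _ "Suc i"]) auto
  next
    case 3 then show ?thesis using \<open>0 < q\<close> by (intro exI[of _ "N + t"]) auto
  qed
qed simp

lemma connected_bip_host: "0 < a \<Longrightarrow> 0 < b \<Longrightarrow> connected_graph (bip_host N c a b)"
  unfolding bip_host_def
\<comment> \<open>The distance to \<open>N + c\<close>. The other vertices on its side are reached
  in two steps through the opposite side.\<close>
proof (rule connected_mk_graph[where r = "N + c" and
      \<mu> = "\<lambda>i. if i < N then 1 else if i \<le> N + c then N + c - i else if i < N + c + a then 2 else 1"])
  fix i assume *: "0 < a" "0 < b" "i < N + c + a + b" "i \<noteq> N + c"
  then consider "i < N" | "N \<le> i" "i < N + c" | "N + c < i" "i < N + c + a" | "N + c + a \<le> i"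
    by linarith
  then show "\<exists>j<N + c + a + b.
      (if j < N then 1 else if j \<le> N + c then N + c - j else if j < N + c + a then 2 else 1)
      < (if i < N then 1 else if i \<le> N + c then N + c - i else if i < N + c + a then 2 else 1) \<and>
      ((i < N \<and> j = N + c \<or> N \<le> i \<and> i < N + c \<and> j = Suc i \<or>
        N + c \<le> i \<and> i < N + c + a \<and> N + c + a \<le> j) \<or>
       (j < N \<and> i = N + c \<or> N \<le> j \<and> j < N + c \<and> i = Suc j \<or>
        N + c \<le> j \<and> j < N + c + a \<and> N + c + a \<le> i))"
  proof cases
    case 1 then show ?thesis using * by (intro exI[of _ "N + c"]) auto
  next
    case 2 then show ?thesis using * by (intro exI[of _ "Suc i"]) auto
  next
    case 3 then show ?thesis using * by (intro exI[of _ "N + c + a"]) auto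
  next
    case 4 then show ?thesis using * by (intro exI[of _ "N + c"]) auto
  qed
qed simp

text \<open>The vertex \<open>N + t\<close> carries the attachment and is no twin of the other
  clique vertices. A clique on \<open>q\<close> vertices thus supplies \<open>q - 1\<close> twins,
  whence the strict inequalities.\<close>

lemma twin_exchange_host:
  assumes "k < q" "k < q'"
  shows "twin_exchange (host N t q) (host N t q') {..N + t} {N + t<..<N + t + q} {N + t<..<N + t + q'} k"
  using assms by unfold_locales (auto simp: host_def)

text \<open>The last side is a class of pairwise nonadjacent twins. By \<open>0 < a\<close>, the
  vertex \<open>N + c\<close> that carries the leaves and the pendant path lies outside this
  class.\<close>

lemma twin_exchange_bip_host:
  assumes "0 < a" "k \<le> b" "k \<le> b'"
  shows "twin_exchange (bip_host N c a b) (bip_host N c a b') {..<N + c + a}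
    {N + c + a..<N + c + a + b} {N + c + a..<N + c + a + b'} k"
  using assms by unfold_locales (auto simp: bip_host_def)

text \<open>
  Below, \<open>m\<close> is the number of vertices of \<open>F\<close> that do not fit into a clique on \<open>k + 1\<close> vertices, and
  \<open>N0\<close> is the threshold from which on \<open>p\<close> defines \<open>F\<close>-containment.
\<close>

locale narrow =
  fixes F :: ngraph and p :: fo
  assumes conn: "connected_graph F" and defi: "defines_asymptotically p (containing F)"
    and narrow: "3 * width p + 6 \<le> 2 * v_count F"
begin

definition "k = width p"
definition "n = v_count F"
definition "m = n - k - 1"
definition "N0 = (SOME N. \<forall>G. connected_graph G \<and> N \<le> v_count G \<longrightarrow>
  (models G p \<longleftrightarrow> G \<in> containing F))"

abbreviation V where "V \<equiv> pverts F"
abbreviation E where "E \<equiv> parcs F"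

lemma F: "pair_graph F"
  using conn by (simp add: connected_graph_def)

lemmas sym = pair_graph_sym[OF F] and irrefl = pair_graph_irrefl[OF F]
  and EV = pair_graph_adj_verts[OF F] and finV = pair_graph_finite[OF F]

text \<open>The assumed bound in convenient form: \<open>n + 3 \<le> 3 * m\<close> is what later
  makes disjoint sets of sizes \<open>m\<close>, \<open>m\<close> and \<open>m - 2\<close> too large
  for \<open>F\<close>.\<close>

lemma nums: "n = m + k + 1" "n + 3 \<le> 3 * m" "3 \<le> m" "0 < k" "3 * k + 6 \<le> 2 * n"
proof -
  have "0 < k" by (simp add: k_def width_pos)
  moreover have "3 * k + 6 \<le> 2 * n" using narrow by (simp add: k_def n_def)
  ultimately show "n = m + k + 1" "n + 3 \<le> 3 * m" "3 \<le> m" "0 < k" "3 * k + 6 \<le> 2 * n"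
    unfolding m_def by linarith+
qed

lemma N0: "connected_graph G \<Longrightarrow> N0 \<le> v_count G \<Longrightarrow> models G p \<longleftrightarrow> G \<in> containing F"
proof -
  have "\<exists>N. \<forall>G. connected_graph G \<and> N \<le> v_count G \<longrightarrow> (models G p \<longleftrightarrow> G \<in> containing F)"
    using defi by (simp add: defines_asymptotically_def)
  then have "\<forall>G. connected_graph G \<and> N0 \<le> v_count G \<longrightarrow> (models G p \<longleftrightarrow> G \<in> containing F)"
    unfolding N0_def by (rule someI_ex)
  then show "connected_graph G \<Longrightarrow> N0 \<le> v_count G \<Longrightarrow> models G p \<longleftrightarrow> G \<in> containing F" by blast
qed

section \<open>Embeddings of \<open>F\<close> into the hosts\<close>

lemma contained_obtain:
  assumes "G \<in> containing F"
  obtains f where "inj_on f V" "f ` V \<subseteq> pverts G" "\<And>u v. (u, v) \<in> E \<Longrightarrow> (f u, f v) \<in> parcs G"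
proof -
  have "pair_graph G" using assms by (simp add: containing_def)
  from assms[unfolded containing_iff[OF F this]] obtain f where "inj_on f V" "f ` V \<subseteq> pverts G"
    "\<forall>(u, v)\<in>E. (f u, f v) \<in> parcs G" by (elim exE conjE)
  then show ?thesis by (intro that[of f]) auto
qed

lemma containedI:
  assumes "pair_graph G" "inj_on f V" "f ` V \<subseteq> pverts G" "\<And>u v. (u, v) \<in> E \<Longrightarrow> (f u, f v) \<in> parcs G"
  shows "G \<in> containing F"
  unfolding containing_iff[OF F assms(1)] using assms(2-4) by (intro exI[of _ f]) auto

text \<open>A clique on \<open>n + k + 1\<close> vertices contains every graph with \<open>n\<close>
  vertices. Removing twins until \<open>k + 1\<close> clique vertices are left is invisible to
  \<open>p\<close>.\<close>

lemma host_contains: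
  assumes "N0 \<le> N + t"
  shows "host N t (k + 1) \<in> containing F"
proof -
  obtain h where h: "bij_betw h V {..<n}"
    using ex_bij_betw_finite_nat[OF finV] by (auto simp: n_def lessThan_atLeast0)
  have hn: "h v < n" if "v \<in> V" for v using h that by (auto simp: bij_betw_def)
  have "host N t (n + k + 1) \<in> containing F"
  proof (rule containedI[where f = "\<lambda>v. N + t + h v"])
    show "inj_on (\<lambda>v. N + t + h v) V" using h by (auto simp: bij_betw_def inj_on_def)
    fix u v assume uv: "(u, v) \<in> E"
    then have "h u \<noteq> h v" using h EV[OF uv] irrefl by (auto simp: bij_betw_def inj_on_def)
    then show "(N + t + h u, N + t + h v) \<in> parcs (host N t (n + k + 1))"
      using hn[OF EV(1)[OF uv]] hn[OF EV(2)[OF uv]] by (simp add: host_def)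
  qed (use hn in \<open>force simp: host_def\<close>)+
  then show ?thesis
    by (rule twin_exchange_contains[OF defi twin_exchange_host _ N0, rotated -1])
      (use assms in \<open>auto simp: k_def intro!: connected_host\<close>, auto simp: host_def)
qed

lemma host_embedding:
  assumes "N0 \<le> N + t"
  obtains f where "inj_on f V" "\<And>v. v \<in> V \<Longrightarrow> f v < N + t + k + 1"
    "\<And>u v. (u, v) \<in> E \<Longrightarrow> f u < N \<and> f v = N \<or> N \<le> f u \<and> f u < N + t \<and> f v = Suc (f u) \<or>
       f v < N \<and> f u = N \<or> N \<le> f v \<and> f v < N + t \<and> f u = Suc (f v) \<or> N + t \<le> f u \<and> N + t \<le> f v"
proof -
  obtain f where "inj_on f V" "f ` V \<subseteq> pverts (host N t (k + 1))"
    "\<And>u v. (u, v) \<in> E \<Longrightarrow> (f u, f v) \<in> parcs (host N t (k + 1))"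
    by (rule contained_obtain[OF host_contains[OF assms]]) blast
  then show ?thesis by (intro that[of f]) (auto simp: host_def)
qed

section \<open>The shape of \<open>F\<close> forced by the hosts\<close>

lemma card_below:
  assumes "inj_on f V" "\<And>v. v \<in> V \<Longrightarrow> f v < M + k + 1"
  shows "m \<le> card {v\<in>V. f v < M}"
proof -
  have "card {v\<in>V. M \<le> f v} \<le> card {M..<M + k + 1}"
    by (rule card_inj_on_le[of f]) (use assms in \<open>auto intro: inj_on_subset\<close>)
  moreover have "n = card {v\<in>V. f v < M} + card {v\<in>V. M \<le> f v}"
    unfolding n_def using finV by (subst card_Un_disjoint[symmetric]) (auto intro!: arg_cong[of _ _ card])
  ultimately show ?thesis using nums by simp
qed

lemma ex_edge_across:
  assumes "u \<in> V" "w \<in> V" "P u" "\<not> P w"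
  obtains y z where "(y, z) \<in> E" "P y" "\<not> P z"
proof -
  have "\<not> V \<subseteq> {v. P v}" using assms by blast
  then have "\<not> (\<forall>y z. P y \<longrightarrow> (y, z) \<in> E \<longrightarrow> P z)"
    using connected_graph_closed[OF conn, of "{v. P v}"] assms by blast
  then show ?thesis using that by blast
qed

lemma ex_nbr: "v \<in> V \<Longrightarrow> \<exists>u. (v, u) \<in> E"
proof -
  assume v: "v \<in> V"
  have "V \<noteq> {v}" using nums by (auto simp: n_def)
  then obtain w where "w \<in> V" "w \<noteq> v" using v by blast
  then show ?thesis using ex_edge_across[of v w "\<lambda>x. x = v"] v by metis
qed

text \<open>Take the clique with \<open>N0\<close> leaves at one of its vertices. At least
  \<open>m\<close> vertices of \<open>F\<close> are placed on leaves, and all their edges go to the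
  vertex placed at the centre.\<close>

lemma star:
  obtains c L where "c \<in> V" "L \<subseteq> V" "m \<le> card L" "\<And>l v. l \<in> L \<Longrightarrow> (l, v) \<in> E \<longleftrightarrow> v = c"
proof -
  obtain f where f: "inj_on f V" "\<And>v. v \<in> V \<Longrightarrow> f v < N0 + 0 + k + 1"
    "\<And>u v. (u, v) \<in> E \<Longrightarrow> f u < N0 \<and> f v = N0 \<or> N0 \<le> f u \<and> f u < N0 + 0 \<and> f v = Suc (f u) \<or>
       f v < N0 \<and> f u = N0 \<or> N0 \<le> f v \<and> f v < N0 + 0 \<and> f u = Suc (f v) \<or> N0 + 0 \<le> f u \<and> N0 + 0 \<le> f v"
    using host_embedding[of N0 0] by auto
  define L where "L = {v\<in>V. f v < N0}"
  have mL: "m \<le> card L" using card_below[OF f(1), of N0] f(2) by (simp add: L_def)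
  then have "L \<noteq> {}" using nums(3) by auto
  then obtain l where l: "l \<in> L" by blast
  then obtain c where lc: "(l, c) \<in> E" using ex_nbr[of l] by (auto simp: L_def)
  have fc: "f v = N0" if "l \<in> L" "(l, v) \<in> E" for l v using f(3)[OF that(2)] that(1) by (auto simp: L_def)
  have c: "c \<in> V" "f c = N0" using fc[OF l lc] EV(2)[OF lc] by auto
  have "(l, v) \<in> E \<longleftrightarrow> v = c" if l: "l \<in> L" for l v
  proof -
    have u: "v = c" if "(l, v) \<in> E" for v
      using fc[OF l that] c inj_onD[OF f(1), of v c] EV(2)[OF that] by simp
    obtain w where "(l, w) \<in> E" using ex_nbr[of l] l by (auto simp: L_def)
    then show ?thesis using u by blast
  qed
  then show ?thesis by (intro that[of c L]) (use c mL in \<open>auto simp: L_def\<close>)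
qed

text \<open>The edge from \<open>i\<close> to \<open>Suc i\<close> is a bridge of the host: it alone
  joins the positions up to \<open>i\<close> to the later ones. A connected graph with vertices on
  both sides has to use it.\<close>

lemma path_edge:
  assumes f: "inj_on f V"
    "\<And>u v. (u, v) \<in> E \<Longrightarrow> f u < N \<and> f v = N \<or> N \<le> f u \<and> f u < N + t \<and> f v = Suc (f u) \<or>
       f v < N \<and> f u = N \<or> N \<le> f v \<and> f v < N + t \<and> f u = Suc (f v) \<or> N + t \<le> f u \<and> N + t \<le> f v"
    and "N \<le> i" "i < N + t" "u \<in> V" "f u \<le> i" "w \<in> V" "i < f w"
  shows "i \<in> f ` V" "Suc i \<in> f ` V" "(inv_into V f i, inv_into V f (Suc i)) \<in> E"
proof -
  obtain y z where yz: "(y, z) \<in> E" "f y \<le> i" "\<not> f z \<le> i"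
    by (rule ex_edge_across[of u w "\<lambda>x. f x \<le> i"]) (use assms(5-8) in auto)
  have fi: "f y = i" "f z = Suc i" using f(2)[OF yz(1)] yz(2,3) assms(3,4) by auto
  have V: "y \<in> V" "z \<in> V" using EV yz(1) by auto
  show "i \<in> f ` V" "Suc i \<in> f ` V" using V imageI[of _ V f] fi by metis+
  have "inv_into V f i = y" "inv_into V f (Suc i) = z"
    using inv_into_f_f[OF f(1)] V fi by metis+
  then show "(inv_into V f i, inv_into V f (Suc i)) \<in> E" using yz(1) by simp
qed

text \<open>Take a path ending in the clique, without leaves. The centre of the star has too many
  neighbours to lie on the path before the clique, so by connectivity \<open>F\<close> fills the
  path without gaps from its lowest position up to the clique.\<close>

lemma tail:
  obtains y q where "m \<le> q" "inj_on y {..q}" "y ` {..q} \<subseteq> V" "\<And>i. i < q \<Longrightarrow> (y i, y (Suc i)) \<in> E"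
    "\<And>i v. 1 \<le> i \<Longrightarrow> i \<le> q \<Longrightarrow> (y i, v) \<in> E \<Longrightarrow> v = y (i - 1) \<or> i < q \<and> v = y (Suc i)"
proof -
  define t where "t = N0 + 1"
  obtain f where f: "inj_on f V" "\<And>v. v \<in> V \<Longrightarrow> f v < 0 + t + k + 1"
    "\<And>u v. (u, v) \<in> E \<Longrightarrow> f u < 0 \<and> f v = 0 \<or> 0 \<le> f u \<and> f u < 0 + t \<and> f v = Suc (f u) \<or>
       f v < 0 \<and> f u = 0 \<or> 0 \<le> f v \<and> f v < 0 + t \<and> f u = Suc (f v) \<or> 0 + t \<le> f u \<and> 0 + t \<le> f v"
    using host_embedding[of 0 t] by (auto simp: t_def)
  have mt: "m \<le> card {v\<in>V. f v < t}" using card_below[OF f(1), of t] f(2) by simp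
  obtain c L where cL: "c \<in> V" "L \<subseteq> V" "m \<le> card L" "\<And>l v. l \<in> L \<Longrightarrow> (l, v) \<in> E \<longleftrightarrow> v = c"
    by (rule star) blast
  have c: "t \<le> f c"
  proof (rule ccontr)
    assume "\<not> t \<le> f c"
    then have "f ` L \<subseteq> {f c - 1, Suc (f c)}" using f(3) cL(4) by fastforce
    then have "card (f ` L) \<le> card {f c - 1, Suc (f c)}" by (intro card_mono) auto
    also have "\<dots> \<le> 2" by (simp add: card_insert_if)
    finally show False using cL(2,3) nums(3) f(1) card_image[OF inj_on_subset[OF f(1) cL(2)]] by simp
  qed
  define b where "b = Min (f ` V)"
  have fV: "finite (f ` V)" "f ` V \<noteq> {}" using finV cL(1) by auto
  have "b \<in> f ` V" unfolding b_def by (rule Min_in[OF fV])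
  then obtain u where u: "u \<in> V" "f u = b" by blast
  have bmin: "b \<le> f v" if "v \<in> V" for v unfolding b_def using fV that by simp
  have "card {v\<in>V. f v < t} \<le> card {b..<t}"
    by (rule card_inj_on_le[of f]) (use f(1) bmin in \<open>auto intro: inj_on_subset\<close>)
  then have q: "m \<le> t - b" using mt by simp
  have edge: "i \<in> f ` V" "Suc i \<in> f ` V" "(inv_into V f i, inv_into V f (Suc i)) \<in> E"
    if "b \<le> i" "i < t" for i
    using path_edge[OF f(1,3), of i u c] that u c cL(1) by auto
  \<comment> \<open>The tail is numbered from the clique outwards. Only \<open>y 0\<close>, the
    vertex at the clique, may have neighbours off the tail.\<close>
  define y where "y i = inv_into V f (t - i)" for i
  have im: "t - i \<in> f ` V" if "i \<le> t - b" for i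
    using edge(1)[of "t - i"] edge(2)[of "t - 1"] that q nums(3) by (cases "i = 0") auto
  have y: "y i \<in> V" "f (y i) = t - i" if "i \<le> t - b" for i
    using im[OF that] by (auto simp: y_def inv_into_into f_inv_into_f)
  show ?thesis
  proof (rule that[of "t - b" y])
    show "inj_on y {..t - b}"
    proof (rule inj_onI)
      fix i j assume ij: "i \<in> {..t - b}" "j \<in> {..t - b}" "y i = y j"
      then have "t - i = t - j" using y(2)[of i] y(2)[of j] by simp
      then show "i = j" using ij by auto
    qed
    show "y ` {..t - b} \<subseteq> V" using y by auto
    show "(y i, y (Suc i)) \<in> E" if "i < t - b" for i
      using sym[OF edge(3)[of "t - Suc i"]] that by (simp add: y_def Suc_diff_Suc)
    fix i v assume i: "1 \<le> i" "i \<le> t - b" and e: "(y i, v) \<in> E"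
    have v: "v \<in> V" using EV e by blast
    have "f v = t - i + 1 \<or> f v + 1 = t - i" using f(3)[OF e] y(2)[OF i(2)] i q nums(3) by auto
    then show "v = y (i - 1) \<or> i < t - b \<and> v = y (Suc i)"
    proof
      assume "f v = t - i + 1"
      then have "f v = f (y (i - 1))" using y(2)[of "i - 1"] i by auto
      then show ?thesis using inj_onD[OF f(1), of v "y (i - 1)"] v y(1)[of "i - 1"] i by simp
    next
      assume *: "f v + 1 = t - i"
      then have "i < t - b" using bmin[OF v] i by auto
      moreover have "f v = f (y (Suc i))" using y(2)[of "Suc i"] * \<open>i < t - b\<close> by auto
      ultimately show ?thesis using inj_onD[OF f(1), of v "y (Suc i)"] v y(1)[of "Suc i"] by simp
    qed
  qed (rule q)
qed

text \<open>Take a path with \<open>m - 2\<close> edges from the star to the clique. At least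
  \<open>m\<close> vertices of \<open>F\<close> lie outside the clique, but the path has only
  \<open>m - 2\<close> positions there, so two or more vertices are on leaves. The end
  \<open>z (m - 2)\<close> lies in the clique, and its neighbours are not controlled.\<close>

lemma broom_end:
  obtains z Z where "inj_on z {..m - 2}" "z ` {..m - 2} \<subseteq> V" "\<And>i. i < m - 2 \<Longrightarrow> (z i, z (Suc i)) \<in> E"
    "\<And>i v. 1 \<le> i \<Longrightarrow> i < m - 2 \<Longrightarrow> (z i, v) \<in> E \<Longrightarrow> v = z (i - 1) \<or> v = z (Suc i)"
    "Z \<subseteq> V" "2 \<le> card Z" "Z \<inter> z ` {..m - 2} = {}"
    "\<And>v. (z 0, v) \<in> E \<Longrightarrow> v = z 1 \<or> v \<in> Z" "\<And>l v. l \<in> Z \<Longrightarrow> (l, v) \<in> E \<longleftrightarrow> v = z 0"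
proof -
  define t where "t = m - 2"
  have t: "1 \<le> t" "m = t + 2" using nums(3) by (auto simp: t_def)
  define N where "N = N0"
  obtain f where f: "inj_on f V" "\<And>v. v \<in> V \<Longrightarrow> f v < N + t + k + 1"
    "\<And>u v. (u, v) \<in> E \<Longrightarrow> f u < N \<and> f v = N \<or> N \<le> f u \<and> f u < N + t \<and> f v = Suc (f u) \<or>
       f v < N \<and> f u = N \<or> N \<le> f v \<and> f v < N + t \<and> f u = Suc (f v) \<or> N + t \<le> f u \<and> N + t \<le> f v"
    by (rule host_embedding[of N t]) (auto simp: N_def)
  have mt: "m \<le> card {v\<in>V. f v < N + t}" by (rule card_below[OF f(1)]) (use f(2) in simp)
  obtain y q where y: "m \<le> q" "inj_on y {..q}" "y ` {..q} \<subseteq> V" "\<And>i. i < q \<Longrightarrow> (y i, y (Suc i)) \<in> E"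
    "\<And>i v. 1 \<le> i \<Longrightarrow> i \<le> q \<Longrightarrow> (y i, v) \<in> E \<Longrightarrow> v = y (i - 1) \<or> i < q \<and> v = y (Suc i)"
    by (rule tail) blast
  \<comment> \<open>The pendant path provides more vertices of degree two than the tree outside the clique has.\<close>
  have "\<exists>w\<in>V. N + t \<le> f w"
  proof (rule ccontr)
    assume "\<not> ?thesis"
    then have small: "f w < N + t" if "w \<in> V" for w using that by auto
    have "N \<le> f (y i)" if i: "i \<in> {1..<m}" for i
    proof (rule ccontr)
      assume l: "\<not> N \<le> f (y i)"
      have e: "(y i, y (i - 1)) \<in> E" "(y i, y (Suc i)) \<in> E"
        using y(4)[of "i - 1"] y(4)[of i] i y(1) sym by auto
      have "f (y (i - 1)) = f (y (Suc i))" using f(3)[OF e(1)] f(3)[OF e(2)] l by auto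
      then have "y (i - 1) = y (Suc i)" 
        by (rule inj_onD[OF f(1) _ EV(2)[OF e(1)] EV(2)[OF e(2)]])
      then have "i - 1 = Suc i" by (rule inj_onD[OF y(2)]) (use y(1) i in auto)
      then show False using i by auto
    qed
    moreover have "y i \<in> V" if "i \<in> {1..<m}" for i using y(1,3) that by auto
    ultimately have "f ` y ` {1..<m} \<subseteq> {N..<N + t}" using small by auto
    then have "card (f ` y ` {1..<m}) \<le> card {N..<N + t}" by (intro card_mono) auto
    moreover have "inj_on (f \<circ> y) {1..<m}"
    proof (rule comp_inj_on)
      show "inj_on y {1..<m}" using y(1) by (intro inj_on_subset[OF y(2)]) auto
      show "inj_on f (y ` {1..<m})" using y(1,3) by (intro inj_on_subset[OF f(1)]) auto
    qed
    ultimately show False using t card_image[of "f \<circ> y" "{1..<m}"] by (simp add: image_comp)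
  qed
  then obtain w where w: "w \<in> V" "N + t \<le> f w" by blast
  define Z where "Z = {v\<in>V. f v < N}"
  have "card {v\<in>V. N \<le> f v \<and> f v < N + t} \<le> card {N..<N + t}"
    by (rule card_inj_on_le[of f]) (use f(1) in \<open>auto intro: inj_on_subset\<close>)
  moreover have "card {v\<in>V. f v < N + t} = card Z + card {v\<in>V. N \<le> f v \<and> f v < N + t}"
    unfolding Z_def using finV by (subst card_Un_disjoint[symmetric]) (auto intro!: arg_cong[of _ _ card])
  ultimately have Z2: "2 \<le> card Z" using mt t by simp
  then have "Z \<noteq> {}" by auto
  then obtain u where u: "u \<in> V" "f u < N" by (auto simp: Z_def)
  have edge: "N + i \<in> f ` V" "Suc (N + i) \<in> f ` V" "(inv_into V f (N + i), inv_into V f (Suc (N + i))) \<in> E"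
    if "i < t" for i
    using path_edge[OF f(1,3), of "N + i" u w] that u w by auto
  define z where "z i = inv_into V f (N + i)" for i
  have im: "N + i \<in> f ` V" if "i \<le> t" for i
  proof (cases "i = t")
    case True then show ?thesis using edge(2)[of "t - 1"] t by simp
  qed (use edge(1) that in simp)
  have z: "z i \<in> V" "f (z i) = N + i" if "i \<le> t" for i
    unfolding z_def using inv_into_into[OF im[OF that]] f_inv_into_f[OF im[OF that]] by simp_all
  have zI: "v = z i" if "v \<in> V" "f v = N + i" "i \<le> t" for v i
    using inj_onD[OF f(1) _ that(1) z(1)[OF that(3)]] z(2)[OF that(3)] that(2) by simp
  have leaf: "v = z 0" if "l \<in> Z" "(l, v) \<in> E" for l v
    using f(3)[OF that(2)] that(1) EV(2)[OF that(2)] by (intro zI) (auto simp: Z_def)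
  show ?thesis
  proof (rule that[of z Z])
    show "inj_on z {..m - 2}"
    proof (rule inj_onI)
      fix i j assume ij: "i \<in> {..m - 2}" "j \<in> {..m - 2}" "z i = z j"
      have "i \<le> t" "j \<le> t" using ij by (auto simp: t_def)
      from z(2)[OF this(1)] z(2)[OF this(2)] show "i = j" unfolding ij(3) by simp
    qed
    show "z ` {..m - 2} \<subseteq> V" using z(1) t by auto
    show "(z i, z (Suc i)) \<in> E" if "i < m - 2" for i using edge(3)[of i] that t by (simp add: z_def)
    show "v = z (i - 1) \<or> v = z (Suc i)" if "1 \<le> i" "i < m - 2" "(z i, v) \<in> E" for i v
    proof -
      have "f v = N + (i - 1) \<or> f v = N + Suc i" using f(3)[OF that(3)] z(2)[of i] that t by auto
      then show ?thesis using zI[of v "i - 1"] zI[of v "Suc i"] EV(2)[OF that(3)] that t by auto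
    qed
    show "Z \<inter> z ` {..m - 2} = {}"
    proof -
      have "z i \<notin> Z" if "i \<le> m - 2" for i
        using z(2)[OF that[folded t_def]] by (simp add: Z_def)
      then show ?thesis by auto
    qed
    show "v = z 1 \<or> v \<in> Z" if "(z 0, v) \<in> E" for v
    proof -
      have "f v < N \<or> f v = N + 1" using f(3)[OF that] z(2)[of 0] t by auto
      then show ?thesis using zI[of v 1] EV(2)[OF that] t by (auto simp: Z_def)
    qed
    show "(l, v) \<in> E \<longleftrightarrow> v = z 0" if l: "l \<in> Z" for l v
    proof -
      obtain v' where "(l, v') \<in> E" using ex_nbr[of l] l by (auto simp: Z_def)
      then show ?thesis using leaf[OF l] by metis
    qed
  qed (use Z2 in \<open>auto simp: Z_def\<close>)
qed

text \<open>The tail \<open>y\<close> and the path \<open>z\<close> leaving the star are shown to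
  overlap by counting. Glued together they form the single pendant path of a broom.\<close>

lemma is_broom:
  obtains w q R where "m \<le> q" "inj_on w {..q}" "w ` {..q} \<subseteq> V" "\<And>i. i < q \<Longrightarrow> (w i, w (Suc i)) \<in> E"
    "\<And>i v. 1 \<le> i \<Longrightarrow> i \<le> q \<Longrightarrow> (w i, v) \<in> E \<Longrightarrow> v = w (i - 1) \<or> i < q \<and> v = w (Suc i)"
    "R = V - w ` {..q}" "m \<le> card R" "\<And>l v. l \<in> R \<Longrightarrow> (l, v) \<in> E \<longleftrightarrow> v = w 0"
proof -
  obtain y q where y: "m \<le> q" "inj_on y {..q}" "y ` {..q} \<subseteq> V" "\<And>i. i < q \<Longrightarrow> (y i, y (Suc i)) \<in> E"
    "\<And>i v. 1 \<le> i \<Longrightarrow> i \<le> q \<Longrightarrow> (y i, v) \<in> E \<Longrightarrow> v = y (i - 1) \<or> i < q \<and> v = y (Suc i)"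
    by (rule tail) blast
  obtain z Z where z: "inj_on z {..m - 2}" "z ` {..m - 2} \<subseteq> V" "\<And>i. i < m - 2 \<Longrightarrow> (z i, z (Suc i)) \<in> E"
    "\<And>i v. 1 \<le> i \<Longrightarrow> i < m - 2 \<Longrightarrow> (z i, v) \<in> E \<Longrightarrow> v = z (i - 1) \<or> v = z (Suc i)"
    and Z: "Z \<subseteq> V" "2 \<le> card Z" "Z \<inter> z ` {..m - 2} = {}"
    "\<And>v. (z 0, v) \<in> E \<Longrightarrow> v = z 1 \<or> v \<in> Z" "\<And>l v. l \<in> Z \<Longrightarrow> (l, v) \<in> E \<longleftrightarrow> v = z 0"
    by (rule broom_end) blast
  obtain c L where cL: "c \<in> V" "L \<subseteq> V" "m \<le> card L" "\<And>l v. l \<in> L \<Longrightarrow> (l, v) \<in> E \<longleftrightarrow> v = c"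
    by (rule star) blast
  define Y where "Y = y ` {1..q}"
  have two: "card S \<le> 2" if "i \<in> {1..q}" "\<And>v. v \<in> S \<Longrightarrow> (y i, v) \<in> E" for i S
  proof -
    have "S \<subseteq> {y (i - 1), y (Suc i)}" using y(5)[of i] that by auto
    then have "card S \<le> card {y (i - 1), y (Suc i)}" by (intro card_mono) auto
    also have "\<dots> \<le> 2" by (simp add: card_insert_if)
    finally show ?thesis .
  qed
  have cY: "c \<notin> Y"
  proof
    assume "c \<in> Y"
    then obtain i where i: "i \<in> {1..q}" "c = y i" by (auto simp: Y_def)
    have "card L \<le> 2" by (rule two[OF i(1)]) (use i cL(4) sym in blast)
    then show False using cL(3) nums(3) by simp
  qed
  have LY: "l \<notin> Y" if l: "l \<in> L" for l
  proof
    assume "l \<in> Y"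
    then obtain i where i: "i \<in> {1..q}" "l = y i" by (auto simp: Y_def)
    have "(y i, y (i - 1)) \<in> E" using y(4)[of "i - 1"] i sym by auto
    then have c: "c = y (i - 1)" using cL(4)[OF l] i by simp
    show False
    proof (cases "i = 1")
      case True
      have "(y i, y (Suc i)) \<in> E" using y(4)[of i] True y(1) nums(3) by simp
      then have "y (Suc i) = y 0" using cL(4)[OF l] i c True by simp
      then show False using inj_onD[OF y(2), of "Suc i" 0] True y(1) nums(3) by simp
    next
      case False
      then have "i - 1 \<in> {1..q}" using i by auto
      then show False using c cY by (auto simp: Y_def)
    qed
  qed
  \<comment> \<open>Otherwise the star, the pendant path and the path to the star contribute more than \<open>n\<close> vertices.\<close>
  have "\<exists>j<m - 2. z j \<in> Y"
  proof (rule ccontr)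
    assume no: "\<not> ?thesis"
    \<comment> \<open>Vertices of \<open>L\<close> have one neighbour, whereas \<open>z j\<close>
      with \<open>j < m - 2\<close> has at least two; for \<open>j = 0\<close> these are
      \<open>z 1\<close> and an element of \<open>Z\<close>.\<close>
    have "L \<inter> z ` {..<m - 2} = {}"
    proof (rule ccontr)
      assume "\<not> ?thesis"
      then obtain j where j: "j < m - 2" "z j \<in> L" by auto
      have "(z j, z (Suc j)) \<in> E" using z(3) j by simp
      then have s: "c = z (Suc j)" using cL(4)[OF j(2)] by simp
      show False
      proof (cases "j = 0")
        case True
        obtain l where l: "l \<in> Z" using Z(2) by force
        have "(z j, l) \<in> E" using sym[of l] Z(5)[OF l] True by simp
        then have "l = z (Suc j)" using cL(4)[OF j(2)] s by simp
        then show False using l Z(3) j by auto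
      next
        case False
        have "(z j, z (j - 1)) \<in> E" using sym[OF z(3)[of "j - 1"]] j False by simp
        then have "z (j - 1) = z (Suc j)" using cL(4)[OF j(2)] s by simp
        then show False using inj_onD[OF z(1), of "j - 1" "Suc j"] j by force
      qed
    qed
    moreover have "Y \<inter> z ` {..<m - 2} = {}" using no by auto
    moreover have "L \<inter> Y = {}" using LY by auto
    moreover have fin: "finite L" "finite Y" using finV cL(2) finite_subset by (auto simp: Y_def)
    ultimately have "card (L \<union> Y \<union> z ` {..<m - 2}) = card L + card Y + card (z ` {..<m - 2})"
      by (subst card_Un_disjoint; (subst card_Un_disjoint)?) auto
    moreover have "card Y = q" using card_image[of y "{1..q}"] inj_on_subset[OF y(2)]
      by (simp add: Y_def subset_eq)
    moreover have "card (z ` {..<m - 2}) = m - 2" using card_image[of z "{..<m - 2}"] inj_on_subset[OF z(1)]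
      by (simp add: subset_eq)
    moreover have "card (L \<union> Y \<union> z ` {..<m - 2}) \<le> n" unfolding n_def
      by (rule card_mono[OF finV]) (use cL(2) y(3) z(2) in \<open>auto simp: Y_def\<close>)
    ultimately show False using cL(3) y(1) nums by linarith
  qed
  \<comment> \<open>The first index at which \<open>z\<close> meets the tail.\<close>
  then have "\<exists>j. (j < m - 2 \<and> z j \<in> Y) \<and> (\<forall>i<j. \<not> (i < m - 2 \<and> z i \<in> Y))"
    by (rule exists_least_iff[THEN iffD1])
  then obtain j where j: "j < m - 2" "z j \<in> Y" "\<And>i. i < j \<Longrightarrow> z i \<notin> Y" by auto
  obtain i where i: "i \<in> {1..q}" "z j = y i" using j(2) by (auto simp: Y_def)
  \<comment> \<open>\<open>z 0\<close> has at least three neighbours, namely \<open>z 1\<close> and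
    the elements of \<open>Z\<close>, while vertices of \<open>Y\<close> have at most two.\<close>
  have j1: "1 \<le> j"
  proof (rule ccontr)
    assume "\<not> 1 \<le> j"
    then have j0: "j = 0" by simp
    have "card (insert (z 1) Z) \<le> 2"
    proof (rule two[OF i(1)])
      fix v assume "v \<in> insert (z 1) Z"
      then show "(y i, v) \<in> E" using z(3)[of 0] Z(5)[of v "z 0"] sym[of v "z 0"] i j j0 by auto
    qed
    moreover have "z 1 \<notin> Z" using Z(3) j by auto
    ultimately show False using Z(1,2) finite_subset[OF Z(1) finV] by simp
  qed
  \<comment> \<open>\<open>z (j - 1)\<close> is a neighbour of \<open>y i\<close> outside
    \<open>Y\<close>. The tail can only be entered from its inner end, so \<open>i = 1\<close> and
    \<open>z (j - 1) = y 0\<close>.\<close>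
  have zj: "(z (j - 1), z j) \<in> E" using z(3)[of "j - 1"] j j1 by simp
  then have "z (j - 1) = y (i - 1) \<or> i < q \<and> z (j - 1) = y (Suc i)"
    using y(5)[of i "z (j - 1)"] i sym by auto
  moreover have "z (j - 1) \<notin> Y" using j(3) j1 by simp
  ultimately have "z (j - 1) = y (i - 1)" "i - 1 \<notin> {1..q}" using i by (auto simp: Y_def)
  then have i1: "i = 1" and y0: "y 0 = z (j - 1)" using i by auto
  \<comment> \<open>The two paths share \<open>z (j - 1) = y 0\<close> and \<open>z j = y 1\<close>;
    \<open>w\<close> follows \<open>z\<close> up to the first of these and the tail from the second
    on, which gives \<open>j - 1 + q\<close> edges.\<close>
  define w where "w r = (if r < j then z r else y (Suc (r - j)))" for r
  define p where "p = j - 1 + q"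
  have wj: "w (j - 1 + r) = y r" for r
  proof (cases r)
    case 0 then show ?thesis using j1 y0 by (simp add: w_def)
  next
    case (Suc r')
    then show ?thesis using j1 by (simp add: w_def)
  qed
  have wz: "w r = z r" if "r \<le> j" for r
  proof (cases "r = j")
    case True then show ?thesis using i i1 by (simp add: w_def)
  qed (use that in \<open>simp add: w_def\<close>)
  have w_cases: "r < j \<and> w r = z r \<or> j \<le> r \<and> w r = y (Suc (r - j)) \<and> Suc (r - j) \<in> {1..q} \<and> w r \<in> Y"
    if "r \<le> p" for r
    using that j1 by (auto simp: w_def p_def Y_def)
  have inj: "inj_on w {..p}"
  proof (rule inj_onI)
    fix r r' assume r: "r \<in> {..p}" "r' \<in> {..p}" "w r = w r'"
    show "r = r'"
    proof (cases "r < j"; cases "r' < j")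
      assume "r < j" "r' < j"
      then show ?thesis using inj_onD[OF z(1), of r r'] r j by (simp add: w_def)
    next
      assume "\<not> r < j" "\<not> r' < j"
      moreover have "Suc (r - j) = Suc (r' - j)"
        by (rule inj_onD[OF y(2)]) (use calculation r j1 in \<open>auto simp: w_def p_def\<close>)
      ultimately show ?thesis by simp
    next
      assume "r < j" "\<not> r' < j"
      then show ?thesis using w_cases[of r] w_cases[of r'] r j(3)[of r] by auto
    next
      assume "\<not> r < j" "r' < j"
      then show ?thesis using w_cases[of r] w_cases[of r'] r j(3)[of r'] by auto
    qed
  qed
  have wV: "w ` {..p} \<subseteq> V"
  proof -
    have "w r \<in> V" if "r \<le> p" for r using w_cases[OF that] z(2) y(3) j by (auto simp: Y_def)
    then show ?thesis by auto
  qed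
  have wE: "(w r, w (Suc r)) \<in> E" if "r < p" for r
  proof (cases "Suc r \<le> j")
    case True
    then show ?thesis using wz[of r] wz[of "Suc r"] z(3)[of r] j by simp
  next
    case False
    then have r: "r = j - 1 + (r - (j - 1))" "Suc r = j - 1 + Suc (r - (j - 1))" using j1 by auto
    have "(y (r - (j - 1)), y (Suc (r - (j - 1)))) \<in> E" by (rule y(4)) (use that False p_def in auto)
    then show ?thesis using wj[of "r - (j - 1)"] wj[of "Suc (r - (j - 1))"] r by metis
  qed
  have wN: "v = w (r - 1) \<or> r < p \<and> v = w (Suc r)" if "1 \<le> r" "r \<le> p" "(w r, v) \<in> E" for r v
  proof (cases "r < j")
    case True
    then show ?thesis using z(4)[of r v] wz[of "r - 1"] wz[of r] wz[of "Suc r"] that j y(1) nums(3)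
      by (auto simp: p_def)
  next
    case False
    define x where "x = r - (j - 1)"
    have x: "r = j - 1 + x" "r - 1 = j - 1 + (x - 1)" "Suc r = j - 1 + Suc x" "1 \<le> x" "x \<le> q"
      "x < q \<longleftrightarrow> r < p"
      using False that j1 by (auto simp: x_def p_def)
    have "(y x, v) \<in> E" using that(3) wj[of x] x(1) by simp
    then show ?thesis using y(5)[of x v] x wj[of "x - 1"] wj[of "Suc x"] by auto
  qed
  define R where "R = V - w ` {..p}"
  have w0: "w 0 = z 0" using wz by simp
  have pm: "m \<le> p" using y(1) by (simp add: p_def)
  \<comment> \<open>Only \<open>w 0\<close> has neighbours off the path. These lie in
    \<open>Z\<close> and have no further neighbours, so the set is closed under adjacency.\<close>
  have "V \<subseteq> w ` {..p} \<union> Z"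
  proof (rule connected_graph_closed[OF conn])
    show "(w ` {..p} \<union> Z) \<inter> V \<noteq> {}" using wV by auto
    fix u v assume u: "u \<in> w ` {..p} \<union> Z" and uv: "(u, v) \<in> E"
    show "v \<in> w ` {..p} \<union> Z"
    proof (cases "u \<in> Z")
      case True
      then show ?thesis using Z(5) uv w0 by (metis UnI1 atMost_iff image_eqI zero_le)
    next
      case False
      then obtain r where r: "r \<le> p" "u = w r" using u by auto
      show ?thesis
      proof (cases "r = 0")
        case True
        then have "v = w 1 \<or> v \<in> Z" using Z(4)[of v] uv r w0 wz[of 1] j1 by simp
        then show ?thesis using pm nums(3) by auto
      next
        case False
        then show ?thesis using wN[of r v] r uv by force
      qed
    qed
  qed
  then have RZ: "R \<subseteq> Z" by (auto simp: R_def)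
  then have leafR: "(l, v) \<in> E \<longleftrightarrow> v = w 0" if "l \<in> R" for l v using Z(5)[of l v] that w0 by auto
  \<comment> \<open>Every vertex except \<open>w 0\<close> has at most two neighbours, but
    \<open>c\<close> has at least \<open>m\<close>.\<close>
  have "c = w 0"
  proof (rule ccontr)
    assume ne: "c \<noteq> w 0"
    have "c \<notin> R"
    proof
      assume "c \<in> R"
      then have "L \<subseteq> {w 0}" using leafR cL(4) sym by blast
      then have "card L \<le> 1" using card_mono[of "{w 0}" L] by simp
      then show False using cL(3) nums(3) by simp
    qed
    then obtain r where r: "r \<le> p" "c = w r" "1 \<le> r" 
    proof -
      obtain r where "r \<le> p" "c = w r" using \<open>c \<notin> R\<close> cL(1) by (auto simp: R_def)
      moreover from this have "1 \<le> r" using ne by (cases r) auto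
      ultimately show ?thesis using that by blast
    qed
    have "L \<subseteq> {w (r - 1), w (Suc r)}" using wN[of r] r cL(4) sym by blast
    then have "card L \<le> card {w (r - 1), w (Suc r)}" by (intro card_mono) auto
    also have "\<dots> \<le> 2" by (simp add: card_insert_if)
    finally show False using cL(3) nums(3) by simp
  qed
  have "L \<subseteq> R"
  proof
    fix l assume l: "l \<in> L"
    show "l \<in> R"
    proof (rule ccontr)
      assume "l \<notin> R"
      then obtain r where r: "r \<le> p" "l = w r" using l cL(2) by (auto simp: R_def)
      have "(l, w 0) \<in> E" using cL(4)[OF l] \<open>c = w 0\<close> by simp
      then have "1 \<le> r" using r irrefl by (cases r) auto
      have "(l, w (r - 1)) \<in> E" using wE[of "r - 1"] r \<open>1 \<le> r\<close> sym by simp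
      then have "w (r - 1) = w 0" using cL(4)[OF l] \<open>c = w 0\<close> by simp
      then have r1: "r = 1" using inj_onD[OF inj, of "r - 1" 0] r \<open>1 \<le> r\<close> by simp
      have "(l, w 2) \<in> E" using wE[of 1] r r1 pm nums(3) by (simp add: numeral_2_eq_2)
      then have "w 2 = w 0" using cL(4)[OF l] \<open>c = w 0\<close> by simp
      then show False using inj_onD[OF inj, of 2 0] pm nums(3) by simp
    qed
  qed
  then have "m \<le> card R" using cL(3) card_mono[of R L] finV by (auto simp: R_def)
  then show ?thesis by (intro that[of p w R]) (use pm inj wV wE wN leafR R_def in auto)
qed

section \<open>Excluding brooms by a complete bipartite host\<close>

lemma contradiction: False
proof -
  obtain w q R where w: "m \<le> q" "inj_on w {..q}" "w ` {..q} \<subseteq> V" "\<And>i. i < q \<Longrightarrow> (w i, w (Suc i)) \<in> E"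
    "\<And>i v. 1 \<le> i \<Longrightarrow> i \<le> q \<Longrightarrow> (w i, v) \<in> E \<Longrightarrow> v = w (i - 1) \<or> i < q \<and> v = w (Suc i)"
    and R: "R = V - w ` {..q}" "m \<le> card R" "\<And>l v. l \<in> R \<Longrightarrow> (l, v) \<in> E \<longleftrightarrow> v = w 0"
    by (rule is_broom) blast
  have finR: "finite R" and VR: "V = w ` {..q} \<union> R" using finV w(3) by (auto simp: R(1))
  have n: "n = q + 1 + card R"
    unfolding n_def VR using card_image[OF w(2)] finR by (subst card_Un_disjoint) (auto simp: R(1))
  \<comment> \<open>The leaves account for at least \<open>m\<close> of the \<open>m + k + 1\<close>
    vertices, so at most \<open>k + 1\<close> remain for the path.\<close>
  have q4: "4 \<le> q" and qk: "q \<le> k" using n R(2) w(1) nums by linarith+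
  \<comment> \<open>The parameters are chosen so that the path of the broom splits into
    \<open>2 * a - 2\<close> vertices alternating between the sides, the vertex \<open>X\<close>,
    and \<open>c\<close> vertices on the pendant path. The parity of \<open>q\<close> decides
    whether \<open>c\<close> is 2 or 3.\<close>
  define a where "a = q div 2"
  define c where "c = q mod 2 + 2"
  define N where "N = N0"
  define X where "X = N + c"
  have ac: "q = 2 * a - 2 + c" "2 \<le> a" "2 \<le> c" "c < q" "c \<le> 3" "2 * a \<le> q"
    using q4 by (auto simp: a_def c_def)
  have big: "bip_host N c a (n + k) \<in> containing F"
  proof -
    obtain h where h: "bij_betw h R {..<card R}"
      using ex_bij_betw_finite_nat[OF finR] by (auto simp: lessThan_atLeast0)
    \<comment> \<open>Even indices use the side of \<open>X\<close>, starting at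
      \<open>X + 1\<close>, and odd indices use the opposite side. \<open>X\<close> itself is kept
      for index \<open>2 * a - 2\<close>, from where the path descends to \<open>N\<close>.\<close>
    define g where "g i = (if i < 2 * a - 2 then if even i then X + 1 + i div 2 else X + a + i div 2
      else X - (i - (2 * a - 2)))" for i
    \<comment> \<open>Leaves go to vertices of the larger side beyond those used by the path; all of
      them are adjacent to \<open>X + 1\<close>, the position of \<open>w 0\<close>.\<close>
    define f where "f v = (if v \<in> R then X + 2 * a + h v else g (inv_into {..q} w v))" for v
    have fw: "f (w i) = g i" if "i \<le> q" for i using that w(2) by (simp add: f_def R(1))
    have fR: "f v = X + 2 * a + h v" "h v < card R" if "v \<in> R" for v
      using that h by (auto simp: f_def bij_betw_def)
    have glt: "g i < X + 2 * a - 1" if "i \<le> q" for i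
      using that ac by (auto simp: g_def X_def elim!: evenE oddE)
    have gi: "i = j" if "i \<le> q" "j \<le> q" "g i = g j" for i j
    proof -
      have t: "i - (2 * a - 2) \<le> c" "j - (2 * a - 2) \<le> c" using that ac by auto
      consider "i < 2 * a - 2" "j < 2 * a - 2" | "i < 2 * a - 2" "2 * a - 2 \<le> j"
        | "2 * a - 2 \<le> i" "j < 2 * a - 2" | "2 * a - 2 \<le> i" "2 * a - 2 \<le> j" by linarith
      then show ?thesis
      proof cases
        case 1 then show ?thesis using that ac by (auto simp: g_def X_def split: if_splits elim!: evenE oddE)
      next
        case 2 then show ?thesis using that(3) by (auto simp: g_def split: if_splits)
      next
        case 3 then show ?thesis using that(3) by (auto simp: g_def split: if_splits)
      next
        case 4
        define r r' where "r = i - (2 * a - 2)" and "r' = j - (2 * a - 2)"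
        have "g i = X - r" "g j = X - r'" using 4 by (simp_all add: g_def r_def r'_def)
        then have "r = r'" using that(3) t by (simp add: X_def r_def[symmetric] r'_def[symmetric])
        then show ?thesis using 4 by (simp add: r_def r'_def)
      qed
    qed
    have gE: "(g i, g (Suc i)) \<in> parcs (bip_host N c a (n + k))" if i: "i < q" for i
    proof -
      have b: "g i < N + c + a + (n + k)" "g (Suc i) < N + c + a + (n + k)"
        using glt[of i] glt[of "Suc i"] i ac(6) n by (auto simp: X_def)
      have ne: "g i \<noteq> g (Suc i)" using gi[of i "Suc i"] i by auto
      consider "Suc i < 2 * a - 2" | "Suc i = 2 * a - 2" | "2 * a - 2 \<le> i" by linarith
      then show ?thesis
      proof cases
        case 1
        then show ?thesis using b ne ac by (auto simp: bip_host_def g_def X_def elim!: evenE oddE)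
      next
        case 2
        then have "odd i" by presburger
        then show ?thesis using b ne ac 2 by (auto simp: bip_host_def g_def X_def)
      next
        case 3
        define r where "r = i - (2 * a - 2)"
        have "g i = N + c - r" "g (Suc i) = N + c - Suc r" "Suc r \<le> c"
          using 3 i ac(1) by (auto simp: g_def r_def X_def Suc_diff_le)
        moreover obtain r' where "N + c - Suc r = r'" "N + c - r = Suc r'" "N \<le> r'" "r' < N + c"
          using \<open>Suc r \<le> c\<close> by (auto simp: Suc_diff_Suc)
        ultimately show ?thesis using b by (auto simp: bip_host_def)
      qed
    qed
    show ?thesis
    proof (rule containedI[where f = f])
      show "pair_graph (bip_host N c a (n + k))" by (simp add: bip_host_def)
      show "inj_on f V"
        unfolding VR
      proof (rule inj_on_Un[THEN iffD2], intro conjI)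
        show "inj_on f (w ` {..q})"
        proof (rule inj_onI)
          fix u v assume "u \<in> w ` {..q}" "v \<in> w ` {..q}" and eq: "f u = f v"
          then obtain i j where ij: "u = w i" "i \<le> q" "v = w j" "j \<le> q" by auto
          then show "u = v" using gi[of i j] fw[of i] fw[of j] eq by simp
        qed
        show "inj_on f R" using h fR(1) by (auto simp: inj_on_def bij_betw_def)
        show "f ` (w ` {..q} - R) \<inter> f ` (R - w ` {..q}) = {}"
        proof -
          have "f (w i) \<noteq> f l" if "i \<le> q" "l \<in> R" for i l
            using fw[OF that(1)] glt[OF that(1)] fR(1)[OF that(2)] by simp
          then show ?thesis by fastforce
        qed
      qed
      show "f ` V \<subseteq> pverts (bip_host N c a (n + k))"
      proof -
        have "f (w i) < N + c + a + (n + k)" if "i \<le> q" for i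
          using fw[OF that] glt[OF that] ac(6) n by (simp add: X_def)
        moreover have "f l < N + c + a + (n + k)" if "l \<in> R" for l
          using fR[OF that] ac(6) n by (simp add: X_def)
        ultimately show ?thesis unfolding VR by (auto simp: bip_host_def)
      qed
      have fE0: "(f u, f v) \<in> parcs (bip_host N c a (n + k))" if u: "u \<in> R" and uv: "(u, v) \<in> E" for u v
      proof -
        have "v = w 0" using R(3)[OF u] uv by simp
        then have v: "f v = X + 1" using fw[of 0] ac(2) by (simp add: g_def)
        show ?thesis using fR[OF u] ac(2,6) n v by (auto simp: bip_host_def X_def)
      qed
      have sy: "(j, i) \<in> parcs (bip_host N c a (n + k)) \<Longrightarrow> (i, j) \<in> parcs (bip_host N c a (n + k))" for i j
        by (auto simp: bip_host_def)
      fix u v assume uv: "(u, v) \<in> E"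
      consider "u \<in> R" | "v \<in> R" | i j where "u = w i" "v = w j" "i \<le> q" "j \<le> q"
        using EV[OF uv] VR by auto
      then show "(f u, f v) \<in> parcs (bip_host N c a (n + k))"
      proof cases
        case 1 then show ?thesis using fE0 uv by blast
      next
        case 2 then show ?thesis using sy[OF fE0[OF _ sym[OF uv]]] by blast
      next
        case 3
        have "j = Suc i \<or> i = Suc j"
        proof (cases "i = 0")
          case True
          then have "j \<noteq> 0" using 3 uv irrefl[of u] by (cases "j = 0") auto
          then have "w i = w (j - 1) \<or> j < q \<and> w i = w (Suc j)" using w(5)[of j u] 3 sym[OF uv] by auto
          then show ?thesis using inj_onD[OF w(2), of i "j - 1"] inj_onD[OF w(2), of i "Suc j"] 3 \<open>j \<noteq> 0\<close>
            by auto
        next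
          case False
          then have "w j = w (i - 1) \<or> i < q \<and> w j = w (Suc i)" using w(5)[of i v] 3 uv by auto
          then show ?thesis using inj_onD[OF w(2), of j "i - 1"] inj_onD[OF w(2), of j "Suc i"] 3 False
            by auto
        qed
        then show ?thesis using gE[of i] sy[OF gE[of j]] fw 3 by auto
      qed
    qed
  qed
  \<comment> \<open>The larger side shrinks to \<open>k\<close> twins, which \<open>p\<close> cannot
    notice.\<close>
  have small: "bip_host N c a k \<in> containing F"
  proof (rule twin_exchange_contains[OF defi _ _ N0 _ _ _ _ big])
    show "twin_exchange (bip_host N c a (n + k)) (bip_host N c a k) {..<N + c + a}
      {N + c + a..<N + c + a + (n + k)} {N + c + a..<N + c + a + k} (width p)"
      by (rule twin_exchange_bip_host) (use ac in \<open>auto simp: k_def\<close>)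
    show "connected_graph (bip_host N c a (n + k))" "connected_graph (bip_host N c a k)"
      using ac nums(4) by (auto intro!: connected_bip_host)
    show "{..<N + c + a} \<noteq> {}" using ac by (auto simp: lessThan_empty_iff)
  qed (use ac in \<open>auto simp: bip_host_def N_def\<close>)
  obtain f where f: "inj_on f V" "f ` V \<subseteq> pverts (bip_host N c a k)"
    "\<And>u v. (u, v) \<in> E \<Longrightarrow> (f u, f v) \<in> parcs (bip_host N c a k)"
    by (rule contained_obtain[OF small]) blast
  have fb: "f v < X + a + k" if "v \<in> V" for v using f(2) that by (auto simp: bip_host_def X_def)
  have adj: "f u < N \<and> f v = X \<or> N \<le> f u \<and> f u < X \<and> f v = Suc (f u) \<or>
      X \<le> f u \<and> f u < X + a \<and> X + a \<le> f v \<or> f v < N \<and> f u = X \<or>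
      N \<le> f v \<and> f v < X \<and> f u = Suc (f v) \<or> X \<le> f v \<and> f v < X + a \<and> X + a \<le> f u"
    if "(u, v) \<in> E" for u v using f(3)[OF that] by (auto simp: bip_host_def X_def)
  have fwi: "i = j" if "f (w i) = f (w j)" "i \<le> q" "j \<le> q" for i j
    using inj_onD[OF f(1), of "w i" "w j"] inj_onD[OF w(2), of i j] that w(3) by auto
  have w0R: "(w 0, l) \<in> E" if "l \<in> R" for l using R(3)[OF that] sym by simp
  \<comment> \<open>Positions below \<open>X\<close> have at most two neighbours, but
    \<open>w 0\<close> has at least \<open>m\<close> leaves.\<close>
  have "X \<le> f (w 0)"
  proof (rule ccontr)
    assume lt: "\<not> X \<le> f (w 0)"
    have "f ` R \<subseteq> (if f (w 0) < N then {X} else {f (w 0) - 1, Suc (f (w 0))})"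
    proof
      fix i assume "i \<in> f ` R"
      then obtain l where l: "l \<in> R" "i = f l" by blast
      then show "i \<in> (if f (w 0) < N then {X} else {f (w 0) - 1, Suc (f (w 0))})"
        using adj[OF w0R[OF l(1)]] lt by (auto simp: X_def)
    qed
    then have "card (f ` R) \<le> card (if f (w 0) < N then {X} else {f (w 0) - 1, Suc (f (w 0))})"
      by (intro card_mono) auto
    also have "\<dots> \<le> 2" by (simp add: card_insert_if)
    finally show False
      using card_image[OF inj_on_subset[OF f(1)], of R] R(1,2) nums(3) by (auto simp: Diff_subset)
  qed
  \<comment> \<open>A path starting at \<open>X\<close> gets stuck before \<open>q\<close> steps: a
    leaf is a dead end, the pendant path is exhausted after \<open>c < q\<close> steps, and
    alternating between the sides would put the \<open>a + 1\<close> vertices of even index up to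
    \<open>2 * a\<close> on a side of size \<open>a\<close>.\<close>
  moreover have "f (w 0) \<noteq> X"
  proof
    assume X: "f (w 0) = X"
    have step: "(w i, w (Suc i)) \<in> E" if "i < q" for i using w(4) that .
    consider "f (w 1) < N" | "Suc (f (w 1)) = X" | "X + a \<le> f (w 1)"
      using adj[OF step[of 0]] X q4 ac(2) by fastforce
    then show False
    proof cases
      case 1
      then have "f (w 2) = f (w 0)" using adj[OF step[of 1]] X q4 ac by (auto simp: numeral_2_eq_2 X_def)
      then show False using fwi[of 2 0] q4 by simp
    next
      case 2
      have "f (w i) = X - i" if "i \<le> c" for i
        using that
      proof (induction i rule: less_induct)
        case (less i)
        show ?case
        proof (cases "i \<le> 1")
          case True
          then show ?thesis using X 2 by (cases "i = 0") (auto simp: le_Suc_eq)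
        next
          case False
          define r where "r = i - 2"
          have r: "i = Suc (Suc r)" using False by (simp add: r_def)
          have IH: "f (w r) = X - r" "f (w (Suc r)) = X - Suc r" using less.IH[of r] less.IH[of "Suc r"] less.prems r by auto
          have "f (w i) \<noteq> f (w r)" using fwi[of i r] r less.prems ac by auto
          moreover have "X - Suc r < X" "N \<le> X - Suc r" using less.prems r by (auto simp: X_def)
          ultimately show ?thesis
            using adj[OF step[of "Suc r"]] IH less.prems r ac by (auto simp: X_def)
        qed
      qed
      then have "f (w c) = N" "f (w (c - 1)) = Suc N" using ac by (auto simp: X_def)
      then have "f (w (Suc c)) = f (w (c - 1))" using adj[OF step[of c]] ac by (auto simp: X_def)
      then have "Suc c = c - 1" by (rule fwi) (use ac in auto)
      then show False by simp
    next
      case 3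
      have par: "if even i then X \<le> f (w i) \<and> f (w i) < X + a else X + a \<le> f (w i)" if "i \<le> q" for i
        using that
      proof (induction i)
        case 0
        then show ?case using X ac by simp
      next
        case (Suc i)
        show ?case
        proof (cases "i = 0")
          case True
          then show ?thesis using 3 by simp
        next
          case False
          then have "f (w i) \<noteq> X" using fwi[of i 0] X Suc.prems by auto
          moreover have "f (w (Suc i)) \<noteq> X" using fwi[of "Suc i" 0] X Suc.prems by auto
          ultimately show ?thesis using Suc adj[OF step[of i]] by (auto simp: X_def split: if_splits)
        qed
      qed
      have "(\<lambda>i. f (w (2 * i))) ` {..a} \<subseteq> {X..<X + a}"
      proof
        fix r assume "r \<in> (\<lambda>i. f (w (2 * i))) ` {..a}"
        then obtain i where "i \<le> a" "r = f (w (2 * i))" by auto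
        then show "r \<in> {X..<X + a}" using par[of "2 * i"] ac(6) by simp
      qed
      then have "card ((\<lambda>i. f (w (2 * i))) ` {..a}) \<le> a" using card_mono[of "{X..<X + a}"] by fastforce
      moreover have "inj_on (\<lambda>i. f (w (2 * i))) {..a}"
      proof (rule inj_onI)
        fix i j assume "i \<in> {..a}" "j \<in> {..a}" "f (w (2 * i)) = f (w (2 * j))"
        then show "i = j" using fwi[of "2 * i" "2 * j"] ac(6) by simp
      qed
      ultimately show False by (simp add: card_image)
    qed
  qed
  ultimately have w0: "X < f (w 0)" by simp
  \<comment> \<open>Leaves of the broom are adjacent to \<open>w 0\<close>, which lies above
    \<open>X\<close>, so \<open>T\<close> meets only the path. The path can get below
    \<open>X\<close> only through \<open>X\<close> and cannot return. It then occupies one leaf of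
    the host or part of the pendant path, hence at most \<open>c\<close> vertices.\<close>
  define T where "T = {v\<in>V. f v < X}"
  have TR: "T \<subseteq> w ` {1..q}"
  proof
    fix v assume v: "v \<in> T"
    have "v \<notin> R" using adj[OF w0R[of v]] w0 v by (auto simp: T_def)
    then obtain i where "i \<le> q" "v = w i" using v VR by (auto simp: T_def)
    moreover have "i \<noteq> 0" using w0 v calculation by (auto simp: T_def intro: ccontr)
    ultimately show "v \<in> w ` {1..q}" by auto
  qed
  have "card T \<le> c"
  proof (cases "T = {}")
    case False
    then obtain v where "v \<in> T" by blast
    moreover from this obtain i where "i \<in> {1..q}" "v = w i" using TR by blast
    ultimately have "\<exists>i. i \<le> q \<and> f (w i) < X" by (auto simp: T_def)
    then obtain i where i: "i \<le> q" "f (w i) < X" "\<And>j. j < i \<Longrightarrow> \<not> (j \<le> q \<and> f (w j) < X)"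
      using LeastI_ex[of "\<lambda>i. i \<le> q \<and> f (w i) < X"] not_less_Least[of _ "\<lambda>i. i \<le> q \<and> f (w i) < X"]
      by blast
    have i1: "1 \<le> i" using i(2) w0 by (cases i) auto
    have "(w (i - 1), w i) \<in> E" using w(4)[of "i - 1"] i1 i(1) by simp
    moreover have "X \<le> f (w (i - 1))" using i(3)[of "i - 1"] i1 i(1) by (simp add: not_less)
    ultimately have pre: "f (w (i - 1)) = X" using adj[of "w (i - 1)" "w i"] i(2) by auto
    show ?thesis
    proof (cases "f (w i) < N")
      case True
      have "i = q"
      proof (rule ccontr)
        assume "i \<noteq> q"
        then have "(w i, w (Suc i)) \<in> E" using w(4) i(1) by simp
        then have "f (w (Suc i)) = f (w (i - 1))" using adj[of "w i" "w (Suc i)"] True pre by (auto simp: X_def)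
        then have "Suc i = i - 1" by (rule fwi) (use i(1) \<open>i \<noteq> q\<close> in auto)
        then show False by simp
      qed
      have "T \<subseteq> {w q}"
      proof
        fix v assume v: "v \<in> T"
        then obtain j where j: "j \<in> {1..q}" "v = w j" using TR by blast
        then have "\<not> j < q" using i(3)[of j] \<open>i = q\<close> v by (auto simp: T_def)
        then show "v \<in> {w q}" using j by auto
      qed
      then have "card T \<le> card {w q}" by (intro card_mono) auto
      then show ?thesis using ac by simp
    next
      case False
      have tl: "N \<le> f (w r) \<and> f (w r) < X" if "i \<le> r" "r \<le> q" for r
        using that
      proof (induction r rule: dec_induct)
        case base then show ?case using False i by simp
      next
        case (step r)
        have "f (w (Suc r)) \<noteq> X"
        proof
          assume "f (w (Suc r)) = X"
          then have "f (w (Suc r)) = f (w (i - 1))" using pre by simp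
          then have "Suc r = i - 1" by (rule fwi) (use step.prems i(1) in simp_all)
          then show False using step(1) by simp
        qed
        then show ?case using adj[OF w(4)[of r]] step by auto
      qed
      have "f ` T \<subseteq> {N..<X}"
      proof
        fix j assume "j \<in> f ` T"
        then obtain v where v: "v \<in> T" "j = f v" by blast
        then obtain r where "r \<in> {1..q}" "v = w r" using TR by blast
        with v have r: "r \<le> q" "j = f (w r)" "f (w r) < X" by (auto simp: T_def)
        then have "i \<le> r" using i(3)[of r] by (meson not_less)
        then show "j \<in> {N..<X}" using tl r by simp
      qed
      then have "card (f ` T) \<le> card {N..<X}" by (intro card_mono) auto
      then show ?thesis using card_image[OF inj_on_subset[OF f(1)], of T] by (auto simp: T_def X_def)
    qed
  qed simp
  moreover have "card {v\<in>V. X \<le> f v} \<le> card {X..<X + a + k}"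
    by (rule card_inj_on_le[of f]) (use f(1) fb in \<open>auto intro: inj_on_subset\<close>)
  moreover have "n = card T + card {v\<in>V. X \<le> f v}"
    unfolding n_def T_def using finV
    by (subst card_Un_disjoint[symmetric]) (auto intro!: arg_cong[of _ _ card])
  \<comment> \<open>All but \<open>c\<close> vertices of \<open>F\<close> are on the two sides,
    which have \<open>a + k\<close> vertices. Together with \<open>q \<le> k\<close> this yields
    \<open>2 * n \<le> 3 * k + 5\<close>, one less than the assumed lower bound allows.\<close>
  ultimately have "n \<le> c + a + k" by simp
  then have "2 * n \<le> q + q mod 2 + 4 + 2 * k" using div_mult_mod_eq[of q 2] unfolding a_def c_def by linarith
  moreover have "q mod 2 \<le> 1" by simp
  ultimately show False using qk nums(5) by linarith
qed

end

theorem width_lower_bound: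
  assumes "connected_graph F"
  shows "2 / 3 * real (v_count F) - 2 < real (W' F)"
proof (rule ccontr)
  assume le: "\<not> ?thesis"
  obtain p where p: "defines_asymptotically p (containing F)" "width p = W' F"
    using LeastI_ex[of "\<lambda>w. \<exists>p. defines_asymptotically p (containing F) \<and> width p = w"]
      ex_defines_asymptotically[OF assms] unfolding W'_def by blast
  \<comment> \<open>The negated claim, multiplied by 3, is the inequality assumed in
    \<open>narrow\<close>.\<close>
  have "narrow F p"
    by unfold_locales (use assms p le in auto)
  then show False by (rule narrow.contradiction)
qed

section \<open>Ehrenfeucht games\<close>

definition agree :: "ngraph \<Rightarrow> ngraph \<Rightarrow> nat list \<Rightarrow> nat list \<Rightarrow> bool" where
  "agree G H as bs \<longleftrightarrow> length as = length bs \<and> (\<forall>i<length as. \<forall>j<length as.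
     (as ! i = as ! j \<longleftrightarrow> bs ! i = bs ! j) \<and>
     ((as ! i, as ! j) \<in> parcs G \<longleftrightarrow> (bs ! i, bs ! j) \<in> parcs H))"

primrec game :: "ngraph \<Rightarrow> ngraph \<Rightarrow> nat \<Rightarrow> nat list \<Rightarrow> nat list \<Rightarrow> bool" where
  "game G H 0 as bs \<longleftrightarrow> agree G H as bs"
| "game G H (Suc d) as bs \<longleftrightarrow> agree G H as bs \<and>
     (\<forall>a\<in>pverts G. \<exists>b\<in>pverts H. game G H d (as @ [a]) (bs @ [b])) \<and>
     (\<forall>b\<in>pverts H. \<exists>a\<in>pverts G. game G H d (as @ [a]) (bs @ [b]))"

lemma game_agree: "game G H d as bs \<Longrightarrow> agree G H as bs"
  by (cases d) auto

lemma agree_sym: "agree G H as bs \<longleftrightarrow> agree H G bs as"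
  unfolding agree_def by metis

lemma game_sym: "game G H d as bs \<Longrightarrow> game H G d bs as"
proof (induction d arbitrary: as bs)
  case 0
  then show ?case by (simp add: agree_sym)
next
  case (Suc d)
  then show ?case by (simp add: agree_sym) meson
qed

lemma game_play:
  assumes "game G H d as bs" "set cs \<subseteq> pverts G" "length cs \<le> d"
  shows "\<exists>ds. length ds = length cs \<and> set ds \<subseteq> pverts H \<and>
    game G H (d - length cs) (as @ cs) (bs @ ds)"
  using assms
proof (induction cs arbitrary: d as bs)
  case (Cons c cs)
  then obtain d0 where d: "d = Suc d0" by (cases d) auto
  then obtain b where b: "b \<in> pverts H" "game G H d0 (as @ [c]) (bs @ [b])" using Cons.prems by auto
  obtain ds where "length ds = length cs" "set ds \<subseteq> pverts H"
    "game G H (d0 - length cs) ((as @ [c]) @ cs) ((bs @ [b]) @ ds)"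
    using Cons.IH[OF b(2)] Cons.prems d by auto
  then show ?case using b d by (intro exI[of _ "b # ds"]) auto
qed auto

lemma agree_map:
  assumes "agree G H as bs"
  obtains \<tau> where "map \<tau> as = bs" "inj_on \<tau> (set as)"
    "\<And>y z. y \<in> set as \<Longrightarrow> z \<in> set as \<Longrightarrow> (\<tau> y, \<tau> z) \<in> parcs H \<longleftrightarrow> (y, z) \<in> parcs G"
proof -
  \<comment> \<open>The choice of the index is harmless, since equal entries of \<open>as\<close>
    have equal partners.\<close>
  define \<tau> where "\<tau> y = bs ! (SOME i. i < length as \<and> as ! i = y)" for y
  have \<tau>: "\<tau> (as ! i) = bs ! i" if i: "i < length as" for i
  proof -
    let ?j = "SOME j. j < length as \<and> as ! j = as ! i"
    have "?j < length as \<and> as ! ?j = as ! i" by (rule someI[of _ i]) (use i in simp)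
    then show ?thesis using assms i unfolding agree_def \<tau>_def by blast
  qed
  show ?thesis
  proof (rule that)
    show "map \<tau> as = bs" using \<tau> assms by (intro nth_equalityI) (auto simp: agree_def)
    show "inj_on \<tau> (set as)"
      using \<tau> assms by (intro inj_onI) (auto simp: agree_def in_set_conv_nth)
    fix y z assume "y \<in> set as" "z \<in> set as"
    then show "(\<tau> y, \<tau> z) \<in> parcs H \<longleftrightarrow> (y, z) \<in> parcs G"
      using \<tau> assms by (auto simp: agree_def in_set_conv_nth)
  qed
qed

section \<open>Finitely many formulas decide the game\<close>

lemma qdepth_foldr_Conj:
  "(\<And>p. p \<in> set ps \<Longrightarrow> qdepth p \<le> d) \<Longrightarrow> qdepth q \<le> d \<Longrightarrow> qdepth (foldr Conj ps q) \<le> d"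
  by (induction ps) auto

lemma qdepth_foldr_Disj:
  "(\<And>p. p \<in> set ps \<Longrightarrow> qdepth p \<le> d) \<Longrightarrow> qdepth q \<le> d \<Longrightarrow> qdepth (foldr Disj ps q) \<le> d"
  by (induction ps) auto

lemma sat_foldr_Disj:
  "sat G e (foldr Disj ps q) \<longleftrightarrow> (\<exists>p\<in>set ps. sat G e p) \<or> sat G e q"
  by (induction ps) auto

lemma free_vars_foldr_Disj:
  "free_vars (foldr Disj ps q) = (\<Union>p\<in>set ps. free_vars p) \<union> free_vars q"
  by (induction ps) auto

text \<open>The complete truth pattern \<open>T\<close> on the formulas \<open>ps\<close>, as in
  Hintikka formulas. The formula \<open>q\<close> closes the conjunction, as there is no
  propositional constant for truth.\<close>

definition diagram :: "fo list \<Rightarrow> fo set \<Rightarrow> fo \<Rightarrow> fo" where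
  "diagram ps T q = foldr Conj (map (\<lambda>p. if p \<in> T then p else Neg p) ps) q"

lemma sat_diagram:
  "sat G e (diagram ps T q) \<longleftrightarrow> (\<forall>p\<in>set ps. sat G e p \<longleftrightarrow> p \<in> T) \<and> sat G e q"
proof -
  have "(\<forall>r\<in>set (map (\<lambda>p. if p \<in> T then p else Neg p) ps). sat G e r) \<longleftrightarrow>
      (\<forall>p\<in>set ps. sat G e p \<longleftrightarrow> p \<in> T)"
    unfolding set_map ball_simps by (intro ball_cong refl) simp
  then show ?thesis unfolding diagram_def sat_foldr_Conj by blast
qed

lemma qdepth_diagram:
  "(\<And>p. p \<in> set ps \<Longrightarrow> qdepth p \<le> d) \<Longrightarrow> qdepth q \<le> d \<Longrightarrow> qdepth (diagram ps T q) \<le> d"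
  unfolding diagram_def by (rule qdepth_foldr_Conj) auto

lemma free_vars_diagram:
  "free_vars (diagram ps T q) = (\<Union>p\<in>set ps. free_vars p) \<union> free_vars q"
  unfolding diagram_def free_vars_foldr_Conj by (auto split: if_splits)

text \<open>Hintikka's construction. For one more round, the formulas say for each subset
  \<open>T\<close> of the previous set that some vertex realises exactly the pattern
  \<open>T\<close>; a move is answered by a vertex with the same pattern. Lists serve as assignments
  through \<open>nth\<close>, so the quantified variable \<open>m\<close> is the next list
  entry.\<close>

lemma finite_game_formulas:
  "\<exists>S. finite S \<and> (\<forall>p\<in>S. qdepth p \<le> d \<and> free_vars p \<subseteq> {..<m}) \<and>
     (\<forall>G H as bs. length as = m \<longrightarrow> length bs = m \<longrightarrow>
        (\<forall>p\<in>S. sat G (nth as) p \<longleftrightarrow> sat H (nth bs) p) \<longrightarrow> game G H d as bs)"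
proof (induction d arbitrary: m)
  case 0
  let ?S = "(\<lambda>(i, j). Adj i j) ` ({..<m} \<times> {..<m}) \<union> (\<lambda>(i, j). Eq i j) ` ({..<m} \<times> {..<m})"
  have "game G H 0 as bs" if "length as = m" "length bs = m"
    "\<forall>p\<in>?S. sat G (nth as) p \<longleftrightarrow> sat H (nth bs) p" for G H as bs
    using that unfolding game.simps agree_def ball_Un by fastforce
  then show ?case by (intro exI[of _ ?S]) auto
next
  case (Suc d)
  obtain S where S: "finite S" "\<forall>p\<in>S. qdepth p \<le> d \<and> free_vars p \<subseteq> {..<Suc m}"
    "\<And>G H as bs. length as = Suc m \<Longrightarrow> length bs = Suc m \<Longrightarrow>
       \<forall>p\<in>S. sat G (nth as) p \<longleftrightarrow> sat H (nth bs) p \<Longrightarrow> game G H d as bs"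
    using Suc[of "Suc m"] by blast
  obtain ps where ps: "set ps = S" using finite_list S(1) by blast
  let ?A = "(\<lambda>(i, j). Adj i j) ` ({..<m} \<times> {..<m}) \<union> (\<lambda>(i, j). Eq i j) ` ({..<m} \<times> {..<m})"
  let ?E = "(\<lambda>T. Exi m (diagram ps T (Eq m m))) ` Pow S"
  have ext: "sat G ((nth as)(m := a)) p \<longleftrightarrow> sat G (nth (as @ [a])) p"
    if "length as = m" "p \<in> S" for G as a p
  proof (rule sat_cong)
    fix x assume "x \<in> free_vars p"
    then have "x < Suc m" using that S(2) by blast
    then show "((nth as)(m := a)) x = nth (as @ [a]) x" using that(1) by (auto simp: nth_append)
  qed
  have game: "game G H (Suc d) as bs" if len: "length as = m" "length bs = m"
    and same: "\<forall>p\<in>?A \<union> ?E. sat G (nth as) p \<longleftrightarrow> sat H (nth bs) p" for G H as bs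
  proof -
    have ag: "agree G H as bs"
      using len same unfolding agree_def ball_Un by fastforce
    have step: "\<exists>b\<in>pverts H'. \<forall>p\<in>S. sat G' (nth (as' @ [a])) p \<longleftrightarrow> sat H' (nth (bs' @ [b])) p"
      if a: "a \<in> pverts G'" and len: "length as' = m" "length bs' = m"
        and same: "\<forall>p\<in>?E. sat G' (nth as') p \<longleftrightarrow> sat H' (nth bs') p" for G' H' as' bs' a
    proof -
      let ?T = "{p\<in>S. sat G' (nth (as' @ [a])) p}"
      have "sat G' (nth as') (Exi m (diagram ps ?T (Eq m m)))"
        using a ext[OF len(1)] by (auto simp: sat_diagram ps)
      moreover have "Exi m (diagram ps ?T (Eq m m)) \<in> ?E" by auto
      ultimately have "sat H' (nth bs') (Exi m (diagram ps ?T (Eq m m)))" using same by blast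
      then show ?thesis using ext[OF len(2)] by (auto simp: sat_diagram ps)
    qed
    have sameE: "\<forall>p\<in>?E. sat G (nth as) p \<longleftrightarrow> sat H (nth bs) p"
      "\<forall>p\<in>?E. sat H (nth bs) p \<longleftrightarrow> sat G (nth as) p"
      using same by (simp_all add: ball_Un)
    have "\<exists>b\<in>pverts H. game G H d (as @ [a]) (bs @ [b])" if aG: "a \<in> pverts G" for a
    proof -
      obtain b where b: "b \<in> pverts H" "\<forall>p\<in>S. sat G (nth (as @ [a])) p \<longleftrightarrow> sat H (nth (bs @ [b])) p"
        using step[OF aG len sameE(1)] by blast
      have "game G H d (as @ [a]) (bs @ [b])" by (rule S(3)[OF _ _ b(2)]) (use len in auto)
      then show ?thesis using b(1) by blast
    qed
    moreover have "\<exists>a\<in>pverts G. game G H d (as @ [a]) (bs @ [b])" if bH: "b \<in> pverts H" for b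
    proof -
      obtain a where a: "a \<in> pverts G" "\<forall>p\<in>S. sat H (nth (bs @ [b])) p \<longleftrightarrow> sat G (nth (as @ [a])) p"
        using step[OF bH len(2,1) sameE(2)] by blast
      have "game G H d (as @ [a]) (bs @ [b])" by (rule S(3)) (use a(2) len in auto)
      then show ?thesis using a(1) by blast
    qed
    ultimately show ?thesis using ag by simp
  qed
  have "qdepth p \<le> Suc d \<and> free_vars p \<subseteq> {..<m}" if p: "p \<in> ?A \<union> ?E" for p
  proof (cases "p \<in> ?A")
    case False
    then obtain T where T: "p = Exi m (diagram ps T (Eq m m))" using p by auto
    have "qdepth (diagram ps T (Eq m m)) \<le> d" by (rule qdepth_diagram) (use S(2) ps in auto)
    moreover have "free_vars p \<subseteq> {..<m}"
    proof -
      have "free_vars r \<subseteq> insert m {..<m}" if "r \<in> S" for r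
        using S(2) that by (simp add: lessThan_Suc)
      then show ?thesis by (auto simp: T free_vars_diagram ps)
    qed
    ultimately show ?thesis by (simp add: T)
  qed auto
  moreover have "finite (?A \<union> ?E)" using S(1) by auto
  ultimately show ?case by (intro exI[of _ "?A \<union> ?E"] conjI) (use game in auto)
qed

text \<open>Only finitely many truth patterns on \<open>S\<close> exist. The sentence is the
  disjunction of the patterns realised by graphs of the class, and the invariance shows that no
  other graph satisfies it.\<close>

lemma game_invariant_definable:
  assumes "1 \<le> d"
    and inv: "\<And>G H. P G \<Longrightarrow> P H \<Longrightarrow> game G H d [] [] \<Longrightarrow> G \<in> \<C> \<Longrightarrow> H \<in> \<C>"
    and ne: "\<And>G. P G \<Longrightarrow> pverts G \<noteq> {}"
  obtains p where "sentence p" "qdepth p \<le> d" "\<And>G. P G \<Longrightarrow> models G p \<longleftrightarrow> G \<in> \<C>"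
proof -
  obtain S where S: "finite S" "\<forall>p\<in>S. qdepth p \<le> d \<and> free_vars p \<subseteq> {..<0}"
    "\<And>G H. \<forall>p\<in>S. sat G (nth []) p \<longleftrightarrow> sat H (nth []) p \<Longrightarrow> game G H d [] []"
    using finite_game_formulas[of d 0] by auto
  obtain ps where ps: "set ps = S" using finite_list S(1) by blast
  define T where "T G = {p\<in>S. sat G (nth []) p}" for G
  have "finite (T ` {G. P G \<and> G \<in> \<C>})"
    by (rule finite_subset[of _ "Pow S"]) (use S(1) in \<open>auto simp: T_def\<close>)
  from finite_list[OF this] obtain ts where ts: "set ts = T ` {G. P G \<and> G \<in> \<C>}" ..
  \<comment> \<open>A closed tautology needs a quantifier; this is where \<open>1 \<le> d\<close>
    enters.\<close>
  define tru where "tru = All 0 (Eq 0 0)"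
  define p where "p = foldr Disj (map (\<lambda>t. diagram ps t tru) ts) (Neg tru)"
  have tru: "sat G e tru" "qdepth tru = 1" "free_vars tru = {}" for G e by (auto simp: tru_def)
  have sen: "sentence p"
    using S(2) by (auto simp: sentence_def p_def free_vars_foldr_Disj free_vars_diagram ps tru)
  show ?thesis
  proof (rule that[OF sen])
    show "qdepth p \<le> d"
      unfolding p_def
    proof (rule qdepth_foldr_Disj)
      fix r assume "r \<in> set (map (\<lambda>t. diagram ps t tru) ts)"
      then obtain t where "r = diagram ps t tru" by auto
      then show "qdepth r \<le> d" using S(2) ps tru assms(1) by (auto intro: qdepth_diagram)
    qed (use tru assms(1) in simp)
    fix G assume G: "P G"
    obtain c where c: "c \<in> pverts G" using ne[OF G] by blast
    have "models G p \<longleftrightarrow> sat G (nth []) p"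
      unfolding models_sentence[OF sen c]
      by (rule sat_cong) (use sen in \<open>simp add: sentence_def\<close>)
    also have "\<dots> \<longleftrightarrow> (\<exists>G'. P G' \<and> G' \<in> \<C> \<and> T G' = T G)"
      unfolding p_def sat_foldr_Disj by (auto simp: sat_diagram ts tru ps T_def)
    also have "\<dots> \<longleftrightarrow> G \<in> \<C>"
    proof
      assume "\<exists>G'. P G' \<and> G' \<in> \<C> \<and> T G' = T G"
      then obtain G' where G': "P G'" "G' \<in> \<C>" "T G' = T G" by blast
      have "game G' G d [] []" by (rule S(3)) (use G'(3) in \<open>auto simp: T_def\<close>)
      then show "G \<in> \<C>" using inv G' G by blast
    qed (use G in blast)
    finally show "models G p \<longleftrightarrow> G \<in> \<C>" .
  qed
qed

section \<open>Paths in the presence of a broom\<close>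

definition gpath :: "ngraph \<Rightarrow> nat list \<Rightarrow> bool" where
  "gpath G xs \<longleftrightarrow> xs \<noteq> [] \<and> distinct xs \<and> set xs \<subseteq> pverts G \<and>
     successively (\<lambda>u v. (u, v) \<in> parcs G) xs"

lemma successively_iff_nth:
  "successively R xs \<longleftrightarrow> (\<forall>i. Suc i < length xs \<longrightarrow> R (xs ! i) (xs ! Suc i))"
proof (induction R xs rule: successively.induct)
  case (3 R x y xs)
  have "(\<forall>i. Suc i < length (x # y # xs) \<longrightarrow> R ((x # y # xs) ! i) ((x # y # xs) ! Suc i)) \<longleftrightarrow>
      R x y \<and> (\<forall>i. Suc i < length (y # xs) \<longrightarrow> R ((y # xs) ! i) ((y # xs) ! Suc i))"
    by (auto simp: nth_Cons split: nat.splits)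
  then show ?case using 3 by simp
qed auto

lemma gpath_take:
  assumes "gpath G xs" "0 < n"
  shows "gpath G (take n xs)"
  using assms set_take_subset[of n xs] unfolding gpath_def successively_iff_nth by auto

text \<open>The walk is traversed backwards. A new start in \<open>X\<close> restarts the path, a
  start that already occurs cuts it there, and any other start is put in front.\<close>

lemma gpath_to_set:
  assumes G: "pair_graph G" and "(v, w) \<in> (parcs G)\<^sup>*" "w \<in> X" "w \<in> pverts G"
  obtains ps x where "gpath G (ps @ [x])" "x \<in> X" "set ps \<inter> X = {}" "hd (ps @ [x]) = v"
proof -
  have "\<exists>ps x. gpath G (ps @ [x]) \<and> x \<in> X \<and> set ps \<inter> X = {} \<and> hd (ps @ [x]) = v"
    using assms(2)
  proof (induction rule: converse_rtrancl_induct)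
    case base
    show ?case by (rule exI[of _ "[]"], rule exI[of _ w]) (use assms in \<open>auto simp: gpath_def\<close>)
  next
    case (step v v')
    then obtain ps x where ps: "gpath G (ps @ [x])" "x \<in> X" "set ps \<inter> X = {}" "hd (ps @ [x]) = v'"
      by blast
    have v: "v \<in> pverts G" using pair_graph_adj_verts(1)[OF G step(1)] .
    consider "v \<in> X" | "v \<notin> X" "v \<in> set ps" | "v \<notin> X" "v \<notin> set ps" by blast
    then show ?case
    proof cases
      case 1
      then show ?thesis by (intro exI[of _ "[]"] exI[of _ v]) (use v in \<open>auto simp: gpath_def\<close>)
    next
      case 2
      then obtain qs rs where qr: "ps = qs @ v # rs" by (meson split_list)
      then show ?thesis
        using ps by (intro exI[of _ "v # rs"] exI[of _ x]) (auto simp: gpath_def successively_append_iff)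
    next
      case 3
      have "successively (\<lambda>u v. (u, v) \<in> parcs G) ((v # ps) @ [x])"
        using ps(1,4) step(1) unfolding gpath_def by (cases "ps @ [x]") auto
      then show ?thesis
        using ps 3 v by (intro exI[of _ "v # ps"] exI[of _ x]) (auto simp: gpath_def)
    qed
  qed
  then show ?thesis using that by blast
qed

section \<open>Inserting vertices between consecutive vertices of a path\<close>

fun pairs_in :: "nat set \<Rightarrow> nat list \<Rightarrow> nat" where
  "pairs_in S (x # y # zs) = (if x \<in> S \<and> y \<in> S then 1 else 0) + pairs_in S (y # zs)"
| "pairs_in S _ = 0"

text \<open>Equality may fail because of a pair across the junction.\<close>

lemma pairs_in_append: "pairs_in S xs + pairs_in S ys \<le> pairs_in S (xs @ ys)"
proof (induction S xs rule: pairs_in.induct)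
  case ("2_2" S v)
  then show ?case by (cases ys) auto
qed auto

lemma pairs_in_upt:
  "pairs_in S (map u [m..<n]) = card {j. m \<le> j \<and> Suc j < n \<and> u j \<in> S \<and> u (Suc j) \<in> S}"
proof (induction "n - m" arbitrary: m)
  case 0
  then have "{j. m \<le> j \<and> Suc j < n \<and> u j \<in> S \<and> u (Suc j) \<in> S} = {}" by auto
  then show ?case unfolding \<open>_ = {}\<close> using 0 by simp
next
  case (Suc k)
  show ?case
  proof (cases "Suc m < n")
    case True
    let ?A = "\<lambda>m. {j. m \<le> j \<and> Suc j < n \<and> u j \<in> S \<and> u (Suc j) \<in> S}"
    have fin: "finite (?A m)" for m by (rule finite_subset[of _ "{..n}"]) auto
    have eq: "?A m = (if u m \<in> S \<and> u (Suc m) \<in> S then insert m (?A (Suc m)) else ?A (Suc m))"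
      using True by (auto simp: Suc_le_eq le_less)
    have "pairs_in S (map u [m..<n]) =
        (if u m \<in> S \<and> u (Suc m) \<in> S then 1 else 0) + pairs_in S (map u [Suc m..<n])"
      using True by (simp add: upt_conv_Cons)
    also have "\<dots> = card (?A m)" using Suc(1)[of "Suc m"] Suc(2) fin[of "Suc m"] by (simp add: eq)
    finally show ?thesis .
  next
    case False
    then have "n = Suc m" using Suc(2) by simp
    then show ?thesis by (auto intro!: arg_cong[of _ _ card])
  qed
qed

lemma pairs_in_rev_upt:
  "pairs_in S (map u (rev [0..<n])) = card {j. Suc j < n \<and> u j \<in> S \<and> u (Suc j) \<in> S}"
proof (induction n)
  case (Suc n)
  show ?case
  proof (cases n)
    case (Suc m)
    let ?A = "\<lambda>n. {j. Suc j < n \<and> u j \<in> S \<and> u (Suc j) \<in> S}"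
    have fin: "finite (?A n)" for n by (rule finite_subset[of _ "{..n}"]) auto
    have eq: "?A (Suc n) = (if u n \<in> S \<and> u m \<in> S then insert m (?A n) else ?A n)"
      using Suc by (auto simp: less_Suc_eq)
    have "m \<notin> ?A n" using Suc by simp
    then have "card (?A (Suc n)) = (if u n \<in> S \<and> u m \<in> S then 1 else 0) + card (?A n)"
      unfolding eq using fin[of n] by simp
    moreover have "pairs_in S (map u (rev [0..<Suc n])) =
        (if u n \<in> S \<and> u m \<in> S then 1 else 0) + pairs_in S (map u (rev [0..<n]))"
      using Suc by simp
    ultimately show ?thesis using Suc.IH by simp
  qed simp
qed simp

text \<open>Every consecutive pair from \<open>S\<close> can take one vertex of \<open>L0\<close>
  between its members, and each vertex of \<open>L0\<close> is used at most once. Insertions never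
  happen before the first vertex, so the start is kept.\<close>

lemma gpath_insert:
  assumes "gpath G xs" "finite L0" "L0 \<subseteq> pverts G" "L0 \<inter> set xs = {}"
    and "\<And>l s. l \<in> L0 \<Longrightarrow> s \<in> S \<Longrightarrow> (s, l) \<in> parcs G \<and> (l, s) \<in> parcs G"
    and "q \<le> pairs_in S xs" "q \<le> card L0"
  shows "\<exists>ys. gpath G ys \<and> hd ys = hd xs \<and> length ys = length xs + q \<and> set ys \<subseteq> set xs \<union> L0"
  using assms
proof (induction S xs arbitrary: q L0 rule: pairs_in.induct)
  case (1 S x y zs)
  have p: "gpath G (y # zs)" and xy: "(x, y) \<in> parcs G" and x: "x \<in> pverts G" "x \<notin> set (y # zs)"
    using "1.prems"(1) by (auto simp: gpath_def)
  show ?case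
  proof (cases "x \<in> S \<and> y \<in> S \<and> q > 0")
    case True
    then obtain q' where q: "q = Suc q'" by (cases q) auto
    then obtain l where l: "l \<in> L0" using "1.prems"(7) by force
    obtain ys where ys: "gpath G ys" "hd ys = y" "length ys = length (y # zs) + q'"
      "set ys \<subseteq> set (y # zs) \<union> (L0 - {l})"
    proof -
      have "\<exists>ys. gpath G ys \<and> hd ys = hd (y # zs) \<and> length ys = length (y # zs) + q' \<and>
          set ys \<subseteq> set (y # zs) \<union> (L0 - {l})"
      proof (rule "1.IH"[OF p])
        show "(L0 - {l}) \<inter> set (y # zs) = {}" using "1.prems"(4) by auto
        show "q' \<le> card (L0 - {l})" using "1.prems"(2,7) q l by simp
        show "q' \<le> pairs_in S (y # zs)" using "1.prems"(6) True q by simp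
      qed (use "1.prems"(2,3,5) in auto)
      then show ?thesis using that by auto
    qed
    obtain ys' where ys': "ys = y # ys'" using ys(1,2) by (cases ys) (auto simp: gpath_def)
    have "gpath G (x # l # ys)"
      using ys(1,4) ys' x l True "1.prems"(3,4,5) by (auto simp: gpath_def)
    then show ?thesis using ys q l by (intro exI[of _ "x # l # ys"]) auto
  next
    case False
    then have "q \<le> pairs_in S (y # zs)" using "1.prems"(6) by (auto split: if_splits)
    then obtain ys where ys: "gpath G ys" "hd ys = y" "length ys = length (y # zs) + q"
      "set ys \<subseteq> set (y # zs) \<union> L0"
      using "1.IH"[OF p, of L0 q] "1.prems"(2-5,7) by auto
    obtain ys' where ys': "ys = y # ys'" using ys(1,2) by (cases ys) (auto simp: gpath_def)
    have "gpath G (x # ys)"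
      using ys(1,4) ys' x xy "1.prems"(4) by (auto simp: gpath_def)
    then show ?thesis using ys by (intro exI[of _ "x # ys"]) auto
  qed
next
  case ("2_1" S)
  then show ?case by auto
next
  case ("2_2" S v)
  then show ?case by (intro exI[of _ "[v]"]) auto
qed

section \<open>A copy of the broom and a vertex that starts no long path\<close>

locale broom_copy =
  fixes G :: ngraph and a :: nat and u :: "nat \<Rightarrow> nat" and L :: "nat set" and v :: nat
  assumes conn: "connected_graph G"
    and u_inj: "inj_on u {..2 * a}" and u_V: "u ` {..2 * a} \<subseteq> pverts G"
    and u_E: "\<And>i. i < 2 * a \<Longrightarrow> (u i, u (Suc i)) \<in> parcs G"
    and L_V: "L \<subseteq> pverts G" and L_card: "card L = a - 1" and L_u: "L \<inter> u ` {..2 * a} = {}"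
    and L_E: "\<And>l. l \<in> L \<Longrightarrow> (u 0, l) \<in> parcs G"
    and a1: "1 \<le> a" and v_V: "v \<in> pverts G"
    and no_path: "\<And>ys. gpath G ys \<Longrightarrow> hd ys = v \<Longrightarrow> length ys \<le> 2 * a"
begin

abbreviation E where "E \<equiv> parcs G"

definition "J = {i\<in>{1..2 * a}. (u 0, u i) \<in> E}"
definition "N = u ` J \<union> L"
definition "cls W T = {y\<in>N - W. \<forall>w\<in>W. (w, y) \<in> E \<longleftrightarrow> w \<in> T}"
text \<open>Of \<open>2 * a + 1\<close> moves, \<open>2 * a - card W\<close> are left after pebbling
  the centre and \<open>W\<close>; every class has to be pebbled within these.\<close>

definition "good W \<longleftrightarrow> W \<subseteq> u ` J \<and> (\<forall>T\<subseteq>W. card (cls W T) + card W \<le> 2 * a)"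

lemma G: "pair_graph G"
  using conn by (simp add: connected_graph_def)

lemmas sym = pair_graph_sym[OF G] and irrefl = pair_graph_irrefl[OF G]
  and finV = pair_graph_finite[OF G]

lemma fin: "finite J" "finite L" "finite N"
  using finite_subset[OF L_V finV] by (auto simp: J_def N_def)

lemma J_sub: "J \<subseteq> {1..2 * a}" "J \<subseteq> {..2 * a}" "card J \<le> 2 * a"
proof -
  show 1: "J \<subseteq> {1..2 * a}" and "J \<subseteq> {..2 * a}" by (auto simp: J_def)
  show "card J \<le> 2 * a" using card_mono[OF _ 1] by simp
qed

lemma card_uJ: "I \<subseteq> {..2 * a} \<Longrightarrow> card (u ` I) = card I"
  using card_image inj_on_subset[OF u_inj] by blast

lemma u_eq: "i \<le> 2 * a \<Longrightarrow> j \<le> 2 * a \<Longrightarrow> u i = u j \<longleftrightarrow> i = j"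
  using inj_onD[OF u_inj] by auto

lemma card_N: "card N = card J + (a - 1)"
proof -
  have "card N = card (u ` J) + card L"
    unfolding N_def using fin L_u J_sub(2) by (intro card_Un_disjoint) auto
  then show ?thesis using card_uJ[OF J_sub(2)] L_card by simp
qed

text \<open>
  If no \<open>W\<close> is good, single vertices and small sets \<open>W\<close> already show that every neighbour of the centre on
  the path is adjacent either to few elements of \<open>N\<close> (low) or to almost all of them, with fewer than \<open>e\<close>
  deviations in total.
\<close>

context
  assumes bad: "\<And>W. \<not> good W"
begin

text \<open>The excess of \<open>card N\<close> over \<open>2 * a\<close>. It is positive because
  the empty set is not good.\<close>

definition "e = card J - a - 1"
definition "low w \<longleftrightarrow> card {y\<in>N. (w, y) \<in> E} < e"
text \<open>\<open>y\<close> is on the minority side of \<open>w\<close>. A vertex that is not low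
  deviates from itself, so deviations are counted outside \<open>W\<close> only.\<close>

definition "dev y w \<longleftrightarrow> (if low w then (w, y) \<in> E else (w, y) \<notin> E)"

lemma e: "card J = a + 1 + e" "1 \<le> e" "card N = 2 * a + e" "e < a"
proof -
  have "\<not> card (cls {} {}) \<le> 2 * a" using bad[of "{}"] by (simp add: good_def)
  then have "2 * a < card J + (a - 1)" using card_N by (simp add: cls_def)
  then show "card J = a + 1 + e" "1 \<le> e" "card N = 2 * a + e" "e < a"
    using a1 card_N J_sub(3) unfolding e_def by linarith+
qed

text \<open>As \<open>{w}\<close> is not good, one of its two classes has at least
  \<open>2 * a\<close> of the \<open>2 * a + e - 1\<close> elements of \<open>N - {w}\<close>, which
  leaves fewer than \<open>e\<close> for the other. If \<open>w\<close> is not low, the small class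
  is that of the nonneighbours.\<close>

lemma high_nonadj:
  assumes w: "w \<in> u ` J" and "\<not> low w"
  shows "card {y\<in>N - {w}. (w, y) \<notin> E} < e"
proof -
  let ?A = "{y\<in>N. (w, y) \<in> E}" and ?B = "{y\<in>N - {w}. (w, y) \<notin> E}"
  have wN: "w \<in> N" using w by (simp add: N_def)
  have "card N = card (insert w (?A \<union> ?B))"
    using wN irrefl[of w] by (intro arg_cong[of _ _ card]) auto
  also have "\<dots> = 1 + card (?A \<union> ?B)" using fin(3) irrefl[of w] by (subst card_insert_disjoint) auto
  also have "card (?A \<union> ?B) = card ?A + card ?B" by (rule card_Un_disjoint) (use fin(3) in auto)
  finally have sum: "card ?A + card ?B + 1 = 2 * a + e" using e by simp
  obtain T where T: "T \<subseteq> {w}" "2 * a < card (cls {w} T) + 1"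
    using bad[of "{w}"] w by (auto simp: good_def not_le)
  have "T = {} \<or> T = {w}" using T(1) by auto
  moreover have "cls {w} {} = ?B" by (auto simp: cls_def)
  moreover have "cls {w} {w} = ?A" using irrefl[of w] by (auto simp: cls_def)
  ultimately have "2 * a < card ?B + 1 \<or> 2 * a < card ?A + 1" using T(2) by metis
  then show ?thesis using sum assms(2) unfolding low_def by linarith
qed

text \<open>Otherwise \<open>e\<close> deviating vertices \<open>D\<close>, with one witness each,
  give a good set \<open>W'\<close> of at most \<open>e\<close> witnesses. The majority class avoids
  \<open>W'\<close> and \<open>D\<close>, so it has at most \<open>2 * a - card W'\<close> elements.
  Any other class lies in the minority of some witness and has fewer than \<open>e\<close> elements,
  where \<open>e < a\<close>.\<close>

lemma card_dev:
  assumes W: "W \<subseteq> u ` J"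
  shows "card {y\<in>N - W. \<exists>w\<in>W. dev y w} < e"
proof (rule ccontr)
  assume "\<not> ?thesis"
  then have "e \<le> card {y\<in>N - W. \<exists>w\<in>W. dev y w}" by simp
  then obtain D where D: "D \<subseteq> {y\<in>N - W. \<exists>w\<in>W. dev y w}" "card D = e"
    by (rule obtain_subset_with_card_n)
  have "\<exists>f. \<forall>y\<in>D. f y \<in> W \<and> dev y (f y)" using D(1) by (intro bchoice) auto
  then obtain f where f: "\<And>y. y \<in> D \<Longrightarrow> f y \<in> W \<and> dev y (f y)" by blast
  have finD: "finite D" using D(1) fin(3) by (auto intro: finite_subset[of _ N])
  define W' where "W' = f ` D"
  have W': "W' \<subseteq> W" "W' \<subseteq> u ` J" "card W' \<le> e" "finite W'"
    using f W D(2) card_image_le[OF finD, of f] finD by (auto simp: W'_def)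
  have "good W'"
    unfolding good_def
  proof (intro conjI allI impI)
    fix T assume T: "T \<subseteq> W'"
    show "card (cls W' T) + card W' \<le> 2 * a"
    proof (cases "T = {w\<in>W'. \<not> low w}")
      case True
      have sub: "cls W' T \<subseteq> N - W' - D"
      proof
        fix y assume y: "y \<in> cls W' T"
        have "y \<notin> D"
        proof
          assume yD: "y \<in> D"
          then have "f y \<in> W'" "dev y (f y)" using f by (auto simp: W'_def)
          then show False using y True by (auto simp: cls_def dev_def split: if_splits)
        qed
        then show "y \<in> N - W' - D" using y by (auto simp: cls_def)
      qed
      have "card (cls W' T) \<le> card (N - W' - D)" by (rule card_mono) (use sub fin in auto)
      also have "\<dots> = card N - card W' - card D"
      proof -
        have "W' \<subseteq> N" "D \<subseteq> N - W'" using W'(1,2) D(1) by (auto simp: N_def)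
        then show ?thesis using W'(4) finD by (simp add: card_Diff_subset)
      qed
      finally have "card (cls W' T) \<le> 2 * a + e - card W' - e" using e(3) D(2) by simp
      then show ?thesis using W'(3) e(4) by linarith
    next
      case False
      then obtain w where w: "w \<in> W'" "w \<in> T \<longleftrightarrow> low w" using T by blast
      have "cls W' T \<subseteq> (if low w then {y\<in>N. (w, y) \<in> E} else {y\<in>N - {w}. (w, y) \<notin> E})"
        using w by (auto simp: cls_def)
      then have "card (cls W' T) \<le> card (if low w then {y\<in>N. (w, y) \<in> E} else {y\<in>N - {w}. (w, y) \<notin> E})"
        using fin by (intro card_mono) auto
      also have "\<dots> < e" using high_nonadj[of w] w(1) W'(2) by (auto simp: low_def)
      finally show ?thesis using W'(3) e(4) by linarith
    qed
  qed (rule W'(2))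
  then show False using bad by blast
qed

definition "L0 = {l\<in>L. \<forall>w\<in>u ` J. \<not> dev l w}"

text \<open>Leaves lie off the path, so \<open>card_dev\<close> applies to the set of all path
  neighbours of the centre: fewer than \<open>e\<close> of the \<open>a - 1\<close> leaves are
  lost.\<close>

lemma card_L0: "a \<le> card L0 + e"
proof -
  have "L - L0 \<subseteq> {y\<in>N - u ` J. \<exists>w\<in>u ` J. dev y w}"
    using L_u J_sub(2) by (auto simp: L0_def N_def)
  then have "card (L - L0) \<le> card {y\<in>N - u ` J. \<exists>w\<in>u ` J. dev y w}" using fin by (intro card_mono) auto
  also have "\<dots> < e" by (rule card_dev) simp
  finally have "card (L - L0) < e" .
  moreover have "card (L - L0) = card L - card L0"
    using fin(2) by (intro card_Diff_subset) (auto simp: L0_def intro: finite_subset)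
  ultimately show ?thesis using L_card by linarith
qed

definition "PJ = {j\<in>{1..<2 * a}. j \<in> J \<and> Suc j \<in> J}"
definition "LP = {j\<in>PJ. low (u j) \<or> low (u (Suc j))}"
definition "Hi = {w\<in>u ` J. \<not> low w}"

lemma card_LP: "card LP + 2 \<le> 2 * e"
proof -
  \<comment> \<open>Pairs starting at indices of the same parity are disjoint, and each contributes a deviation.\<close>
  have par: "card {j\<in>LP. j mod 2 = r} < e" for r
  proof -
    define M where "M = {j\<in>LP. j mod 2 = r}"
    define li where "li j = (if low (u j) then j else Suc j)" for j
    define oi where "oi j = (if low (u j) then Suc j else j)" for j
    have M: "li j \<in> J" "oi j \<in> J" "low (u (li j))" "(u (li j), u (oi j)) \<in> E" "j mod 2 = r"
      if "j \<in> M" for j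
      using that u_E[of j] sym[OF u_E[of j]] by (auto simp: M_def LP_def PJ_def li_def oi_def)
    have apart: "oi j \<noteq> li j'" if "j \<in> M" "j' \<in> M" for j j'
    proof
      assume "oi j = li j'"
      moreover have "j mod 2 = j' mod 2" using M(5) that by simp
      ultimately show False by (auto simp: oi_def li_def split: if_splits) presburger+
    qed
    have oinj: "inj_on oi M"
    proof (rule inj_onI)
      fix j j' assume "j \<in> M" "j' \<in> M" and eq: "oi j = oi j'"
      then have "j mod 2 = j' mod 2" using M(5) by simp
      then show "j = j'" using eq by (auto simp: oi_def split: if_splits) presburger+
    qed
    let ?W = "u ` li ` M"
    have "u ` oi ` M \<subseteq> {y\<in>N - ?W. \<exists>w\<in>?W. dev y w}"
    proof
      fix y assume "y \<in> u ` oi ` M"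
      then obtain j where j: "j \<in> M" "y = u (oi j)" by auto
      have "y \<notin> ?W"
      proof
        assume "y \<in> ?W"
        then obtain j' where j': "j' \<in> M" "u (oi j) = u (li j')" using j by auto
        then have "oi j = li j'" using u_eq M(1)[OF j'(1)] M(2)[OF j(1)] J_sub(2) by auto
        then show False using apart j j' by blast
      qed
      moreover have "y \<in> N" using M(2)[OF j(1)] j(2) by (auto simp: N_def)
      moreover have "dev y (u (li j))" using M(3,4)[OF j(1)] j(2) by (simp add: dev_def)
      ultimately show "y \<in> {y\<in>N - ?W. \<exists>w\<in>?W. dev y w}" using j(1) by blast
    qed
    then have "card (u ` oi ` M) \<le> card {y\<in>N - ?W. \<exists>w\<in>?W. dev y w}" using fin by (intro card_mono) auto
    also have "\<dots> < e" by (rule card_dev) (use M(1) in auto)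
    also have "card (u ` oi ` M) = card M"
    proof -
      have "oi ` M \<subseteq> {..2 * a}" using M(2) J_sub(2) by blast
      then show ?thesis using card_uJ card_image[OF oinj] by simp
    qed
    finally show ?thesis by (simp add: M_def)
  qed
  have "card LP = card ({j\<in>LP. j mod 2 = 0} \<union> {j\<in>LP. j mod 2 = 1})"
    by (rule arg_cong[of _ _ card]) auto
  also have "\<dots> \<le> card {j\<in>LP. j mod 2 = 0} + card {j\<in>LP. j mod 2 = 1}" by (rule card_Un_le)
  finally have "card LP \<le> card {j\<in>LP. j mod 2 = 0} + card {j\<in>LP. j mod 2 = 1}" .
  then show ?thesis using par[of 0] par[of 1] by linarith
qed

text \<open>Every index in \<open>J\<close> except possibly \<open>2 * a\<close> starts a pair in
  \<open>PJ\<close> or is followed by an index outside \<open>J\<close>. Inside the gap only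
  \<open>i + 1\<close> can be such a follower, so a nonempty gap leaves \<open>card PJ\<close> at
  least \<open>2 * e + (g - i - 1)\<close>, and at most \<open>2 * e - 2\<close> of these pairs
  contain a low vertex.\<close>

lemma card_high_pairs:
  assumes "i < g" "g \<le> 2 * a + 1" "{i<..<g} \<inter> J = {}"
  shows "g - i - 1 \<le> card {j\<in>PJ. u j \<in> Hi \<and> u (Suc j) \<in> Hi}"
proof (cases "g - i - 1 = 0")
  case False
  have lost: "j \<notin> J" if "i < j" "j < g" for j using assms(3) that by (auto simp: disjoint_iff)
  define C where "C = {1..2 * a} - J"
  have subC: "{i + 2..<g} \<subseteq> C" using lost assms(2) by (auto simp: C_def)
  have cC: "card C = 2 * a - card J" unfolding C_def using J_sub(1) fin(1) by (simp add: card_Diff_subset)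
  have finPJ: "finite PJ" using fin(1) by (simp add: PJ_def)
  define Q where "Q = {j\<in>J. j < 2 * a \<and> Suc j \<notin> J}"
  have finQ: "finite Q" using fin(1) by (simp add: Q_def)
  have "Suc ` Q \<subseteq> C - {i + 2..<g}"
  proof
    fix j assume "j \<in> Suc ` Q"
    then obtain j' where j': "j' \<in> J" "j' < 2 * a" "j = Suc j'" "j \<notin> J" by (auto simp: Q_def)
    have "j \<notin> {i + 2..<g}" using j' lost[of j'] by auto
    then show "j \<in> C - {i + 2..<g}" using j' by (auto simp: C_def)
  qed
  then have "card (Suc ` Q) \<le> card (C - {i + 2..<g})" by (intro card_mono) (auto simp: C_def)
  also have "\<dots> = card C - card {i + 2..<g}"
    by (rule card_Diff_subset[OF _ subC]) simp
  \<comment> \<open>The second alternative only covers truncated subtraction; \<open>sub2\<close>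
    excludes it.\<close>
  finally have cQ: "card Q + (g - i - 2) \<le> 2 * a - card J + 0 \<or> 2 * a - card J < g - i - 2"
    using cC by (simp add: card_image) linarith
  have sub2: "card {i + 2..<g} \<le> card C" by (rule card_mono[OF _ subC]) (simp add: C_def)
  have "J \<subseteq> insert (2 * a) (PJ \<union> Q)" using J_sub(1) by (auto simp: PJ_def Q_def)
  then have "card J \<le> card (insert (2 * a) (PJ \<union> Q))" using finPJ finQ by (intro card_mono) auto
  also have "\<dots> \<le> Suc (card PJ + card Q)"
    using card_insert_le_m1[of "Suc (card PJ + card Q)" "PJ \<union> Q" "2 * a"] card_Un_le[of PJ Q] by simp
  finally have cJ: "card J \<le> Suc (card PJ + card Q)" .
  have "PJ - LP \<subseteq> {j\<in>PJ. u j \<in> Hi \<and> u (Suc j) \<in> Hi}" by (auto simp: LP_def Hi_def PJ_def)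
  then have "card (PJ - LP) \<le> card {j\<in>PJ. u j \<in> Hi \<and> u (Suc j) \<in> Hi}" using finPJ by (intro card_mono) auto
  moreover have "card (PJ - LP) = card PJ - card LP"
    by (rule card_Diff_subset) (use finPJ in \<open>auto simp: LP_def\<close>)
  ultimately show ?thesis using cQ sub2 cC cJ card_LP e J_sub(3) False by simp
qed simp

text \<open>A path from \<open>v\<close> to the copy is continued inside the copy. From a leaf it
  runs through the centre along the whole path; from \<open>u i\<close> it goes back to the centre
  and jumps to the next path neighbour of the centre beyond \<open>i\<close>.\<close>

lemma long_path_from_v: False
proof -
  let ?X = "u ` {..2 * a} \<union> L"
  have u0: "u 0 \<in> ?X" "u 0 \<in> pverts G" using u_V by auto
  have "(v, u 0) \<in> E\<^sup>*" using conn v_V u0(2) by (simp add: connected_graph_iff)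
  then obtain ps x where ps: "gpath G (ps @ [x])" "x \<in> ?X" "set ps \<inter> ?X = {}" "hd (ps @ [x]) = v"
    by (rule gpath_to_set[OF G _ u0])
  have up: "gpath G (map u [0..<2 * a + 1])"
    using u_inj u_V u_E unfolding gpath_def successively_iff_nth distinct_map
    by (auto simp: atLeastLessThanSuc_atLeastAtMost atMost_atLeast0 simp del: upt_Suc)
  show False
  proof (cases "x \<in> L")
    case True
    have "gpath G ((ps @ [x]) @ map u [0..<2 * a + 1])"
      using ps up True L_u sym[OF L_E[OF True]] unfolding gpath_def successively_append_iff
      by (auto simp: hd_map simp del: upt_Suc)
    from no_path[OF this] ps(4) show False by (cases ps) auto
  next
    case False
    then obtain i where i: "i \<le> 2 * a" "x = u i" using ps(2) by auto
    \<comment> \<open>The default \<open>2 * a + 1\<close> makes the segment after the jump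
      empty.\<close>
    define g where "g = (if \<exists>j. j \<in> J \<and> i < j then LEAST j. j \<in> J \<and> i < j else 2 * a + 1)"
    have g: "i < g" "g \<le> 2 * a + 1" "{i<..<g} \<inter> J = {}" "g = 2 * a + 1 \<or> g \<in> J"
    proof -
      have "i < g \<and> g \<le> 2 * a + 1 \<and> {i<..<g} \<inter> J = {} \<and> (g = 2 * a + 1 \<or> g \<in> J)"
      proof (cases "\<exists>j. j \<in> J \<and> i < j")
        case True
        then have "g \<in> J \<and> i < g" unfolding g_def using LeastI_ex[OF True] by simp
        moreover have "j \<notin> J" if "i < j" "j < g" for j
          using not_less_Least[of j "\<lambda>j. j \<in> J \<and> i < j"] that True by (auto simp: g_def)
        ultimately show ?thesis using J_sub(2) by auto
      next
        case False
        then show ?thesis using i by (auto simp: g_def)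
      qed
      then show "i < g" "g \<le> 2 * a + 1" "{i<..<g} \<inter> J = {}" "g = 2 * a + 1 \<or> g \<in> J" by blast+
    qed
    define q where "q = g - i - 1"
    \<comment> \<open>This path misses \<open>q\<close> vertices, none of them adjacent to the centre; \<open>q\<close> insertions make up for it.\<close>
    define zs where "zs = ps @ map u (rev [0..<Suc i]) @ map u [g..<2 * a + 1]"
    have zs: "gpath G zs"
    proof -
      have A: "gpath G (ps @ [u i])" using ps i by simp
      have B: "successively (\<lambda>u v. (u, v) \<in> E) (map u (rev [0..<Suc i]))"
        unfolding successively_iff_nth
      proof (intro allI impI)
        fix j assume "Suc j < length (map u (rev [0..<Suc i]))"
        then have j: "Suc j \<le> i" by simp
        have "map u (rev [0..<Suc i]) ! j = u (i - j)" "map u (rev [0..<Suc i]) ! Suc j = u (i - Suc j)"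
          using j by (simp_all add: rev_nth nth_append del: upt_Suc)
        moreover have "(u (i - j), u (i - Suc j)) \<in> E"
          using sym[OF u_E[of "i - Suc j"]] j i by (simp add: Suc_diff_Suc)
        ultimately show "(map u (rev [0..<Suc i]) ! j, map u (rev [0..<Suc i]) ! Suc j) \<in> E" by simp
      qed
      have C: "successively (\<lambda>u v. (u, v) \<in> E) (map u [g..<2 * a + 1])"
        unfolding successively_iff_nth using u_E by (auto simp del: upt_Suc)
      have D: "map u [g..<2 * a + 1] = [] \<or> (u 0, hd (map u [g..<2 * a + 1])) \<in> E"
        using g(4) by (auto simp: J_def hd_map simp del: upt_Suc)
      have hd1: "hd (map u (rev [0..<Suc i])) = u i" by simp
      have last1: "last (map u (rev [0..<Suc i])) = u 0" by (simp add: last_map last_rev del: upt_Suc)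
      have "successively (\<lambda>u v. (u, v) \<in> E) zs"
        using A B C D hd1 last1 unfolding zs_def gpath_def successively_append_iff
        by (auto simp: hd_append last_append simp del: upt_Suc map_map)
      moreover have "distinct zs"
      proof -
        have "distinct (map u (rev [0..<Suc i] @ [g..<2 * a + 1]))"
          unfolding distinct_map
          using i g by (intro conjI inj_on_subset[OF u_inj]) (auto simp del: upt_Suc)
        moreover have "set ps \<inter> set (map u (rev [0..<Suc i] @ [g..<2 * a + 1])) = {}"
          using ps(3) i g by (auto simp del: upt_Suc)
        ultimately show ?thesis using A unfolding zs_def gpath_def by (simp del: upt_Suc)
      qed
      moreover have "set zs \<subseteq> pverts G"
      proof -
        have "u j \<in> pverts G" if "j \<le> 2 * a" for j using u_V that by auto
        then show ?thesis using A i unfolding zs_def gpath_def by (auto simp del: upt_Suc)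
      qed
      moreover have "zs \<noteq> []" by (simp add: zs_def)
      ultimately show ?thesis by (simp add: gpath_def)
    qed
    have hd: "hd zs = v" using ps(4) i by (cases ps) (simp_all add: zs_def)
    have len: "length zs = length ps + (2 * a + 1 - q)" using i g(1,2) unfolding zs_def q_def by (simp del: upt_Suc)
    have "q \<le> card {j\<in>PJ. u j \<in> Hi \<and> u (Suc j) \<in> Hi}"
      unfolding q_def by (rule card_high_pairs[OF g(1-3)])
    \<comment> \<open>If \<open>q = 0\<close>, the pair formed by \<open>i\<close> and
      \<open>g\<close> may be counted on the left but not on the right. The summand
      \<open>2 * a\<close> absorbs this case, in which nothing has to be inserted.\<close>
    also have "\<dots> \<le> card ({j. Suc j < Suc i \<and> u j \<in> Hi \<and> u (Suc j) \<in> Hi} \<union>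
        {j. g \<le> j \<and> Suc j < 2 * a + 1 \<and> u j \<in> Hi \<and> u (Suc j) \<in> Hi}) + (if q = 0 then 2 * a else 0)"
      (is "_ \<le> card (?A \<union> ?B) + _")
    proof (cases "q = 0")
      case True
      have "card {j\<in>PJ. u j \<in> Hi \<and> u (Suc j) \<in> Hi} \<le> card {1..<2 * a}"
        by (rule card_mono) (auto simp: PJ_def)
      then show ?thesis using True by simp
    next
      case False
      have "{j\<in>PJ. u j \<in> Hi \<and> u (Suc j) \<in> Hi} \<subseteq> ?A \<union> ?B"
      proof
        fix j assume j: "j \<in> {j\<in>PJ. u j \<in> Hi \<and> u (Suc j) \<in> Hi}"
        then have "j \<in> J" "Suc j \<in> J" "j < 2 * a" by (auto simp: PJ_def)
        then have "\<not> (i < j \<and> j < g)" "\<not> (i < Suc j \<and> Suc j < g)" using g(3) by auto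
        then have "Suc j \<le> i \<or> g \<le> j" using False by (auto simp: q_def)
        then show "j \<in> ?A \<union> ?B" using j \<open>j < 2 * a\<close> by auto
      qed
      moreover have "finite (?A \<union> ?B)" by (rule finite_subset[of _ "{..2 * a + i}"]) auto
      ultimately have "card {j\<in>PJ. u j \<in> Hi \<and> u (Suc j) \<in> Hi} \<le> card (?A \<union> ?B)" by (intro card_mono)
      then show ?thesis by simp
    qed
    finally have q1: "q \<le> card (?A \<union> ?B) \<or> q = 0" by auto
    have "card (?A \<union> ?B) \<le> card ?A + card ?B" by (rule card_Un_le)
    also have "\<dots> = pairs_in Hi (map u (rev [0..<Suc i])) + pairs_in Hi (map u [g..<2 * a + 1])"
      by (simp only: pairs_in_upt pairs_in_rev_upt)
    also have "\<dots> \<le> pairs_in Hi (map u (rev [0..<Suc i]) @ map u [g..<2 * a + 1])"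
      by (rule pairs_in_append)
    also have "\<dots> \<le> pairs_in Hi zs"
      unfolding zs_def using pairs_in_append[of Hi ps] by (meson add_leD2)
    finally have q2: "q \<le> pairs_in Hi zs" using q1 by auto
    \<comment> \<open>The skipped vertices are not adjacent to the centre, so there are at most
      \<open>a - 1 - e\<close> of them, fewer than \<open>card L0\<close>.\<close>
    have "q \<le> card ({1..2 * a} - J)"
    proof -
      have "card {i<..<g} \<le> card ({1..2 * a} - J)" by (rule card_mono) (use g in auto)
      then show ?thesis by (simp add: q_def)
    qed
    also have "\<dots> = 2 * a - card J" using J_sub(1) fin(1) by (simp add: card_Diff_subset)
    finally have q3: "q \<le> card L0" using card_L0 e by linarith
    have hiL: "(s, l) \<in> E \<and> (l, s) \<in> E" if "l \<in> L0" "s \<in> Hi" for l s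
      using that sym[of s l] by (auto simp: L0_def Hi_def dev_def)
    have L0: "finite L0" "L0 \<subseteq> pverts G" "L0 \<inter> set zs = {}"
    proof -
      have "L0 \<subseteq> L" by (auto simp: L0_def)
      then show "finite L0" "L0 \<subseteq> pverts G" using fin L_V finite_subset by auto
      have "set zs \<subseteq> set ps \<union> u ` {..2 * a}" using i by (auto simp: zs_def simp del: upt_Suc)
      then show "L0 \<inter> set zs = {}" using \<open>L0 \<subseteq> L\<close> ps(3) L_u by blast
    qed
    obtain ys where ys: "gpath G ys" "hd ys = hd zs" "length ys = length zs + q"
      using gpath_insert[OF zs L0 hiL q2 q3] by blast
    have "length ys \<le> 2 * a" using no_path[OF ys(1)] ys(2) hd by simp
    then show False using ys(3) len by simp
  qed
qed

end

lemma ex_good: "\<exists>W. good W"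
  using long_path_from_v by blast

end

section \<open>Upper bound on the depth\<close>

definition broom :: "nat \<Rightarrow> ngraph" where
  "broom a = mk_graph (3 * a) (\<lambda>i j. i < 2 * a \<and> j = Suc i \<or> i = 0 \<and> 2 * a < j)"

lemma connected_broom: "1 \<le> a \<Longrightarrow> connected_graph (broom a)"
  unfolding broom_def
proof (rule connected_mk_graph[where r = 0 and \<mu> = "\<lambda>i. i"])
  fix i assume "1 \<le> a" "i < 3 * a" "i \<noteq> 0"
  then show "\<exists>j<3 * a. j < i \<and> ((i < 2 * a \<and> j = Suc i \<or> i = 0 \<and> 2 * a < j) \<or>
      (j < 2 * a \<and> i = Suc j \<or> j = 0 \<and> 2 * a < i))"
    by (intro exI[of _ "if i \<le> 2 * a then i - 1 else 0"]) auto
qed simp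

lemma pair_graph_broom: "pair_graph (broom a)"
  by (simp add: broom_def)

lemma broom_containI:
  assumes G: "pair_graph G" and a: "1 \<le> a" and u: "inj_on u {..2 * a}" "u ` {..2 * a} \<subseteq> pverts G"
    "\<And>i. i < 2 * a \<Longrightarrow> (u i, u (Suc i)) \<in> parcs G"
    and L: "L \<subseteq> pverts G" "L \<inter> u ` {..2 * a} = {}" "a - 1 \<le> card L"
    "\<And>l. l \<in> L \<Longrightarrow> (u 0, l) \<in> parcs G"
  shows "G \<in> containing (broom a)"
proof -
  obtain L' where L': "L' \<subseteq> L" "card L' = a - 1" "finite L'"
    using obtain_subset_with_card_n[OF L(3)] finite_subset[OF L(1) pair_graph_finite[OF G]]
    by (metis finite_subset)
  have "card {2 * a<..<3 * a} = card L'" using L'(2) by simp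
  then obtain h where h: "bij_betw h {2 * a<..<3 * a} L'"
    using finite_same_card_bij[of "{2 * a<..<3 * a}" L'] L'(3) by blast
  have hL: "h i \<in> L" if "2 * a < i" "i < 3 * a" for i
    using h L'(1) that by (auto simp: bij_betw_def)
  define f where "f i = (if i \<le> 2 * a then u i else h i)" for i
  have fu: "f i = u i" if "i \<le> 2 * a" for i using that by (simp add: f_def)
  have fh: "f i = h i" if "2 * a < i" for i using that by (simp add: f_def)
  have split: "pverts (broom a) = {..2 * a} \<union> {2 * a<..<3 * a}" using a by (auto simp: broom_def)
  have "inj_on f (pverts (broom a))"
    unfolding split
  proof (rule inj_on_Un[THEN iffD2], intro conjI)
    show "inj_on f {..2 * a}" using u(1) by (auto simp: inj_on_def fu)
    show "inj_on f {2 * a<..<3 * a}" using h by (auto simp: inj_on_def bij_betw_def fh)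
    have "u i \<noteq> h j" if "i \<le> 2 * a" "2 * a < j" "j < 3 * a" for i j
      using hL[OF that(2,3)] L(2) that(1) by (metis IntI atMost_iff empty_iff image_eqI)
    then show "f ` ({..2 * a} - {2 * a<..<3 * a}) \<inter> f ` ({2 * a<..<3 * a} - {..2 * a}) = {}"
      by (auto simp: fu fh)
  qed
  moreover have "f ` pverts (broom a) \<subseteq> pverts G"
    unfolding split using u(2) L(1) hL by (auto simp: fu fh)
  moreover have "(f i, f j) \<in> parcs G" if "(i, j) \<in> parcs (broom a)" for i j
  proof -
    have fwd: "(f i, f j) \<in> parcs G"
      if "i < 2 * a \<and> j = Suc i \<or> i = 0 \<and> 2 * a < j" "j < 3 * a" for i j
      using that u(3)[of i] L(4)[OF hL[of j]] by (auto simp: fu fh)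
    show ?thesis using that fwd[of i j] pair_graph_sym[OF G fwd[of j i]] by (auto simp: broom_def)
  qed
  ultimately show ?thesis
    unfolding containing_iff[OF pair_graph_broom G]
    by (intro exI[of _ f]) auto
qed

lemma broom_containE:
  assumes "G \<in> containing (broom a)" "1 \<le> a"
  obtains u L where "inj_on u {..2 * a}" "u ` {..2 * a} \<subseteq> pverts G"
    "\<And>i. i < 2 * a \<Longrightarrow> (u i, u (Suc i)) \<in> parcs G"
    "L \<subseteq> pverts G" "L \<inter> u ` {..2 * a} = {}" "card L = a - 1"
    "\<And>l. l \<in> L \<Longrightarrow> (u 0, l) \<in> parcs G"
proof -
  have G: "pair_graph G" using assms by (simp add: containing_def)
  obtain f where f: "inj_on f (pverts (broom a))" "f ` pverts (broom a) \<subseteq> pverts G"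
    "\<forall>(i, j)\<in>parcs (broom a). (f i, f j) \<in> parcs G"
    using assms(1)[unfolded containing_iff[OF pair_graph_broom G]] by (elim exE conjE)
  have f3: "(f i, f j) \<in> parcs G" if "(i, j) \<in> parcs (broom a)" for i j using f(3) that by auto
  have V: "pverts (broom a) = {..<3 * a}" by (simp add: broom_def)
  show ?thesis
  proof (rule that[of f "f ` {2 * a<..<3 * a}"])
    show "inj_on f {..2 * a}" by (rule inj_on_subset[OF f(1)]) (use assms(2) in \<open>auto simp: V\<close>)
    show "f ` {..2 * a} \<subseteq> pverts G" using f(2) assms(2) by (auto simp: V)
    show "f ` {2 * a<..<3 * a} \<subseteq> pverts G" using f(2) by (auto simp: V)
    show "(f i, f (Suc i)) \<in> parcs G" if "i < 2 * a" for i
      by (rule f3) (use that assms(2) in \<open>auto simp: broom_def\<close>)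
    show "f ` {2 * a<..<3 * a} \<inter> f ` {..2 * a} = {}"
    proof -
      have "f i \<noteq> f j" if "2 * a < i" "i < 3 * a" "j \<le> 2 * a" for i j
        using inj_onD[OF f(1), of i j] that by (auto simp: V)
      then show ?thesis by auto
    qed
    have "inj_on f {2 * a<..<3 * a}" by (rule inj_on_subset[OF f(1)]) (auto simp: V)
    then show "card (f ` {2 * a<..<3 * a}) = a - 1" by (simp add: card_image)
    fix l assume "l \<in> f ` {2 * a<..<3 * a}"
    then show "(f 0, l) \<in> parcs G" using f3[of 0] assms(2) by (auto simp: broom_def)
  qed
qed

section \<open>Balls, distance layers and large graphs\<close>

primrec gball :: "ngraph \<Rightarrow> nat \<Rightarrow> nat \<Rightarrow> nat set" where
  "gball G x 0 = {x}"
| "gball G x (Suc k) = gball G x k \<union> {y. \<exists>z\<in>gball G x k. (z, y) \<in> parcs G}"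

lemma gball_mono: "i \<le> j \<Longrightarrow> gball G x i \<subseteq> gball G x j"
  by (induction j rule: dec_induct) auto

lemma finite_nbrs: "pair_graph G \<Longrightarrow> finite {y. (z, y) \<in> parcs G}"
  by (rule finite_subset[OF _ pair_graph_finite]) (auto dest: pair_graph_adj_verts)

lemma card_gball:
  assumes "pair_graph G" "\<And>z. card {y. (z, y) \<in> parcs G} < D"
  shows "finite (gball G x k) \<and> card (gball G x k) \<le> D ^ k"
proof (induction k)
  case (Suc k)
  have eq: "gball G x (Suc k) = (\<Union>z\<in>gball G x k. insert z {y. (z, y) \<in> parcs G})" by auto
  have "card (gball G x (Suc k)) \<le> (\<Sum>z\<in>gball G x k. card (insert z {y. (z, y) \<in> parcs G}))"
    unfolding eq by (rule card_UN_le) (use Suc in simp)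
  also have "\<dots> \<le> (\<Sum>z\<in>gball G x k. D)"
  proof (rule sum_mono)
    fix z
    have "card (insert z {y. (z, y) \<in> parcs G}) \<le> Suc (card {y. (z, y) \<in> parcs G})"
      using finite_nbrs[OF assms(1)] by (simp add: card_insert_if)
    also have "\<dots> \<le> D" using assms(2)[of z] by simp
    finally show "card (insert z {y. (z, y) \<in> parcs G}) \<le> D" .
  qed
  also have "\<dots> \<le> D ^ Suc k" using Suc by simp
  finally show ?case using Suc finite_nbrs[OF assms(1)] unfolding eq by blast
qed simp

definition layer :: "ngraph \<Rightarrow> nat \<Rightarrow> nat \<Rightarrow> nat set" where
  "layer G x k = {y\<in>gball G x k. \<forall>i<k. y \<notin> gball G x i}"

text \<open>A shortest path from \<open>x\<close>: a neighbour of \<open>y\<close> inside the ball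
  of radius \<open>k\<close> cannot be in a smaller ball, as \<open>y\<close> would then be too
  close. Vertices in different layers are distinct, so the path is injective.\<close>

lemma layer_path:
  assumes "y \<in> layer G x k"
  shows "\<exists>u. u k = y \<and> (\<forall>i\<le>k. u i \<in> layer G x i) \<and> (\<forall>i<k. (u i, u (Suc i)) \<in> parcs G)"
  using assms
proof (induction k arbitrary: y)
  case 0
  then show ?case by (intro exI[of _ "\<lambda>_. y"]) auto
next
  case (Suc k)
  then have "y \<in> gball G x (Suc k)" "y \<notin> gball G x k" by (auto simp: layer_def)
  then obtain z where z: "z \<in> gball G x k" "(z, y) \<in> parcs G" by auto
  have "z \<in> layer G x k"
  proof -
    have "z \<notin> gball G x i" if "i < k" for i
    proof
      assume "z \<in> gball G x i"
      then have "y \<in> gball G x (Suc i)" using z(2) by auto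
      then show False using Suc.prems that by (auto simp: layer_def simp del: gball.simps)
    qed
    then show ?thesis using z(1) by (auto simp: layer_def)
  qed
  from Suc.IH[OF this] obtain u where u: "u k = z" "\<forall>i\<le>k. u i \<in> layer G x i"
    "\<forall>i<k. (u i, u (Suc i)) \<in> parcs G" by blast
  show ?case
    by (rule exI[of _ "u(Suc k := y)"]) (use u z(2) Suc.prems in \<open>auto simp: le_Suc_eq less_Suc_eq\<close>)
qed

text \<open>A vertex of degree at least \<open>3 * a\<close> keeps \<open>a - 1\<close> neighbours
  off any path on \<open>2 * a + 1\<close> vertices that starts at it. If all degrees are smaller,
  the ball of radius \<open>2 * a - 1\<close> around \<open>x\<close> misses a vertex, and a
  shortest path to distance \<open>2 * a\<close> contains only one neighbour of
  \<open>x\<close>.\<close>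

lemma paths_everywhere_contain_broom:
  assumes conn: "connected_graph G" and a: "1 \<le> a" and large: "(3 * a) ^ (2 * a) < v_count G"
    and paths: "\<And>v. v \<in> pverts G \<Longrightarrow> \<exists>ys. gpath G ys \<and> hd ys = v \<and> length ys = 2 * a + 1"
    and x: "x \<in> pverts G" "a \<le> card {y. (x, y) \<in> parcs G}"
  shows "G \<in> containing (broom a)"
proof -
  have G: "pair_graph G" using conn by (simp add: connected_graph_def)
  note finN = finite_nbrs[OF G]
  show ?thesis
  proof (cases "\<exists>z\<in>pverts G. 3 * a \<le> card {y. (z, y) \<in> parcs G}")
    case True
    then obtain z where z: "z \<in> pverts G" "3 * a \<le> card {y. (z, y) \<in> parcs G}" by blast
    obtain ys where ys: "gpath G ys" "hd ys = z" "length ys = 2 * a + 1" using paths[OF z(1)] by blast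
    have set: "nth ys ` {..2 * a} = set ys"
      using ys(3) by (auto simp: set_conv_nth image_def less_Suc_eq_le) 
    have y0: "ys ! 0 = z" using ys(1,2) by (simp add: gpath_def hd_conv_nth)
    show ?thesis
    proof (rule broom_containI[OF G a, where u = "nth ys" and L = "{y. (z, y) \<in> parcs G} - set ys"])
      show "inj_on ((!) ys) {..2 * a}" using ys by (intro inj_on_nth) (auto simp: gpath_def)
      show "(!) ys ` {..2 * a} \<subseteq> pverts G" using ys(1) by (simp add: set gpath_def)
      show "(ys ! i, ys ! Suc i) \<in> parcs G" if "i < 2 * a" for i
        using ys that by (simp add: gpath_def successively_iff_nth)
      show "a - 1 \<le> card ({y. (z, y) \<in> parcs G} - set ys)"
      proof -
        have "card (set ys) \<le> 2 * a + 1" using card_length[of ys] ys(3) by simp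
        moreover have "card {y. (z, y) \<in> parcs G} - card (set ys) \<le> card ({y. (z, y) \<in> parcs G} - set ys)"
          by (rule diff_card_le_card_Diff) simp
        ultimately show ?thesis using z(2) by linarith
      qed
    qed (use pair_graph_adj_verts[OF G] set y0 in auto)
  next
    case False
    have deg: "card {y. (z, y) \<in> parcs G} < 3 * a" for z
    proof (cases "z \<in> pverts G")
      case False
      then have "{y. (z, y) \<in> parcs G} = {}" using pair_graph_adj_verts[OF G] by blast
      then show ?thesis using a by simp
    qed (use False in auto)
    note ball = card_gball[OF G deg]
    have "\<not> pverts G \<subseteq> gball G x (2 * a - 1)"
    proof
      assume "pverts G \<subseteq> gball G x (2 * a - 1)"
      then have "v_count G \<le> card (gball G x (2 * a - 1))" using ball by (intro card_mono) auto
      also have "\<dots> \<le> (3 * a) ^ (2 * a - 1)" using ball by blast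
      also have "\<dots> \<le> (3 * a) ^ (2 * a)" using a by (intro power_increasing) auto
      finally show False using large by simp
    qed
    then have "\<not> (\<forall>u v. u \<in> gball G x (2 * a - 1) \<longrightarrow> (u, v) \<in> parcs G \<longrightarrow> v \<in> gball G x (2 * a - 1))"
      using connected_graph_closed[OF conn, of "gball G x (2 * a - 1)"] x(1)
        gball_mono[of 0 "2 * a - 1" G x] by auto
    then obtain z y where zy: "z \<in> gball G x (2 * a - 1)" "(z, y) \<in> parcs G" "y \<notin> gball G x (2 * a - 1)"
      by blast
    have "y \<in> gball G x (Suc (2 * a - 1))" using zy by auto
    then have yb: "y \<in> gball G x (2 * a)" using a by (simp del: gball.simps)
    have "y \<in> layer G x (2 * a)"
    proof -
      have "y \<notin> gball G x i" if "i < 2 * a" for i 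
      proof -
        have "i \<le> 2 * a - 1" using that by simp
        then show ?thesis using zy(3) gball_mono[of i "2 * a - 1" G x] by blast
      qed
      then show ?thesis using yb by (simp add: layer_def)
    qed
    from layer_path[OF this] obtain u where u: "\<And>i. i \<le> 2 * a \<Longrightarrow> u i \<in> layer G x i"
      "\<And>i. i < 2 * a \<Longrightarrow> (u i, u (Suc i)) \<in> parcs G" by blast
    have u0: "u 0 = x" using u(1)[of 0] by (simp add: layer_def)
    show ?thesis
    proof (rule broom_containI[OF G a, where u = u and L = "{y. (x, y) \<in> parcs G} - {u 1}"])
      show "inj_on u {..2 * a}"
      proof (rule linorder_inj_onI)
        fix i j assume "i < j" "i \<in> {..2 * a}" "j \<in> {..2 * a}"
        then show "u i \<noteq> u j" using u(1)[of i] u(1)[of j] by (auto simp: layer_def)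
      qed auto
      show "u ` {..2 * a} \<subseteq> pverts G"
      proof -
        have "u i \<in> pverts G" if "i \<le> 2 * a" for i
        proof (cases "i = 0")
          case False
          then show ?thesis using pair_graph_adj_verts(2)[OF G u(2)[of "i - 1"]] that by simp
        qed (use u0 x in simp)
        then show ?thesis by auto
      qed
      show "({y. (x, y) \<in> parcs G} - {u 1}) \<inter> u ` {..2 * a} = {}"
      proof -
        have "(x, u i) \<notin> parcs G" if "i \<le> 2 * a" "i \<noteq> 1" for i
        proof
          assume xu: "(x, u i) \<in> parcs G"
          then have "u i \<in> gball G x 1" by simp
          then have "\<not> 1 < i" using u(1)[OF that(1)] by (auto simp: layer_def simp del: gball.simps)
          then have "i = 0" using that(2) by simp
          then show False using xu u0 pair_graph_irrefl[OF G] by simp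
        qed
        then show ?thesis by auto
      qed
      show "a - 1 \<le> card ({y. (x, y) \<in> parcs G} - {u 1})"
        using x(2) diff_card_le_card_Diff[of "{u 1}" "{y. (x, y) \<in> parcs G}"] by simp
    qed (use u u0 pair_graph_adj_verts[OF G] in auto)
  qed
qed

section \<open>Transferring the broom through the game\<close>

context broom_copy
begin

text \<open>Pebbling the centre and \<open>W\<close> yields one fixed position. The game is
  continued from it separately for the rest of the path and for each class; the resulting maps agree
  on the centre and \<open>W\<close>, so the classes can be compared in \<open>H\<close>.\<close>

lemma good_transfer:
  assumes W: "good W" and H: "pair_graph H" and game: "game G H (2 * a + 1) [] []"
  shows "H \<in> containing (broom a)"
proof -
  have WJ: "W \<subseteq> u ` J" and cls: "\<And>T. T \<subseteq> W \<Longrightarrow> card (cls W T) + card W \<le> 2 * a"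
    using W by (auto simp: good_def)
  have finW: "finite W" using finite_subset[OF WJ] fin(1) by simp
  obtain ws where ws: "set ws = W" "distinct ws" using finite_distinct_list[OF finW] by blast
  have lw: "length ws = card W" using distinct_card[OF ws(2)] ws(1) by simp
  have JV: "u ` J \<subseteq> u ` {..2 * a}" using J_sub(2) by blast
  have W2a: "card W \<le> 2 * a" using card_mono[OF _ WJ] fin(1) card_uJ[OF J_sub(2)] J_sub(3) by simp
  have NV: "N \<subseteq> pverts G" using JV u_V L_V by (auto simp: N_def)
  have xV: "u 0 \<in> pverts G" using u_V by auto
  obtain bs where bs: "length bs = Suc (card W)" "set bs \<subseteq> pverts H"
    "game G H (2 * a - card W) (u 0 # ws) bs"
  proof -
    have "set (u 0 # ws) \<subseteq> pverts G" using xV WJ JV u_V ws(1) by auto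
    then show ?thesis using game_play[OF game, of "u 0 # ws"] lw W2a that by auto
  qed
  \<comment> \<open>The answers \<open>bs\<close> to the centre and \<open>W\<close> are the same
    for every \<open>Y\<close>.\<close>
  have ext: "\<exists>\<tau>. map \<tau> (u 0 # ws) = bs \<and> inj_on \<tau> (insert (u 0) (W \<union> Y)) \<and> \<tau> ` Y \<subseteq> pverts H \<and>
      (\<forall>y\<in>insert (u 0) (W \<union> Y). \<forall>z\<in>insert (u 0) (W \<union> Y). (\<tau> y, \<tau> z) \<in> parcs H \<longleftrightarrow> (y, z) \<in> E)"
    if Y: "finite Y" "Y \<subseteq> pverts G" "card Y + card W \<le> 2 * a" for Y
  proof -
    obtain cs where cs: "set cs = Y" "distinct cs" using finite_distinct_list[OF Y(1)] by blast
    then have "length cs = card Y" using distinct_card by fastforce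
    then have "set cs \<subseteq> pverts G" "length cs \<le> 2 * a - card W" using Y cs(1) by auto
    from game_play[OF bs(3) this] obtain ds where ds: "length ds = length cs" "set ds \<subseteq> pverts H"
      "game G H (2 * a - card W - length cs) ((u 0 # ws) @ cs) (bs @ ds)" by blast
    from agree_map[OF game_agree[OF ds(3)]] obtain \<tau> where \<tau>: "map \<tau> ((u 0 # ws) @ cs) = bs @ ds"
      "inj_on \<tau> (set ((u 0 # ws) @ cs))"
      "\<forall>y\<in>set ((u 0 # ws) @ cs). \<forall>z\<in>set ((u 0 # ws) @ cs). (\<tau> y, \<tau> z) \<in> parcs H \<longleftrightarrow> (y, z) \<in> E"
      by (metis (no_types, lifting))
    have m: "map \<tau> (u 0 # ws) = bs" "map \<tau> cs = ds"
      using \<tau>(1) append_eq_append_conv[of "map \<tau> (u 0 # ws)" bs "map \<tau> cs" ds] bs(1) lw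
      unfolding map_append by simp_all
    have "\<tau> ` Y = set ds" using m(2) cs(1) by auto
    moreover have "set ((u 0 # ws) @ cs) = insert (u 0) (W \<union> Y)" using ws(1) cs(1) by auto
    ultimately show ?thesis using m(1) \<tau>(2,3) ds(2) by (intro exI[of _ \<tau>]) simp
  qed
  define R where "R = u ` {1..2 * a} - W"
  have W1: "W \<subseteq> u ` {1..2 * a}" using WJ J_sub(1) by blast
  have "card R = 2 * a - card W"
    unfolding R_def using card_Diff_subset[OF finW W1] card_uJ[of "{1..2 * a}"] by simp
  then have R: "finite R" "R \<subseteq> pverts G" "card R + card W \<le> 2 * a" using u_V W2a by (auto simp: R_def)
  from ext[OF R] obtain \<tau> where \<tau>: "map \<tau> (u 0 # ws) = bs" "inj_on \<tau> (insert (u 0) (W \<union> R))"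
    "\<tau> ` R \<subseteq> pverts H"
    "\<forall>y\<in>insert (u 0) (W \<union> R). \<forall>z\<in>insert (u 0) (W \<union> R). (\<tau> y, \<tau> z) \<in> parcs H \<longleftrightarrow> (y, z) \<in> E"
    by (elim exE conjE)
  have P: "insert (u 0) (W \<union> R) = u ` {..2 * a}"
  proof -
    have "{..2 * a} = insert 0 {1..2 * a}" by auto
    then show ?thesis using W1 by (auto simp: R_def)
  qed
  have \<tau>E: "(\<tau> y, \<tau> z) \<in> parcs H \<longleftrightarrow> (y, z) \<in> E" if "y \<in> u ` {..2 * a}" "z \<in> u ` {..2 * a}" for y z
    using \<tau>(4) that unfolding P by blast
  have \<tau>P: "\<tau> ` u ` {..2 * a} \<subseteq> pverts H"
  proof -
    have "\<tau> ` insert (u 0) W = set bs" using arg_cong[OF \<tau>(1), of set] ws(1) by simp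
    then show ?thesis using \<tau>(3) bs(2) unfolding P[symmetric] by auto
  qed
  define x' where "x' = \<tau> (u 0)"
  \<comment> \<open>The counterpart of \<open>cls W T\<close> in \<open>H\<close>, taken among all
    neighbours of the image of the centre.\<close>
  define K' where "K' T = {y. (x', y) \<in> parcs H \<and> y \<notin> \<tau> ` W \<and> (\<forall>w\<in>W. (\<tau> w, y) \<in> parcs H \<longleftrightarrow> w \<in> T)}" for T
  have finK': "finite (K' T)" for T
    by (rule finite_subset[OF _ finite_nbrs[OF H, of x']]) (auto simp: K'_def)
  have Nx: "(u 0, y) \<in> E" if "y \<in> N" for y using that L_E by (auto simp: N_def J_def)
  have cK: "card (cls W T) \<le> card (K' T)" if T: "T \<subseteq> W" for T
  proof -
    have sub: "cls W T \<subseteq> N" by (auto simp: cls_def)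
    have "cls W T \<subseteq> pverts G" using sub NV by blast
    from ext[OF finite_subset[OF sub fin(3)] this cls[OF T]] obtain \<sigma> where \<sigma>:
      "map \<sigma> (u 0 # ws) = bs" "inj_on \<sigma> (insert (u 0) (W \<union> cls W T))"
      and "\<forall>y\<in>insert (u 0) (W \<union> cls W T). \<forall>z\<in>insert (u 0) (W \<union> cls W T).
         (\<sigma> y, \<sigma> z) \<in> parcs H \<longleftrightarrow> (y, z) \<in> E"
      by (elim exE conjE)
    then have \<sigma>E: "(\<sigma> y, \<sigma> z) \<in> parcs H \<longleftrightarrow> (y, z) \<in> E"
      if "y \<in> insert (u 0) (W \<union> cls W T)" "z \<in> insert (u 0) (W \<union> cls W T)" for y z
      using that by blast
    have same: "\<sigma> (u 0) = x'" "\<And>w. w \<in> W \<Longrightarrow> \<sigma> w = \<tau> w"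
    proof -
      have "map \<sigma> (u 0 # ws) = map \<tau> (u 0 # ws)" using \<sigma>(1) \<tau>(1) by simp
      then show "\<sigma> (u 0) = x'" "\<And>w. w \<in> W \<Longrightarrow> \<sigma> w = \<tau> w" using ws(1) by (auto simp: x'_def)
    qed
    have "\<sigma> ` cls W T \<subseteq> K' T"
    proof
      fix y' assume "y' \<in> \<sigma> ` cls W T"
      then obtain y where y: "y \<in> cls W T" "y' = \<sigma> y" by blast
      have "(x', y') \<in> parcs H" using \<sigma>E[of "u 0" y] Nx[of y] y sub same(1) by auto
      moreover have "y' \<notin> \<tau> ` W"
      proof
        assume "y' \<in> \<tau> ` W"
        then obtain w where w: "w \<in> W" "\<sigma> y = \<sigma> w" using y same(2) by auto
        then have "y = w" using inj_onD[OF \<sigma>(2), of y w] y by auto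
        then show False using w y by (auto simp: cls_def)
      qed
      moreover have "(\<tau> w, y') \<in> parcs H \<longleftrightarrow> w \<in> T" if "w \<in> W" for w
        using \<sigma>E[of w y] same(2)[OF that] that y by (auto simp: cls_def)
      ultimately show "y' \<in> K' T" by (auto simp: K'_def)
    qed
    moreover have "inj_on \<sigma> (cls W T)" by (rule inj_on_subset[OF \<sigma>(2)]) auto
    ultimately show ?thesis using card_inj_on_le[OF _ _ finK'] by blast
  qed
  let ?P = "\<tau> ` u ` {..2 * a}"
  \<comment> \<open>\<open>\<tau>\<close> preserves adjacency on the whole path, so elements of
    \<open>K' T\<close> on its image come from path elements of \<open>cls W T\<close>. What
    \<open>K' T\<close> has outside the image is therefore at least as large as the leaf part of the
    class.\<close>
  have cKL: "card (cls W T \<inter> L) \<le> card (K' T - ?P)" if T: "T \<subseteq> W" for T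
  proof -
    have sub: "K' T \<inter> ?P \<subseteq> \<tau> ` (cls W T \<inter> u ` {..2 * a})"
    proof
      fix y' assume y': "y' \<in> K' T \<inter> ?P"
      then obtain y where y: "y \<in> u ` {..2 * a}" "y' = \<tau> y" by blast
      have "y \<notin> W" using y' y by (auto simp: K'_def)
      have "(u 0, y) \<in> E" using \<tau>E[of "u 0" y] y y' by (auto simp: K'_def x'_def)
      moreover have "y \<noteq> u 0" using calculation irrefl by auto
      moreover obtain i where "i \<le> 2 * a" "y = u i" using y by auto
      moreover from calculation have "i \<noteq> 0" by (cases "i = 0") auto
      ultimately have "y \<in> N" by (auto simp: N_def J_def)
      moreover have "(w, y) \<in> E \<longleftrightarrow> w \<in> T" if "w \<in> W" for w
      proof -
        have "w \<in> u ` {..2 * a}" using WJ JV that by blast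
        then show ?thesis using \<tau>E[of w y] y y' that by (auto simp: K'_def)
      qed
      ultimately have "y \<in> cls W T" using \<open>y \<notin> W\<close> by (auto simp: cls_def)
      then show "y' \<in> \<tau> ` (cls W T \<inter> u ` {..2 * a})" using y by blast
    qed
    have "card (K' T \<inter> ?P) \<le> card (\<tau> ` (cls W T \<inter> u ` {..2 * a}))" by (rule card_mono[OF _ sub]) auto
    also have "\<dots> \<le> card (cls W T \<inter> u ` {..2 * a})" by (rule card_image_le) simp
    finally have 1: "card (K' T \<inter> ?P) \<le> card (cls W T \<inter> u ` {..2 * a})" .
    have finc: "finite (cls W T)" using fin(3) by (simp add: cls_def)
    have "cls W T = (cls W T \<inter> L) \<union> (cls W T \<inter> u ` {..2 * a})"
      using JV by (auto simp: cls_def N_def)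
    then have "card (cls W T) = card (cls W T \<inter> L) + card (cls W T \<inter> u ` {..2 * a})"
      using card_Un_disjoint[of "cls W T \<inter> L" "cls W T \<inter> u ` {..2 * a}"] finc L_u by auto
    moreover have "card (K' T) = card (K' T - ?P) + card (K' T \<inter> ?P)"
      using card_Int_Diff[OF finK', of T ?P] by simp
    ultimately show ?thesis using 1 cK[OF T] by linarith
  qed
  \<comment> \<open>Different patterns give disjoint sets, so the leaf counts of the classes add
    up.\<close>
  define L' where "L' = (\<Union>T\<in>Pow W. K' T - ?P)"
  have "card L \<le> card L'"
  proof -
    have "L \<subseteq> (\<Union>T\<in>Pow W. cls W T \<inter> L)"
    proof
      fix l assume l: "l \<in> L"
      have "l \<notin> W" using l L_u WJ JV by blast
      then have "l \<in> cls W {w\<in>W. (w, l) \<in> E}" using l by (auto simp: cls_def N_def)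
      moreover have "{w\<in>W. (w, l) \<in> E} \<in> Pow W" by auto
      ultimately show "l \<in> (\<Union>T\<in>Pow W. cls W T \<inter> L)" using l by (intro UN_I) auto
    qed
    then have "card L \<le> card (\<Union>T\<in>Pow W. cls W T \<inter> L)" using finW fin(2) by (intro card_mono) auto
    also have "\<dots> \<le> (\<Sum>T\<in>Pow W. card (cls W T \<inter> L))" by (rule card_UN_le) (use finW in simp)
    also have "\<dots> \<le> (\<Sum>T\<in>Pow W. card (K' T - ?P))" by (rule sum_mono) (use cKL in auto)
    also have "\<dots> = card L'"
      unfolding L'_def
    proof (rule card_UN_disjoint[symmetric])
      show "\<forall>T\<in>Pow W. \<forall>T'\<in>Pow W. T \<noteq> T' \<longrightarrow> (K' T - ?P) \<inter> (K' T' - ?P) = {}"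
      proof (intro ballI impI)
        fix T T' assume "T \<in> Pow W" "T' \<in> Pow W" "T \<noteq> T'"
        then obtain w where "w \<in> W" "w \<in> T \<longleftrightarrow> w \<notin> T'" by blast
        then show "(K' T - ?P) \<inter> (K' T' - ?P) = {}" by (auto simp: K'_def)
      qed
    qed (use finW finK' in auto)
    finally show ?thesis .
  qed
  show ?thesis
  proof (rule broom_containI[OF H a1, where u = "\<tau> \<circ> u" and L = L'])
    show "inj_on (\<tau> \<circ> u) {..2 * a}" using u_inj \<tau>(2) unfolding P by (rule comp_inj_on)
    show "(\<tau> \<circ> u) ` {..2 * a} \<subseteq> pverts H" using \<tau>P by (simp add: image_comp)
    show "((\<tau> \<circ> u) i, (\<tau> \<circ> u) (Suc i)) \<in> parcs H" if "i < 2 * a" for i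
      using \<tau>E[of "u i" "u (Suc i)"] u_E[OF that] that by auto
    show "L' \<subseteq> pverts H" using pair_graph_adj_verts[OF H] by (auto simp: L'_def K'_def)
    show "L' \<inter> (\<tau> \<circ> u) ` {..2 * a} = {}" by (auto simp: L'_def)
    show "a - 1 \<le> card L'" using \<open>card L \<le> card L'\<close> L_card by simp
    show "((\<tau> \<circ> u) 0, l) \<in> parcs H" if "l \<in> L'" for l using that by (auto simp: L'_def K'_def x'_def)
  qed
qed

end

lemma gpath_agree:
  assumes "agree G H as bs" "gpath G as" "set bs \<subseteq> pverts H"
  shows "gpath H bs"
  using assms unfolding gpath_def successively_iff_nth agree_def distinct_conv_nth by (auto; metis Suc_lessD)

text \<open>If every vertex of \<open>G\<close> starts a path with \<open>2 * a\<close> edges, this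
  property passes to \<open>H\<close>, and so does a vertex with \<open>a\<close> neighbours; in a
  large graph these two suffice. Otherwise some vertex starts no such path, and a good
  \<open>W\<close> exists.\<close>

lemma broom_game_invariant:
  assumes G: "connected_graph G" and H: "connected_graph H" and a: "1 \<le> a"
    and large: "(3 * a) ^ (2 * a) < v_count H" and game: "game G H (2 * a + 1) [] []"
    and F: "G \<in> containing (broom a)"
  shows "H \<in> containing (broom a)"
proof -
  have pG: "pair_graph G" and pH: "pair_graph H" using G H by (auto simp: connected_graph_def)
  obtain u L where u: "inj_on u {..2 * a}" "u ` {..2 * a} \<subseteq> pverts G"
    "\<And>i. i < 2 * a \<Longrightarrow> (u i, u (Suc i)) \<in> parcs G"
    and L: "L \<subseteq> pverts G" "L \<inter> u ` {..2 * a} = {}" "card L = a - 1" "\<And>l. l \<in> L \<Longrightarrow> (u 0, l) \<in> parcs G"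
    by (rule broom_containE[OF F a]) blast
  show ?thesis
  proof (cases "\<forall>v\<in>pverts G. \<exists>ys. gpath G ys \<and> hd ys = v \<and> length ys = 2 * a + 1")
    case True
    have paths: "\<exists>ys. gpath H ys \<and> hd ys = y \<and> length ys = 2 * a + 1" if y: "y \<in> pverts H" for y
    proof -
      obtain ds where ds: "length ds = 1" "set ds \<subseteq> pverts G" "game H G (2 * a) [y] ds"
        using game_play[OF game_sym[OF game], of "[y]"] y by auto
      then obtain x where x: "ds = [x]" by (cases ds) auto
      then obtain ys where ys: "gpath G ys" "hd ys = x" "length ys = 2 * a + 1" using True ds(2) by auto
      then obtain ys' where ys': "ys = x # ys'" by (cases ys) auto
      obtain zs where zs: "length zs = length ys'" "set zs \<subseteq> pverts H"
        "game G H (2 * a - length ys') ([x] @ ys') ([y] @ zs)"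
        using game_play[OF game_sym[OF ds(3)], of ys'] ys ys' x by (auto simp: gpath_def)
      have "gpath H ([y] @ zs)"
        by (rule gpath_agree[OF game_agree[OF zs(3)]]) (use ys(1) ys' zs(2) y in auto)
      then show ?thesis using zs(1) ys(3) ys' by (intro exI[of _ "[y] @ zs"]) auto
    qed
    \<comment> \<open>The leaves and the first path vertex are \<open>a\<close> neighbours of the
      centre; pebbling them after the centre takes \<open>a + 1\<close> moves.\<close>
    let ?Y = "insert (u 1) L"
    have finL: "finite L" by (rule finite_subset[OF L(1) pair_graph_finite[OF pG]])
    have u1: "u 1 \<in> u ` {..2 * a}" using a by auto
    have "u 1 \<notin> L" using u1 L(2) by blast
    then have cY: "card ?Y = a" using finL L(3) a by simp
    have Y: "?Y \<subseteq> pverts G" "u 0 \<in> pverts G" using L(1) u(2) u1 by auto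
    have YE: "(u 0, y) \<in> parcs G" if "y \<in> ?Y" for y using that L(4) u(3)[of 0] a by auto
    obtain cs where cs: "set cs = ?Y" "distinct cs" using finite_distinct_list[of ?Y] finL by auto
    have lc: "length cs = a" using distinct_card[OF cs(2)] cs(1) cY by simp
    obtain ds where ds: "length ds = length (u 0 # cs)" "set ds \<subseteq> pverts H"
      "game G H (2 * a + 1 - length (u 0 # cs)) ([] @ u 0 # cs) ([] @ ds)"
      using game_play[OF game, of "u 0 # cs"] Y cs(1) lc by auto
    obtain \<tau> where \<tau>: "map \<tau> ([] @ u 0 # cs) = [] @ ds" "inj_on \<tau> (set ([] @ u 0 # cs))"
      "\<And>y z. y \<in> set ([] @ u 0 # cs) \<Longrightarrow> z \<in> set ([] @ u 0 # cs) \<Longrightarrow> (\<tau> y, \<tau> z) \<in> parcs H \<longleftrightarrow> (y, z) \<in> parcs G"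
      by (rule agree_map[OF game_agree[OF ds(3)]]) blast
    have "\<tau> ` ?Y \<subseteq> {y. (\<tau> (u 0), y) \<in> parcs H}" using \<tau>(3) YE cs(1) by auto
    moreover have "card (\<tau> ` ?Y) = a"
      using cY card_image[OF inj_on_subset[OF \<tau>(2)], of ?Y] cs(1) by auto
    ultimately have "a \<le> card {y. (\<tau> (u 0), y) \<in> parcs H}"
      using card_mono[OF finite_nbrs[OF pH]] by metis
    moreover have "\<tau> (u 0) \<in> pverts H" using \<tau>(1) ds(2) by auto
    ultimately show ?thesis by (intro paths_everywhere_contain_broom[OF H a large paths])
  next
    case False
    then obtain v where v: "v \<in> pverts G" "\<And>ys. gpath G ys \<Longrightarrow> hd ys = v \<Longrightarrow> length ys \<noteq> 2 * a + 1"
      by blast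
    have np: "length ys \<le> 2 * a" if ys: "gpath G ys" "hd ys = v" for ys
    proof (rule ccontr)
      assume "\<not> length ys \<le> 2 * a"
      then have "length (take (2 * a + 1) ys) = 2 * a + 1" by simp
      moreover have "gpath G (take (2 * a + 1) ys)" by (rule gpath_take[OF ys(1)]) simp
      moreover have "hd (take (2 * a + 1) ys) = v" using ys(2) by simp
      ultimately show False using v(2) by blast
    qed
    interpret broom_copy G a u L v
      by unfold_locales (use G u L a v(1) np in auto)
    obtain W where "good W" using ex_good by blast
    then show ?thesis using pH game by (rule good_transfer)
  qed
qed

section \<open>Depth bound for the family of brooms\<close>

lemma D'_broom:
  assumes a: "1 \<le> a"
  shows "D' (broom a) \<le> 2 * a + 1"
proof -
  obtain p where p: "sentence p" "qdepth p \<le> 2 * a + 1"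
    "\<And>G. connected_graph G \<and> (3 * a) ^ (2 * a) < v_count G \<Longrightarrow> models G p \<longleftrightarrow> G \<in> containing (broom a)"
  proof (rule game_invariant_definable[of "2 * a + 1" "\<lambda>G. connected_graph G \<and> (3 * a) ^ (2 * a) < v_count G"
        "containing (broom a)"])
    show "pverts G \<noteq> {}" if "connected_graph G \<and> (3 * a) ^ (2 * a) < v_count G" for G
      using that by (simp add: connected_graph_iff)
  qed (use broom_game_invariant[OF _ _ a] in auto)
  have "defines_asymptotically p (containing (broom a))"
    unfolding defines_asymptotically_def
    using p(1,3) by (intro conjI exI[of _ "Suc ((3 * a) ^ (2 * a))"]) (auto simp: Suc_le_eq)
  then have "D' (broom a) \<le> qdepth p" unfolding D'_def by (intro Least_le) blast
  then show ?thesis using p(2) by simp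
qed

lemma graph_iso_v_count:
  assumes "graph_iso F F'"
  shows "v_count F = v_count F'"
proof -
  obtain h where h: "pre_digraph.digraph_isomorphism (with_proj F) h" "with_proj F' = app_iso h (with_proj F)"
    using assms unfolding graph_iso_def digraph_iso_def by blast
  have "pverts F' = iso_verts h ` pverts F"
    using arg_cong[OF h(2), of verts] by (simp add: app_iso_def)
  moreover have "inj_on (iso_verts h) (pverts F)"
    using h(1) unfolding pre_digraph.digraph_isomorphism_def by simp
  ultimately show ?thesis by (simp add: card_image)
qed

lemma v_count_broom: "v_count (broom a) = 3 * a"
  by (simp add: broom_def)

text \<open>Infinitely many graphs are meant up to isomorphism; the brooms are told apart by their
  numbers of vertices \<open>3 * a\<close>.\<close>

theorem depth_upper_bound:
  "\<exists>\<F> :: ngraph set. infinite \<F> \<and>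
     (\<forall>F\<in>\<F>. \<forall>F'\<in>\<F>. graph_iso F F' \<longrightarrow> F = F') \<and>
     (\<forall>F\<in>\<F>. connected_graph F \<and> real (D' F) \<le> 2 / 3 * real (v_count F) + 1)"
proof (intro exI[of _ "broom ` {1..}"] conjI ballI impI)
  have inj: "inj_on broom {1..}"
  proof (rule inj_onI)
    fix a b assume "broom a = broom b"
    then have "v_count (broom a) = v_count (broom b)" by simp
    then show "a = b" by (simp add: v_count_broom)
  qed
  show "infinite (broom ` {1..})"
    using finite_image_iff[OF inj] infinite_Ici[of "1 :: nat"] by blast
next
  fix F F' assume "F \<in> broom ` {1..}" "F' \<in> broom ` {1..}" "graph_iso F F'"
  then show "F = F'" using graph_iso_v_count[of F F'] by (auto simp: v_count_broom)
next
  fix F assume "F \<in> broom ` {1..}"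
  then obtain a where a: "1 \<le> a" "F = broom a" by auto
  then show "connected_graph F" using connected_broom by simp
  have "real (D' F) \<le> real (2 * a + 1)" using D'_broom[OF a(1)] a(2) by (simp only: of_nat_le_iff)
  then show "real (D' F) \<le> 2 / 3 * real (v_count F) + 1" using a(2) by (simp add: v_count_broom)
qed

theorem theorem2:
  shows "(\<exists>\<F> :: ngraph set. infinite \<F> \<and>
            (\<forall>F\<in>\<F>. \<forall>F'\<in>\<F>. graph_iso F F' \<longrightarrow> F = F') \<and>
            (\<forall>F\<in>\<F>. connected_graph F \<and> real (D' F) \<le> 2 / 3 * real (v_count F) + 1)) \<and>
         (\<forall>F :: ngraph. connected_graph F \<longrightarrow> real (W' F) > 2 / 3 * real (v_count F) - 2)"
  using depth_upper_bound width_lower_bound by blast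

end
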